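(* Let $a,\alpha,p,q$ be as in the context, let $M(a,\alpha,p,q)$ be the associated germ at $(0,0)$ of a real hypersurface in $\mathbb C^2$, and for $t\in\mathbb R$ let $\phi^{a,\alpha}_t$ be the germ at the origin of the holomorphic map $$ \phi^{a,\alpha}_t(z_1,z_2)= \begin{cases} \Big(-\frac{1}{\alpha} \log\Big[1+(e^{-\alpha z_1}-1) \exp\big(\int_0^t a(z_2e^{i\tau})\,d\tau \big)\Big],\; z_2 e^{it}\Big)&\text{if }\alpha\ne 0,\\ \Big(z_1 \exp\big(\int_0^t a(z_2e^{i\tau})\,d\tau \big),\; z_2 e^{it}\Big)&\text{if } \alpha=0. \end{cases} $$ Then $$\mathrm{Aut}\big(M(a,\alpha,p,q),0\big)=\{\phi^{a,\alpha}_t : t\in \mathbb R\}.$$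
   Context: For a real hypersurface germ $M$ at $0\in\mathbb C^2$, $\mathrm{Aut}(M,0)$ (the stability group) is the group of germs at $0$ of biholomorphisms of $\mathbb C^2$ fixing $0$ and mapping $M$ into itself. Write $\Delta_r=\{z\in\mathbb C: |z|<r\}$ and $\Delta_r^*=\Delta_r\setminus\{0\}$. A $\mathcal C^\infty$-smooth function vanishes to infinite order at a point if all its partial derivatives of all orders (including order $0$) vanish there. Data: $\epsilon_0>0$; $\alpha\in\mathbb R$; $a(z)=\sum_{n=1}^\infty a_n z^n$ is a nonzero holomorphic function on $\Delta_{\epsilon_0}$; $p$ and $q$ are real-valued $\mathcal C^\infty$-smooth functions on $(0,\epsilon_0)$ and $[0,\epsilon_0)$ respectively, such that $q(0)=0$ and the function $g$ on $\Delta_{\epsilon_0}$ given by $g(z)=e^{p(|z|)}$ for $0<|z|<\epsilon_0$, $g(0)=0$, is $\mathcal C^\infty$-smooth and vanishes to infinite order at $0$. Set $R(z_2)=q(|z_2|)-\mathrm{Re}\big(\sum_{n=1}^\infty\frac{a_n}{n}z_2^n\big)$ and $$P_1(z_2)=\exp\Big[p(|z_2|)+\mathrm{Re}\Big(\sum_{n=1}^\infty\frac{a_n}{in}z_2^n\Big)-\log|\cos(R(z_2))|\Big]\ (z_2\neq 0),\qquad P_1(0)=0.$$ Let $P(z_2)=\frac1\alpha\log[1+\alpha P_1(z_2)]$ if $\alpha\ne0$ and $P=P_1$ if $\alpha=0$. Let $F(z_2,t)=-\frac1\alpha\log\Big|\frac{\cos(R(z_2)+\alpha t)}{\cos(R(z_2))}\Big|$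 if $\alpha\neq0$ and $F(z_2,t)=\tan(R(z_2))\,t$ if $\alpha=0$, for $(z_2,t)\in\Delta_{\epsilon_0}\times(-\delta_0,\delta_0)$. Here $\epsilon_0,\delta_0>0$ are taken small enough that these expressions are defined. $M(a,\alpha,p,q)$ is the germ at $(0,0)$ of the real hypersurface in $\mathbb C^2$ defined by $\rho(z_1,z_2):=\mathrm{Re}\,z_1+P(z_2)+F(z_2,\mathrm{Im}\,z_1)=0$. Hypersurfaces are $\mathcal C^\infty$-smooth throughout (so $P$ and $F$ are $\mathcal C^\infty$-smooth near the origin). In the formula for $\phi^{a,\alpha}_t$, $\log$ is the principal branch near $1$. *)

theory Defs
  imports "HOL-Analysis.Analysis"
begin

(* partials S [v1, ..., vk] f is the iterated directional derivative d_v1 ... d_vk f.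
   Derivatives are taken within S, which matters only at points of S that are not interior,
   such as the end point 0 of {0..<e}, where they are one-sided. *)
fun partials :: "'a::euclidean_space set \<Rightarrow> 'a list \<Rightarrow> ('a \<Rightarrow> 'b::real_normed_vector) \<Rightarrow> 'a \<Rightarrow> 'b" where
  "partials S [] f = f"
| "partials S (v # vs) f = (\<lambda>x. frechet_derivative (partials S vs f) (at x within S) v)"

(* Smoothness in the real sense. Total differentiability of every iterated partial derivative
   makes all of them continuous. Meant for open S and for real intervals,
   where derivatives within S are unique. *)
definition smooth_on :: "'a::euclidean_space set \<Rightarrow> ('a \<Rightarrow> 'b::real_normed_vector) \<Rightarrow> bool" where
  "smooth_on S f \<longleftrightarrow> (\<forall>vs \<in> lists Basis. partials S vs f differentiable_on S)"

definition vanishes_to_infinite_order :: "('a::euclidean_space \<Rightarrow> 'b::real_normed_vector) \<Rightarrow> 'a \<Rightarrow> bool" where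
  "vanishes_to_infinite_order f x \<longleftrightarrow> (\<forall>vs \<in> lists Basis. partials UNIV vs f x = 0)"

definition holomorphic2_on :: "(complex \<times> complex \<Rightarrow> complex \<times> complex) \<Rightarrow> (complex \<times> complex) set \<Rightarrow> bool" where
  "holomorphic2_on f U \<longleftrightarrow>
     (\<forall>x\<in>U. \<exists>L. (f has_derivative L) (at x) \<and>
        (\<forall>c v w. L (c * v, c * w) = (c * fst (L (v, w)), c * snd (L (v, w)))))"

definition biholomorphic2 ::
  "(complex \<times> complex \<Rightarrow> complex \<times> complex) \<Rightarrow> (complex \<times> complex) set \<Rightarrow> (complex \<times> complex) set \<Rightarrow> bool" where
  "biholomorphic2 f U V \<longleftrightarrow> open U \<and> open V \<and> bij_betw f U V \<and>
     holomorphic2_on f U \<and> holomorphic2_on (inv_into U f) V"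

(* The germ of f at the origin, as a class of total functions agreeing with f near 0. *)
definition germ :: "('a::{topological_space,zero} \<Rightarrow> 'b) \<Rightarrow> ('a \<Rightarrow> 'b) set" where
  "germ f = {g. \<forall>\<^sub>F x in nhds 0. g x = f x}"

(* Depends on M only through its germ at the origin. *)
definition stability_group ::
  "(complex \<times> complex) set \<Rightarrow> (complex \<times> complex \<Rightarrow> complex \<times> complex) set set" where
  "stability_group M = {germ f | f.
     (\<exists>U V. 0 \<in> U \<and> biholomorphic2 f U V) \<and> f 0 = 0 \<and>
     (\<forall>\<^sub>F x in nhds 0. x \<in> M \<longrightarrow> f x \<in> M)}"

(* Below, c n is the coefficient of z^n in a; since the sums start at n = 1,
   c 0 is never used. *)

definition flat_fun :: "(real \<Rightarrow> real) \<Rightarrow> complex \<Rightarrow> real" where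
  "flat_fun p z = (if z = 0 then 0 else exp (p (cmod z)))"

definition R_fun :: "(nat \<Rightarrow> complex) \<Rightarrow> (real \<Rightarrow> real) \<Rightarrow> complex \<Rightarrow> real" where
  "R_fun c q z = q (cmod z) - Re (\<Sum>n. c (Suc n) / of_nat (Suc n) * z ^ Suc n)"

definition P1_fun ::
  "(nat \<Rightarrow> complex) \<Rightarrow> (real \<Rightarrow> real) \<Rightarrow> (real \<Rightarrow> real) \<Rightarrow> complex \<Rightarrow> real" where
  "P1_fun c p q z =
     (if z = 0 then 0
      else exp (p (cmod z) + Re (\<Sum>n. c (Suc n) / (\<i> * of_nat (Suc n)) * z ^ Suc n)
                - ln \<bar>cos (R_fun c q z)\<bar>))"

definition P_fun ::
  "(nat \<Rightarrow> complex) \<Rightarrow> real \<Rightarrow> (real \<Rightarrow> real) \<Rightarrow> (real \<Rightarrow> real) \<Rightarrow> complex \<Rightarrow> real" where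
  "P_fun c \<alpha> p q z =
     (if \<alpha> = 0 then P1_fun c p q z else 1 / \<alpha> * ln (1 + \<alpha> * P1_fun c p q z))"

definition F_fun ::
  "(nat \<Rightarrow> complex) \<Rightarrow> real \<Rightarrow> (real \<Rightarrow> real) \<Rightarrow> complex \<Rightarrow> real \<Rightarrow> real" where
  "F_fun c \<alpha> q z t =
     (if \<alpha> = 0 then tan (R_fun c q z) * t
      else - (1 / \<alpha>) * ln \<bar>cos (R_fun c q z + \<alpha> * t) / cos (R_fun c q z)\<bar>)"

(* A representative, on |z2| < e and |Im z1| < d, of the hypersurface germ. *)
definition hypersurface ::
  "real \<Rightarrow> real \<Rightarrow> (nat \<Rightarrow> complex) \<Rightarrow> real \<Rightarrow> (real \<Rightarrow> real) \<Rightarrow> (real \<Rightarrow> real) \<Rightarrow> (complex \<times> complex) set" where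
  "hypersurface e d c \<alpha> p q =
     {(z1, z2). cmod z2 < e \<and> \<bar>Im z1\<bar> < d \<and>
        Re z1 + P_fun c \<alpha> p q z2 + F_fun c \<alpha> q z2 (Im z1) = 0}"

(* The interval integral is oriented, so negative t is covered. *)
definition phi ::
  "(complex \<Rightarrow> complex) \<Rightarrow> real \<Rightarrow> real \<Rightarrow> complex \<times> complex \<Rightarrow> complex \<times> complex" where
  "phi a \<alpha> t = (\<lambda>(z1, z2).
     let E = exp (LBINT \<tau>=ereal 0..ereal t. a (z2 * exp (\<i> * of_real \<tau>)))
     in (if \<alpha> = 0 then z1 * E
         else - (1 / of_real \<alpha>) * Ln (1 + (exp (- of_real \<alpha> * z1) - 1) * E),
         z2 * exp (\<i> * of_real t)))"

end

theory Submission
  imports Defs "HOL-Complex_Analysis.Complex_Analysis"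
begin

text \<open>
  The theorem becomes transparent in coordinates in which the hypersurface is invariant under
  rotations. Let \<open>A(z)\<close> be the sum of the \<open>c n / n * z^n\<close> over \<open>n \<ge> 1\<close> (below: \<open>antideriv\<close>), so that
  \<open>z * A'(z) = a(z)\<close>. The map
  \<open>Phi(z1, z2) = ((exp(- \<alpha> z1) - 1) / \<alpha> * exp(\<i> A(z2)), z2)\<close>, with \<open>- z1 * exp(\<i> A(z2))\<close> as first
  component when \<open>\<alpha> = 0\<close>, is biholomorphic near the origin. It carries the hypersurface to the model
  \<open>Re (Z * exp(- \<i> q|z|)) = G|z|\<close> with \<open>G = exp \<circ> p\<close> (lemma \<open>membership\<close>), and it turns the maps of the
  statement into the rotations \<open>(Z, z) \<mapsto> (Z, exp(\<i> t) z)\<close>. The model depends on \<open>z\<close> only through \<open>|z|\<close>,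
  so the rotations preserve it, which is one inclusion.

  For the other inclusion let \<open>(U, V)\<close> be a local biholomorphism that fixes the origin and maps the
  model into itself. For every constant \<open>\<omega>\<close> with \<open>Re \<omega> = 1\<close> the points with
  \<open>Z = \<omega> * exp(\<i> q|z|) * G|z|\<close> lie on the model, and \<open>Z\<close> is flat as a function of \<open>z\<close>: it is smaller
  than every power of \<open>|z|\<close>. Inserting these points into \<open>Re (U * exp(- \<i> q|V|)) = G|V|\<close> and expanding
  in powers of \<open>Z\<close> separates the orders \<open>1, G, G^2, ...\<close>, each up to flat errors, and a holomorphic
  function of \<open>z\<close> that is flat vanishes.

  Order \<open>1\<close>: the real part of \<open>U(0, z) * exp(- \<i> q|V|)\<close> is flat, which forces \<open>U(0, z) = 0\<close> (\<open>U0_eq_0\<close>).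

  Order \<open>G\<close>: let \<open>u(z)\<close> be the coefficient of \<open>Z\<close> in \<open>U\<close> and \<open>w(z) = u(z) * exp(\<i> (q|z| - q|V(0, z)|))\<close>.
  Then \<open>Im w\<close> and \<open>Re w - G|V(0, z)| / G|z|\<close> are flat (\<open>first_order\<close>). So \<open>V(0, z)\<close> changes \<open>G\<close> by a
  bounded factor. At a maximum of \<open>G(x) / x^N\<close> with \<open>N\<close> large this is impossible if \<open>V(0, z)\<close> contracts
  or expands, so its derivative \<open>b\<close> at \<open>0\<close> is unimodular. Then every small circle contains a point with
  \<open>|V(0, z)| = |z|\<close>; there \<open>u - 1\<close> is as small as any power of \<open>|z|\<close>, whence \<open>u = 1\<close> (\<open>u_eq_1\<close>). Now \<open>V(0, z)\<close>
  changes \<open>G\<close> only by a factor \<open>1 + flat\<close>, and at a maximum of \<open>G(x) * exp(- x)\<close> this is impossible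
  unless \<open>V(0, z) = b z\<close> (\<open>V0_linear\<close>).

  Order \<open>G^(n+1)\<close>, by induction on \<open>n \<ge> 1\<close>: the coefficients of \<open>Z^(n+1)\<close> in \<open>U\<close> and of \<open>Z^n\<close> in \<open>V\<close> satisfy,
  up to a flat error, an equation that is a trigonometric polynomial in the argument of \<open>\<omega>\<close> with
  the frequencies \<open>n + 1\<close> and \<open>n - 1\<close> (\<open>higher_order\<close>, \<open>flat_amplitudes\<close>). Separating the two, and using that \<open>G'/G\<close>
  is not bounded by a multiple of \<open>1/|z|\<close>, gives that both coefficients vanish
  (\<open>higher_coefficients_vanish\<close>). Hence \<open>U = Z\<close> and \<open>V = b z\<close> (\<open>rotation\<close>).
\<close>

section \<open>Orders of vanishing at the origin\<close>

text \<open>Functions of \<open>z\<close> are compared as \<open>z\<close> tends to \<open>0\<close>. This is the big-O relation; the two functions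
  may take values in different spaces, and the weight \<open>g\<close> may have any sign.\<close>

definition dominated :: "(complex \<Rightarrow> 'b::real_normed_vector) \<Rightarrow> (complex \<Rightarrow> real) \<Rightarrow> bool" where
  "dominated f g \<longleftrightarrow> (\<exists>C>0. \<forall>\<^sub>F z in at 0. norm (f z) \<le> C * \<bar>g z\<bar>)"

text \<open>The quotient of \<open>f\<close> by \<open>g\<close> vanishes to infinite order, in a form that makes sense at zeros of \<open>g\<close>.\<close>

definition flat_wrt :: "(complex \<Rightarrow> 'b::real_normed_vector) \<Rightarrow> (complex \<Rightarrow> real) \<Rightarrow> bool" where
  "flat_wrt f g \<longleftrightarrow> (\<forall>N. dominated f (\<lambda>z. g z * cmod z ^ N))"

abbreviation flat :: "(complex \<Rightarrow> 'b::real_normed_vector) \<Rightarrow> bool" where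
  "flat f \<equiv> flat_wrt f (\<lambda>_. 1)"

lemma dominatedI:
  assumes "\<forall>\<^sub>F z in at 0. norm (f z) \<le> C * \<bar>g z\<bar>"
  shows "dominated f g"
  unfolding dominated_def
proof (intro exI conjI)
  show "\<forall>\<^sub>F z in at 0. norm (f z) \<le> (\<bar>C\<bar> + 1) * \<bar>g z\<bar>"
    using assms
  proof eventually_elim
    case (elim z)
    have "C * \<bar>g z\<bar> \<le> (\<bar>C\<bar> + 1) * \<bar>g z\<bar>" by (rule mult_right_mono) auto
    with elim show ?case by linarith
  qed
qed simp

lemma dominatedE:
  assumes "dominated f g"
  obtains C where "C > 0" "\<forall>\<^sub>F z in at 0. norm (f z) \<le> C * \<bar>g z\<bar>"
  using assms unfolding dominated_def by blast

lemma dominated_trans: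
  assumes "dominated f g" "dominated g h"
  shows "dominated f h"
proof -
  obtain C where C: "C > 0" "\<forall>\<^sub>F z in at 0. norm (f z) \<le> C * \<bar>g z\<bar>"
    using assms(1) by (rule dominatedE)
  obtain D where D: "\<forall>\<^sub>F z in at 0. norm (g z) \<le> D * \<bar>h z\<bar>"
    using assms(2) by (rule dominatedE)
  have "\<forall>\<^sub>F z in at 0. norm (f z) \<le> (C * D) * \<bar>h z\<bar>"
    using C(2) D
  proof eventually_elim
    case (elim z)
    have "C * \<bar>g z\<bar> \<le> C * (D * \<bar>h z\<bar>)"
      by (rule mult_left_mono) (use elim C(1) in auto)
    with elim(1) show ?case by (simp add: mult.assoc)
  qed
  then show ?thesis by (rule dominatedI)
qed

lemma dominated_cong:
  assumes "dominated f g" "\<forall>\<^sub>F z in at 0. norm (f' z) \<le> norm (f z)"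
  shows "dominated f' g"
proof -
  obtain C where C: "\<forall>\<^sub>F z in at 0. norm (f z) \<le> C * \<bar>g z\<bar>"
    using assms(1) by (rule dominatedE)
  show ?thesis by (rule dominatedI[of _ C]) (use C assms(2) in eventually_elim, auto)
qed

lemma dominated_add:
  assumes "dominated f g" "dominated f' g"
  shows "dominated (\<lambda>z. f z + f' z) g"
proof -
  obtain C where C: "\<forall>\<^sub>F z in at 0. norm (f z) \<le> C * \<bar>g z\<bar>"
    using assms(1) by (rule dominatedE)
  obtain D where D: "\<forall>\<^sub>F z in at 0. norm (f' z) \<le> D * \<bar>g z\<bar>"
    using assms(2) by (rule dominatedE)
  show ?thesis
    by (rule dominatedI[of _ "C + D"], use C D in eventually_elim)
       (metis add_mono distrib_right norm_triangle_le)
qed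

lemma dominated_minus: "dominated f g \<Longrightarrow> dominated (\<lambda>z. - f z) g"
  unfolding dominated_def by simp

lemma dominated_diff:
  "dominated f g \<Longrightarrow> dominated f' g \<Longrightarrow> dominated (\<lambda>z. f z - f' z) g"
  using dominated_add[OF _ dominated_minus, of f g f'] by simp

lemma dominated_mult:
  fixes f f' :: "complex \<Rightarrow> 'b::real_normed_algebra"
  assumes "dominated f g" "dominated f' g'"
  shows "dominated (\<lambda>z. f z * f' z) (\<lambda>z. g z * g' z)"
proof -
  obtain C where C: "\<forall>\<^sub>F z in at 0. norm (f z) \<le> C * \<bar>g z\<bar>"
    using assms(1) by (rule dominatedE)
  obtain D where D: "\<forall>\<^sub>F z in at 0. norm (f' z) \<le> D * \<bar>g' z\<bar>"
    using assms(2) by (rule dominatedE)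
  have "\<forall>\<^sub>F z in at 0. norm (f z * f' z) \<le> (C * D) * \<bar>g z * g' z\<bar>"
    using C D
  proof eventually_elim
    case (elim z)
    have "norm (f z * f' z) \<le> norm (f z) * norm (f' z)" by (rule norm_mult_ineq)
    also have "\<dots> \<le> (C * \<bar>g z\<bar>) * (D * \<bar>g' z\<bar>)"
      by (rule mult_mono) (use elim norm_ge_zero order_trans in \<open>blast+\<close>)
    finally show ?case by (simp add: algebra_simps abs_mult)
  qed
  then show ?thesis by (rule dominatedI)
qed

lemma dominated_of_real: "dominated f g \<Longrightarrow> dominated (\<lambda>z. complex_of_real (f z)) g"
  unfolding dominated_def by simp

lemma dominated_Re: "dominated f g \<Longrightarrow> dominated (\<lambda>z. Re (f z)) g"
  by (erule dominated_cong) (simp add: abs_Re_le_cmod)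

lemma dominated_self: "dominated g (\<lambda>z. norm (g z))"
  by (rule dominatedI[of _ 1]) simp

lemma dominated_tendsto:
  assumes "(f \<longlongrightarrow> l) (at 0)"
  shows "dominated f (\<lambda>_. 1)"
proof -
  have "\<forall>\<^sub>F z in at 0. norm (f z) < norm l + 1"
    using tendsto_norm[OF assms] by (rule order_tendstoD) simp
  then show ?thesis by (intro dominatedI[of _ "norm l + 1"]) (auto elim: eventually_mono)
qed

lemma eventually_at0_norm_less: "r > 0 \<Longrightarrow> \<forall>\<^sub>F z::complex in at 0. z \<noteq> 0 \<and> cmod z < r"
  unfolding eventually_at by (auto intro!: exI[of _ r])

lemma dominated_tendsto_0:
  assumes "dominated f g" "(g \<longlongrightarrow> 0) (at 0)"
  shows "(f \<longlongrightarrow> 0) (at 0)"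
proof -
  obtain C where C: "\<forall>\<^sub>F z in at 0. norm (f z) \<le> C * \<bar>g z\<bar>"
    using assms(1) by (rule dominatedE)
  have "((\<lambda>z. C * \<bar>g z\<bar>) \<longlongrightarrow> 0) (at 0)"
    using tendsto_mult_right_zero[OF tendsto_rabs_zero[OF assms(2)]] by simp
  then show ?thesis by (rule Lim_null_comparison[OF C])
qed

lemma tendsto_cmod_power_0: "((\<lambda>z. cmod z ^ Suc k) \<longlongrightarrow> 0) (at 0)"
  proof -
  have "((\<lambda>z::complex. cmod z) \<longlongrightarrow> 0) (at 0)" by (rule tendsto_norm_zero[OF tendsto_ident_at])
  from tendsto_power[OF this, of "Suc k"] show ?thesis by simp
qed

lemma flat_wrtD: "flat_wrt f g \<Longrightarrow> dominated f (\<lambda>z. g z * cmod z ^ N)"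
  unfolding flat_wrt_def by blast

lemma flat_wrt_dominated: "flat_wrt f g \<Longrightarrow> dominated f g"
  using flat_wrtD[of f g 0] by simp

lemma flatD:
  assumes "flat f"
  obtains C r where "C > 0" "r > 0" "\<And>z. z \<noteq> 0 \<Longrightarrow> cmod z < r \<Longrightarrow> norm (f z) \<le> C * cmod z ^ N"
proof -
  have "dominated f (\<lambda>z. cmod z ^ N)" using flat_wrtD[OF assms, of N] by simp
  then obtain C where C: "C > 0" "\<forall>\<^sub>F z in at 0. norm (f z) \<le> C * \<bar>cmod z ^ N\<bar>"
    by (rule dominatedE)
  then show ?thesis using that unfolding eventually_at by (auto simp: dist_norm)
qed

lemma flat_tendsto_0: "flat f \<Longrightarrow> (f \<longlongrightarrow> 0) (at 0)"
  using dominated_tendsto_0[OF flat_wrtD[of f "\<lambda>_. 1" 1]] tendsto_cmod_power_0[of 0] by simp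

lemma flat_wrt_add: "flat_wrt f g \<Longrightarrow> flat_wrt f' g \<Longrightarrow> flat_wrt (\<lambda>z. f z + f' z) g"
  unfolding flat_wrt_def by (blast intro: dominated_add)

lemma flat_wrt_diff: "flat_wrt f g \<Longrightarrow> flat_wrt f' g \<Longrightarrow> flat_wrt (\<lambda>z. f z - f' z) g"
  unfolding flat_wrt_def by (blast intro: dominated_diff)

lemma flat_wrt_Re: "flat_wrt f g \<Longrightarrow> flat_wrt (\<lambda>z. Re (f z)) g"
  unfolding flat_wrt_def by (blast intro: dominated_Re)

lemma flat_wrt_of_real: "flat_wrt f g \<Longrightarrow> flat_wrt (\<lambda>z. complex_of_real (f z)) g"
  unfolding flat_wrt_def by (blast intro: dominated_of_real)

lemma flat_wrt_cong:
  "flat_wrt f g \<Longrightarrow> \<forall>\<^sub>F z in at 0. norm (f' z) \<le> norm (f z) \<Longrightarrow> flat_wrt f' g"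
  unfolding flat_wrt_def by (blast intro: dominated_cong)

lemma flat_wrt_mult:
  fixes f f' :: "complex \<Rightarrow> 'b::real_normed_algebra"
  assumes "flat_wrt f g" "dominated f' g'"
  shows "flat_wrt (\<lambda>z. f z * f' z) (\<lambda>z. g z * g' z)"
  unfolding flat_wrt_def
proof
  fix N
  show "dominated (\<lambda>z. f z * f' z) (\<lambda>z. g z * g' z * cmod z ^ N)"
    using dominated_mult[OF flat_wrtD[OF assms(1), of N] assms(2)]
    by (simp add: mult_ac)
qed

lemma dominated_flat_wrt_trans:
  assumes "dominated f g" "flat_wrt g h"
  shows "flat_wrt f h"
  unfolding flat_wrt_def using dominated_trans[OF assms(1) flat_wrtD[OF assms(2)]] by blast

lemma flat_wrt_dominated_trans:
  assumes "flat_wrt f g" "dominated g h"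
  shows "flat_wrt f h"
  unfolding flat_wrt_def
proof
  fix N
  have "dominated (\<lambda>z. g z * cmod z ^ N) (\<lambda>z. h z * cmod (z ^ N))"
    using dominated_mult[OF assms(2) dominated_self[of "\<lambda>z. cmod (z^N)"]] 
    by (simp add: norm_power)
  then show "dominated f (\<lambda>z. h z * cmod z ^ N)"
    using dominated_trans[OF flat_wrtD[OF assms(1)]] by (simp add: norm_power)
qed

text \<open>How relative flatness arises in practice: a surplus flat factor in a bound can be traded for all
  powers of \<open>|z|\<close>.\<close>

lemma flat_wrt_flat_weight:
  assumes "dominated f (\<lambda>z. w z * g z)" "flat w"
  shows "flat_wrt f g"
proof (rule dominated_flat_wrt_trans[OF assms(1)])
  show "flat_wrt (\<lambda>z. w z * g z) g"
    using flat_wrt_mult[OF assms(2), of g "\<lambda>z. g z"] dominatedI[of g 1 g] by simp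
qed

section \<open>Holomorphic functions near a zero\<close>

lemma holomorphic_isCont_0:
  assumes "h holomorphic_on ball 0 R" "R > 0"
  shows "(h \<longlongrightarrow> h 0) (at 0)"
proof -
  have "isCont h 0"
    using assms by (meson centre_in_ball holomorphic_on_imp_continuous_on open_ball continuous_on_eq_continuous_at)
  then show ?thesis by (simp add: isCont_def)
qed

text \<open>Two different orders of vanishing exclude each other.\<close>

lemma power_contradiction:
  fixes c C r :: real
  assumes "0 < c" "0 < r" "\<And>x. 0 < x \<Longrightarrow> x < r \<Longrightarrow> c * x ^ k \<le> C * x ^ Suc k"
  shows False
proof -
  define x where "x = min (r / 2) (c / (2 * (\<bar>C\<bar> + 1)))"
  have x: "0 < x" "x < r" "x \<le> c / (2 * (\<bar>C\<bar> + 1))"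
    unfolding x_def using assms(1,2) by auto
  have "c * x ^ k \<le> (C * x) * x ^ k" using assms(3)[OF x(1,2)] by (simp add: mult_ac)
  then have "c \<le> C * x" using x(1) by simp
  also have "\<dots> \<le> (\<bar>C\<bar> + 1) * x" using x(1) by (intro mult_right_mono) auto
  also have "\<dots> \<le> (\<bar>C\<bar> + 1) * (c / (2 * (\<bar>C\<bar> + 1)))" by (intro mult_left_mono x) auto
  also have "\<dots> = c / 2" by (simp add: field_simps)
  finally show False using assms(1) by simp
qed

lemma holomorphic_leading_term:
  assumes "h holomorphic_on ball 0 R" "R > 0" "w \<in> ball 0 R" "h w \<noteq> 0"
  obtains k g r where "0 < r" "r \<le> R" "g holomorphic_on ball 0 r" "g 0 \<noteq> 0"
    "\<And>z. z \<in> ball 0 r \<Longrightarrow> h z = z ^ k * g z" "h 0 = 0 \<Longrightarrow> 0 < k"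
proof (cases "h 0 = 0")
  case False
  then show ?thesis using that[of R h 0] assms by auto
next
  case True
  have nc: "\<not> h constant_on ball 0 R"
    using True assms unfolding constant_on_def by (metis centre_in_ball)
  show ?thesis
  proof (rule holomorphic_factor_zero_nonconstant[OF assms(1) open_ball connected_ball _ True nc])
    show "0 \<in> ball 0 R" using assms(2) by simp
  next
    fix g r n
    assume g: "0 < (n::nat)" "0 < r" "ball 0 r \<subseteq> (ball 0 R :: complex set)" "g holomorphic_on ball 0 r"
      "\<And>w. w \<in> ball 0 r \<Longrightarrow> h w = (w - 0) ^ n * g w"
      "\<And>w. w \<in> ball 0 r \<Longrightarrow> g w \<noteq> 0"
    show thesis
    proof (rule that[of r g n])
      show "r \<le> R" using g(2,3) unfolding ball_subset_ball_iff by simp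
      show "g 0 \<noteq> 0" using g(6)[of 0] g(2) by simp
      show "h z = z ^ n * g z" if "z \<in> ball 0 r" for z using g(5)[OF that] by simp
    qed (use g in auto)
  qed
qed

lemma holomorphic_lower_bound:
  assumes "h holomorphic_on ball 0 R" "R > 0" "w \<in> ball 0 R" "h w \<noteq> 0"
  obtains k c where "0 < c" "\<forall>\<^sub>F z in at 0. c * cmod z ^ k \<le> cmod (h z)"
proof -
  obtain k g r where g: "0 < r" "r \<le> R" "g holomorphic_on ball 0 r" "g 0 \<noteq> 0"
    "\<And>z. z \<in> ball 0 r \<Longrightarrow> h z = z ^ k * g z"
    using holomorphic_leading_term[OF assms] by metis
  have "((\<lambda>z. cmod (g z)) \<longlongrightarrow> cmod (g 0)) (at 0)"
    by (intro tendsto_norm holomorphic_isCont_0[OF g(3,1)])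
  then have "\<forall>\<^sub>F z in at 0. cmod (g 0) / 2 < cmod (g z)"
    by (rule order_tendstoD) (use g(4) in simp)
  then have "\<forall>\<^sub>F z in at 0. cmod (g 0) / 2 * cmod z ^ k \<le> cmod (h z)"
    using eventually_at0_norm_less[OF g(1)]
    by eventually_elim (auto simp: g(5) norm_mult norm_power mult.commute intro!: mult_left_mono)
  then show ?thesis using that[of "cmod (g 0) / 2" k] g(4) by simp
qed

text \<open>The lower bound by a power of \<open>|z|\<close> holds at all points of a circle, so smallness at a single point
  of every circle is enough to force the function to vanish.\<close>

lemma holomorphic_eq_0_if_flat_on_circles:
  assumes "h holomorphic_on ball 0 R" "R > 0"
    and "\<And>N. \<exists>C r. 0 < r \<and> (\<forall>x. 0 < x \<and> x < r \<longrightarrow> (\<exists>z. cmod z = x \<and> cmod (h z) \<le> C * x ^ N))"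
    and "z \<in> ball 0 R"
  shows "h z = 0"
proof (rule ccontr)
  assume "h z \<noteq> 0"
  then obtain k c where kc: "0 < c" "\<forall>\<^sub>F z in at 0. c * cmod z ^ k \<le> cmod (h z)"
    using holomorphic_lower_bound[OF assms(1,2,4)] by metis
  obtain r1 where r1: "0 < r1" "\<And>z. z \<noteq> 0 \<Longrightarrow> cmod z < r1 \<Longrightarrow> c * cmod z ^ k \<le> cmod (h z)"
    using kc(2) unfolding eventually_at by (auto simp: dist_norm)
  obtain C r where Cr: "0 < r" "\<And>x. 0 < x \<Longrightarrow> x < r \<Longrightarrow> \<exists>z. cmod z = x \<and> cmod (h z) \<le> C * x ^ Suc k"
    using assms(3)[of "Suc k"] by blast
  show False
  proof (rule power_contradiction[OF kc(1), of "min r r1" k C])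
    fix x assume x: "0 < x" "x < min r r1"
    then obtain z where z: "cmod z = x" "cmod (h z) \<le> C * x ^ Suc k" using Cr(2)[of x] by auto
    have "z \<noteq> 0" using z(1) x(1) by auto
    then have "c * x ^ k \<le> cmod (h z)" using r1(2)[of z] z(1) x by simp
    then show "c * x ^ k \<le> C * x ^ Suc k" using z(2) by (rule order_trans)
  qed (use Cr(1) r1(1) in simp)
qed

lemma holomorphic_eq_0_if_flat:
  assumes "h holomorphic_on ball 0 R" "R > 0" "flat h" "z \<in> ball 0 R"
  shows "h z = 0"
proof (rule holomorphic_eq_0_if_flat_on_circles[OF assms(1,2) _ assms(4)])
  fix N
  obtain C r where "C > 0" "r > 0" "\<And>z. z \<noteq> 0 \<Longrightarrow> cmod z < r \<Longrightarrow> norm (h z) \<le> C * cmod z ^ N"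
    using flatD[OF assms(3)] by metis
  then have "\<forall>x. 0 < x \<and> x < r \<longrightarrow> cmod (complex_of_real x) = x \<and> cmod (h (complex_of_real x)) \<le> C * x ^ N"
    by (metis abs_of_pos less_irrefl norm_of_real norm_zero)
  then show "\<exists>C r. 0 < r \<and> (\<forall>x. 0 < x \<and> x < r \<longrightarrow> (\<exists>z. cmod z = x \<and> cmod (h z) \<le> C * x ^ N))"
    using \<open>r > 0\<close> by blast
qed

text \<open>On a small circle the leading term \<open>\<gamma> * z^k\<close> takes every argument because \<open>k > 0\<close>. So the real part
  of \<open>h\<close> attains the order of its modulus, even after multiplication by a constant \<open>\<kappa>\<close> that may
  depend on the radius in an uncontrolled way.\<close>

lemma holomorphic_direction:
  assumes "h holomorphic_on ball 0 R" "R > 0" "h 0 = 0" "w \<in> ball 0 R" "h w \<noteq> 0"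
  obtains k c C r where "0 < k" "0 < c" "0 < r" "r \<le> R"
    "\<forall>z. cmod z < r \<longrightarrow> cmod (h z) \<le> C * cmod z ^ k"
    "\<forall>x \<kappa>. 0 < x \<and> x < r \<longrightarrow> (\<exists>z. cmod z = x \<and> c * cmod \<kappa> * x ^ k \<le> Re (\<kappa> * h z))"
proof -
  obtain k g r0 where g: "0 < r0" "r0 \<le> R" "g holomorphic_on ball 0 r0" "g 0 \<noteq> 0"
    "\<And>z. z \<in> ball 0 r0 \<Longrightarrow> h z = z ^ k * g z" "0 < k"
    using holomorphic_leading_term[OF assms(1,2,4,5)] assms(3) by metis
  have "isCont g 0"
    using g(1,3) by (meson centre_in_ball holomorphic_on_imp_continuous_on open_ball continuous_on_eq_continuous_at)
  then have "\<exists>r>0. \<forall>z. dist z 0 < r \<longrightarrow> dist (g z) (g 0) < cmod (g 0) / 2"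
    unfolding continuous_at_eps_delta using g(4) by (metis half_gt_zero zero_less_norm_iff)
  then obtain r1 where r1: "r1 > 0" "\<And>z. cmod z < r1 \<Longrightarrow> cmod (g z - g 0) < cmod (g 0) / 2"
    by (auto simp: dist_norm)
  define r where "r = min r0 r1"
  show ?thesis
  proof (rule that[of k "cmod (g 0) / 2" r "2 * cmod (g 0)"]; (intro allI impI)?)
    fix z assume z: "cmod z < r"
    have "cmod (g z) \<le> cmod (g z - g 0) + cmod (g 0)" by (metis diff_add_cancel norm_triangle_ineq)
    also have "\<dots> \<le> 2 * cmod (g 0)" using r1(2)[of z] z norm_ge_zero[of "g 0"] unfolding r_def min_less_iff_conj by linarith
    finally have "cmod (g z) \<le> 2 * cmod (g 0)" .
    then show "cmod (h z) \<le> 2 * cmod (g 0) * cmod z ^ k"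
      using g(5)[of z] z mult_right_mono[OF \<open>cmod (g z) \<le> 2 * cmod (g 0)\<close>, of "cmod z ^ k"]
      unfolding r_def by (simp add: norm_mult norm_power mult_ac)
  next
    fix x :: real and \<kappa> :: complex assume "0 < x \<and> x < r"
    then have x: "0 < x" "x < r" by auto
    define \<theta> where "\<theta> = - Arg (\<kappa> * g 0) / k"
    define z where "z = of_real x * cis \<theta>"
    have zx: "cmod z = x" unfolding z_def using x by (simp add: norm_mult)
    have zk: "z ^ k = of_real (x ^ k) * cis (- Arg (\<kappa> * g 0))"
      unfolding z_def using g(6) by (simp add: power_mult_distrib Complex.DeMoivre \<theta>_def)
    have "\<kappa> * g 0 * cis (- Arg (\<kappa> * g 0)) = of_real (cmod (\<kappa> * g 0))"
      using rcis_cmod_Arg[of "\<kappa> * g 0"] unfolding rcis_def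
      by (metis (no_types, lifting) ab_semigroup_mult_class.mult_ac(1) cis_mult cis_zero mult.right_neutral right_minus)
    then have e: "\<kappa> * g 0 * z ^ k = of_real (cmod \<kappa> * cmod (g 0) * x ^ k)"
      unfolding zk by (simp add: norm_mult mult_ac)
    have "\<kappa> * h z = \<kappa> * g 0 * z ^ k + \<kappa> * z ^ k * (g z - g 0)"
      using g(5)[of z] zx x unfolding r_def by (simp add: algebra_simps)
    then have "Re (\<kappa> * h z) = cmod \<kappa> * cmod (g 0) * x ^ k + Re (\<kappa> * z ^ k * (g z - g 0))"
      using e by simp
    moreover have "\<bar>Re (\<kappa> * z ^ k * (g z - g 0))\<bar> \<le> cmod \<kappa> * x ^ k * (cmod (g 0) / 2)"
    proof -
      have "\<bar>Re (\<kappa> * z ^ k * (g z - g 0))\<bar> \<le> cmod (\<kappa> * z ^ k * (g z - g 0))"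
        by (rule abs_Re_le_cmod)
      also have "\<dots> = cmod \<kappa> * x ^ k * cmod (g z - g 0)" by (simp add: norm_mult norm_power zx)
      also have "\<dots> \<le> cmod \<kappa> * x ^ k * (cmod (g 0) / 2)"
        using r1(2)[of z] zx x unfolding r_def by (intro mult_left_mono) auto
      finally show ?thesis .
    qed
    ultimately have "cmod (g 0) / 2 * cmod \<kappa> * x ^ k \<le> Re (\<kappa> * h z)" by argo
    then show "\<exists>z. cmod z = x \<and> cmod (g 0) / 2 * cmod \<kappa> * x ^ k \<le> Re (\<kappa> * h z)" using zx by blast
  qed (use g r1(1) in \<open>auto simp: r_def\<close>)
qed

lemma holomorphic_dominated:
  assumes "h holomorphic_on ball 0 R" "R > 0"
  shows "dominated h (\<lambda>_. 1)"
proof -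
  show ?thesis by (rule dominated_tendsto[OF holomorphic_isCont_0[OF assms]])
qed

lemma holomorphic_dominated_zero:
  assumes "h holomorphic_on ball 0 R" "R > 0" "h 0 = 0"
  shows "dominated h cmod"
proof -
  have "h field_differentiable at 0"
    using assms(1,2) by (simp add: holomorphic_on_imp_differentiable_at)
  then obtain D where "(h has_field_derivative D) (at 0)" unfolding field_differentiable_def by blast
  then have "((\<lambda>z. h z / z) \<longlongrightarrow> D) (at 0)"
    unfolding has_field_derivative_iff using assms(3) by simp
  then have "dominated (\<lambda>z. h z / z) (\<lambda>_. 1)" by (rule dominated_tendsto)
  then obtain C where C: "\<forall>\<^sub>F z in at 0. cmod (h z / z) \<le> C * \<bar>1\<bar>" by (rule dominatedE)
  show ?thesis
    by (rule dominatedI[of _ C], use C eventually_at0_norm_less[of 1, simplified] in eventually_elim)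
       (auto simp: norm_divide field_simps)
qed

section \<open>Expansion of a function of two variables in powers of the first\<close>

text \<open>The coefficient of \<open>Z ^ j\<close> in the power series of \<open>f Z z\<close> in \<open>Z\<close>.\<close>

definition coeff1 :: "(complex \<Rightarrow> complex \<Rightarrow> complex) \<Rightarrow> nat \<Rightarrow> complex \<Rightarrow> complex" where
  "coeff1 f j z = (deriv ^^ j) (\<lambda>Z. f Z z) 0 / fact j"

locale separately_holomorphic =
  fixes f :: "complex \<Rightarrow> complex \<Rightarrow> complex" and R B :: real
  assumes R_pos: "R > 0"
    and holo1: "\<And>z. z \<in> ball 0 R \<Longrightarrow> (\<lambda>Z. f Z z) holomorphic_on ball 0 R"
    and holo2: "\<And>Z. Z \<in> ball 0 R \<Longrightarrow> f Z holomorphic_on ball 0 R"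
    and bounded: "\<And>Z z. Z \<in> ball 0 R \<Longrightarrow> z \<in> ball 0 R \<Longrightarrow> cmod (f Z z) \<le> B"
begin

lemma coeff1_sums:
  assumes "z \<in> ball 0 R" "Z \<in> ball 0 R"
  shows "(\<lambda>j. coeff1 f j z * Z ^ j) sums f Z z"
  using holomorphic_power_series[OF holo1[OF assms(1)] assms(2)] by (simp add: coeff1_def)

lemma coeff1_0: "z \<in> ball 0 R \<Longrightarrow> coeff1 f 0 z = f 0 z"
  by (simp add: coeff1_def)

lemma coeff1_bound:
  assumes "z \<in> ball 0 R"
  shows "cmod (coeff1 f j z) \<le> B * (2 / R) ^ j"
proof -
  have sub: "cball 0 (R / 2) \<subseteq> (ball 0 R :: complex set)" using R_pos unfolding cball_subset_ball_iff by simp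
  have h: "(\<lambda>Z. f Z z) holomorphic_on cball 0 (R / 2)"
    using holomorphic_on_subset[OF holo1[OF assms] sub] .
  have "cmod ((deriv ^^ j) (\<lambda>Z. f Z z) 0) \<le> fact j * B / (R / 2) ^ j"
  proof (rule Cauchy_inequality)
    show "(\<lambda>Z. f Z z) holomorphic_on ball 0 (R / 2)"
      using holomorphic_on_subset[OF h] by simp
    show "continuous_on (cball 0 (R / 2)) (\<lambda>Z. f Z z)"
      by (rule holomorphic_on_imp_continuous_on[OF h])
    show "cmod (f x z) \<le> B" if "cmod (0 - x) = R / 2" for x
      using that R_pos bounded[of x z] assms by auto
  qed (use R_pos in auto)
  then have "cmod ((deriv ^^ j) (\<lambda>Z. f Z z) 0) / fact j \<le> fact j * B / (R / 2) ^ j / fact j"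
    by (rule divide_right_mono) simp
  also have "\<dots> = B * (2 / R) ^ j" by (simp add: power_divide)
  finally show ?thesis by (simp add: coeff1_def norm_divide)
qed

text \<open>The remainder is a tail of a geometric series by Cauchy's inequality; what matters is that
  the bound is uniform in the second variable.\<close>

lemma coeff1_remainder:
  assumes z: "z \<in> ball 0 R" and Z: "cmod Z \<le> R / 4"
  shows "cmod (f Z z - (\<Sum>i<j. coeff1 f i z * Z ^ i)) \<le> 2 * B * (2 / R) ^ j * cmod Z ^ j"
proof -
  have B: "B \<ge> 0" using order_trans[OF norm_ge_zero bounded[of 0 0]] R_pos by simp
  define t where "t = 2 / R * cmod Z"
  have t: "0 \<le> t" "t \<le> 1 / 2" using Z R_pos by (auto simp: t_def field_simps)
  have s: "(\<lambda>i. coeff1 f i z * Z ^ i) sums f Z z" using Z R_pos by (intro coeff1_sums z) auto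
  have tail: "(\<lambda>i. coeff1 f (i + j) z * Z ^ (i + j)) sums (f Z z - (\<Sum>i<j. coeff1 f i z * Z ^ i))"
    using sums_split_initial_segment[OF s, of j] by simp
  have geo: "(\<lambda>i. B * t ^ j * t ^ i) sums (B * t ^ j * (1 / (1 - t)))"
    by (intro sums_mult geometric_sums) (use t in simp)
  have "cmod (f Z z - (\<Sum>i<j. coeff1 f i z * Z ^ i)) \<le> B * t ^ j * (1 / (1 - t))"
    unfolding sums_unique[OF tail] sums_unique[OF geo]
  proof (rule norm_suminf_le[OF _ sums_summable[OF geo]])
    fix i
    have "cmod (coeff1 f (i + j) z * Z ^ (i + j)) \<le> B * (2 / R) ^ (i + j) * cmod Z ^ (i + j)"
      unfolding norm_mult norm_power by (intro mult_right_mono coeff1_bound z) simp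
    also have "\<dots> = B * t ^ j * t ^ i"
      by (simp only: t_def power_mult_distrib power_add mult_ac)
    finally show "cmod (coeff1 f (i + j) z * Z ^ (i + j)) \<le> B * t ^ j * t ^ i" .
  qed
  also have "\<dots> \<le> B * t ^ j * 2"
    by (intro mult_left_mono) (use t B in \<open>simp_all add: divide_simps\<close>)
  finally show ?thesis by (simp add: t_def power_mult_distrib power_divide mult_ac)
qed

text \<open>Each coefficient is the uniform limit, as the first variable tends to zero, of the
  difference quotients that remain after subtracting the previous terms.\<close>

lemma coeff1_holomorphic: "coeff1 f j holomorphic_on ball 0 R"
proof (induction j rule: less_induct)
  case (less j)
  define h where "h n = complex_of_real (R / 4 / (n + 1))" for n :: nat
  have h: "h n \<noteq> 0" "cmod (h n) \<le> R / 4" for n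
    using R_pos by (auto simp: h_def norm_divide field_simps simp del: of_nat_Suc)
  define g where "g n z = (f (h n) z - (\<Sum>i<j. coeff1 f i z * h n ^ i)) / h n ^ j" for n z
  define K where "K = 2 * B * (2 / R) ^ Suc j"
  have err: "cmod (g n z - coeff1 f j z) \<le> K * cmod (h n)" if z: "z \<in> ball 0 R" for n z
  proof -
    have "cmod (f (h n) z - (\<Sum>i<Suc j. coeff1 f i z * h n ^ i)) \<le> K * cmod (h n) ^ Suc j"
      unfolding K_def using coeff1_remainder[OF z h(2)] .
    moreover have "g n z - coeff1 f j z = (f (h n) z - (\<Sum>i<Suc j. coeff1 f i z * h n ^ i)) / h n ^ j"
      using h(1) by (simp add: g_def field_simps)
    ultimately have "cmod (g n z - coeff1 f j z) \<le> K * cmod (h n) ^ Suc j / cmod (h n) ^ j"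
      by (simp add: norm_divide norm_power divide_right_mono del: sum.lessThan_Suc power_Suc)
    then show ?thesis using h(1)[of n] by simp
  qed
  have lim: "uniform_limit (ball 0 R) g (coeff1 f j) sequentially"
  proof (rule uniform_limitI)
    fix e :: real assume e: "e > 0"
    have "(\<lambda>n. R / 4 * inverse (real (Suc n))) \<longlonglongrightarrow> R / 4 * 0"
      by (intro tendsto_mult tendsto_const LIMSEQ_inverse_real_of_nat)
    moreover have "cmod (h n) = R / 4 * inverse (real (Suc n))" for n
    proof -
      have "cmod (h n) = \<bar>R / 4 / (real n + 1)\<bar>" 
        unfolding h_def by (simp only: norm_of_real of_nat_add of_nat_1)
      also have "\<dots> = R / 4 / (real n + 1)" using R_pos by (intro abs_of_nonneg) simp
      also have "\<dots> = R / 4 * inverse (real (Suc n))" unfolding of_nat_Suc divide_inverse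
        by (simp only: add.commute)
      finally show ?thesis .
    qed
    ultimately have "(\<lambda>n. cmod (h n)) \<longlonglongrightarrow> 0" by (simp only: mult_zero_right)
    then have "(\<lambda>n. K * cmod (h n)) \<longlonglongrightarrow> 0" by (rule tendsto_mult_right_zero)
    then have "\<forall>\<^sub>F n in sequentially. K * cmod (h n) < e" using e by (rule order_tendstoD)
    then show "\<forall>\<^sub>F n in sequentially. \<forall>z\<in>ball 0 R. dist (g n z) (coeff1 f j z) < e"
      by eventually_elim (use err le_less_trans in \<open>unfold dist_norm, blast\<close>)
  qed
  show ?case
  proof (rule holomorphic_uniform_sequence[of _ g])
    show "g n holomorphic_on ball 0 R" for n
      unfolding g_def using less.IH h[of n] R_pos by (intro holomorphic_intros holo2) auto
    show "\<exists>d>0. cball x d \<subseteq> ball 0 R \<and> uniform_limit (cball x d) g (coeff1 f j) sequentially"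
      if "x \<in> ball 0 R" for x
    proof -
      have "\<exists>d>0. cball x d \<subseteq> ball 0 R"
        by (rule open_contains_cball[THEN iffD1, OF open_ball, rule_format, OF that])
      then obtain d where "d > 0" "cball x d \<subseteq> ball 0 R" by (elim exE conjE)
      then show ?thesis using uniform_limit_on_subset[OF lim] by blast
    qed
  qed simp
qed

lemma dominated_coeff1_remainder:
  assumes "(Z \<longlongrightarrow> 0) (at 0)"
  shows "dominated (\<lambda>z. f (Z z) z - (\<Sum>i<j. coeff1 f i z * Z z ^ i)) (\<lambda>z. cmod (Z z) ^ j)"
proof (rule dominatedI)
  have "((\<lambda>z. cmod (Z z)) \<longlongrightarrow> 0) (at 0)" using assms by (rule tendsto_norm_zero)
  then have "\<forall>\<^sub>F z in at 0. cmod (Z z) < R / 4" by (rule order_tendstoD) (use R_pos in simp)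
  then show "\<forall>\<^sub>F z in at 0. cmod (f (Z z) z - (\<Sum>i<j. coeff1 f i z * Z z ^ i))
      \<le> (2 * B * (2 / R) ^ j) * \<bar>cmod (Z z) ^ j\<bar>"
    using eventually_at0_norm_less[OF R_pos]
    by eventually_elim (use coeff1_remainder in auto)
qed

end

section \<open>Flat profiles\<close>

text \<open>Both parts follow from the mean value theorem; the second one applies it to
  \<open>f u - f' x * u\<close>, whose derivative is controlled by the first.\<close>

lemma second_order_bound:
  fixes f f' f'' :: "real \<Rightarrow> real"
  assumes f: "\<And>x. x \<in> {0..<e} \<Longrightarrow> (f has_real_derivative f' x) (at x within {0..<e})"
    and f': "\<And>x. x \<in> {0..<e} \<Longrightarrow> (f' has_real_derivative f'' x) (at x within {0..<e})"
    and K: "\<And>x. x \<in> {0..m} \<Longrightarrow> \<bar>f'' x\<bar> \<le> K"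
    and m: "m < e" and x: "x \<in> {0..m}" and y: "y \<in> {0..m}"
  shows "\<bar>f' y - f' x\<bar> \<le> K * \<bar>y - x\<bar>" "\<bar>f y - f x - f' x * (y - x)\<bar> \<le> K * (y - x)\<^sup>2"
proof -
  have lip: "\<bar>f' u - f' v\<bar> \<le> K * \<bar>u - v\<bar>" if "u \<in> {0..m}" "v \<in> {0..m}" for u v
  proof -
    have "norm (f' u - f' v) \<le> K * norm (u - v)"
    proof (rule field_differentiable_bound[of "{0..m}" f' f''])
      show "(f' has_field_derivative f'' z) (at z within {0..m})" if "z \<in> {0..m}" for z
        by (rule DERIV_subset[OF f']) (use that m in auto)
    qed (use that K in auto)
    then show ?thesis by simp
  qed
  show "\<bar>f' y - f' x\<bar> \<le> K * \<bar>y - x\<bar>" by (rule lip) (use x y in auto)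
  define S where "S = closed_segment x y"
  have S: "u \<in> {0..m}" "\<bar>u - x\<bar> \<le> \<bar>y - x\<bar>" if "u \<in> S" for u
    using that x y unfolding S_def closed_segment_eq_real_ivl by (auto split: if_splits)
  have K0: "K \<ge> 0" using K[OF x] by linarith
  have "norm ((f y - f' x * y) - (f x - f' x * x)) \<le> (K * \<bar>y - x\<bar>) * norm (y - x)"
  proof (rule field_differentiable_bound[of S "\<lambda>u. f u - f' x * u" "\<lambda>u. f' u - f' x"])
    show "((\<lambda>u. f u - f' x * u) has_field_derivative f' u - f' x) (at u within S)" if "u \<in> S" for u
    proof -
      have u: "u \<in> {0..<e}" and "S \<subseteq> {0..<e}" using S(1) that m by force+
      then have "(f has_real_derivative f' u) (at u within S)" by (intro DERIV_subset[OF f])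
      then show ?thesis by (auto intro!: derivative_eq_intros)
    qed
    show "norm (f' u - f' x) \<le> K * \<bar>y - x\<bar>" if "u \<in> S" for u
      using lip[OF S(1)[OF that] x] mult_left_mono[OF S(2)[OF that] K0] by simp
  qed (auto simp: S_def)
  then show "\<bar>f y - f x - f' x * (y - x)\<bar> \<le> K * (y - x)\<^sup>2"
    by (simp add: algebra_simps power2_eq_square flip: abs_mult)
qed

text \<open>Near \<open>0\<close> the function is below its value at \<open>r\<close>, so the maximum over a compact interval is global.\<close>

lemma attains_max_half_open:
  fixes k :: "real \<Rightarrow> real"
  assumes "r > 0" "continuous_on {0<..r} k" "\<And>x. 0 < x \<Longrightarrow> x \<le> r \<Longrightarrow> k x > 0"
    and "(k \<longlongrightarrow> 0) (at_right 0)"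
  obtains x where "0 < x" "x \<le> r" "\<And>y. 0 < y \<Longrightarrow> y \<le> r \<Longrightarrow> k y \<le> k x"
proof -
  have "\<forall>\<^sub>F x in at_right 0. k x < k r"
    using assms(4) by (rule order_tendstoD) (use assms(1,3) in simp)
  then obtain s where s: "s > 0" "\<And>x. 0 < x \<Longrightarrow> x < s \<Longrightarrow> k x < k r"
    unfolding eventually_at_right_field by blast
  define t where "t = min (s / 2) r"
  have t: "0 < t" "t \<le> r" "t < s" using s(1) assms(1) unfolding t_def by auto
  obtain x where x: "x \<in> {t..r}" "\<And>y. y \<in> {t..r} \<Longrightarrow> k y \<le> k x"
  proof -
    have "continuous_on {t..r} k" by (rule continuous_on_subset[OF assms(2)]) (use t in auto)
    then show ?thesis using continuous_attains_sup[of "{t..r}" k] t that by auto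
  qed
  show ?thesis
  proof (rule that[of x])
    fix y assume y: "0 < y" "y \<le> r"
    show "k y \<le> k x"
    proof (cases "y < t")
      case True
      then have "k y \<le> k r" using s(2)[of y] y t by simp
      also have "k r \<le> k x" using x(2)[of r] t by simp
      finally show ?thesis .
    qed (use x y in auto)
  qed (use x t in auto)
qed

lemma dominated_cmod_less:
  assumes "dominated V cmod" "r > 0"
  obtains K where "K \<ge> 1" "\<forall>\<^sub>F z in at 0. cmod (V z) \<le> K * cmod z \<and> K * cmod z < r \<and> z \<noteq> 0"
proof -
  obtain C where C: "C > 0" "\<forall>\<^sub>F z in at 0. cmod (V z) \<le> C * \<bar>cmod z\<bar>"
    using assms(1) by (rule dominatedE)
  have "r / (C + 1) > 0" using assms(2) C(1) by simp
  from C(2) eventually_at0_norm_less[OF this]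
  have "\<forall>\<^sub>F z in at 0. cmod (V z) \<le> (C + 1) * cmod z \<and> (C + 1) * cmod z < r \<and> z \<noteq> 0"
  proof (eventually_elim)
    case (elim z)
    have "C * cmod z \<le> (C + 1) * cmod z" by (rule mult_right_mono) auto
    moreover have "(C + 1) * cmod z < r" using elim C(1) by (simp add: field_simps)
    moreover have "cmod (V z) \<le> C * cmod z" using elim(1) by simp
    ultimately show ?case using elim(2) by (intro conjI) linarith+
  qed
  then show ?thesis using that[of "C + 1"] C(1) by simp
qed

lemma dominated_power_weightI:
  fixes f :: "complex \<Rightarrow> real"
  assumes "\<forall>\<^sub>F z in at 0. \<bar>f z\<bar> \<le> C * (K * cmod z) ^ N * h z" "\<forall>\<^sub>F z in at 0. 0 \<le> h z"
  shows "dominated f (\<lambda>z. h z * cmod z ^ N)"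
  by (rule dominatedI[of _ "C * K ^ N"], use assms in eventually_elim)
     (simp add: power_mult_distrib abs_mult mult_ac)

text \<open>Estimates for \<open>f |z|\<close> when \<open>f''\<close> is of order \<open>x ^ N\<close>. They are used for all \<open>N\<close> with a function that
  vanishes to infinite order, and for \<open>N = 0\<close> with one that merely has a bounded second derivative; in
  the latter case \<open>f' 0\<close> is arbitrary.\<close>

locale radial_function =
  fixes f f' f'' :: "real \<Rightarrow> real" and e :: real and N :: nat
  assumes e_pos: "e > 0"
    and f_deriv: "\<And>x. x \<in> {0..<e} \<Longrightarrow> (f has_real_derivative f' x) (at x within {0..<e})"
    and f'_deriv: "\<And>x. x \<in> {0..<e} \<Longrightarrow> (f' has_real_derivative f'' x) (at x within {0..<e})"
    and f'_0: "N = 0 \<or> f' 0 = 0"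
    and f''_bound: "\<exists>C r. r > 0 \<and> (\<forall>x. 0 \<le> x \<and> x < r \<longrightarrow> \<bar>f'' x\<bar> \<le> C * x ^ N)"
begin

lemma estimates:
  obtains C r where "0 < C" "0 < r" "r \<le> 1"
    "\<forall>m x. 0 \<le> x \<and> x \<le> m \<and> m < r \<longrightarrow> \<bar>f' x\<bar> \<le> C * m ^ N"
    "\<forall>m x y. 0 \<le> x \<and> x \<le> m \<and> 0 \<le> y \<and> y \<le> m \<and> m < r \<longrightarrow>
       \<bar>f y - f x - f' x * (y - x)\<bar> \<le> C * m ^ N * (y - x)\<^sup>2"
proof -
  obtain C r0 where C: "r0 > 0" "\<And>x. 0 \<le> x \<Longrightarrow> x < r0 \<Longrightarrow> \<bar>f'' x\<bar> \<le> C * x ^ N"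
    using f''_bound by blast
  define r where "r = Min {r0, e, 1}"
  have r: "0 < r" "r \<le> r0" "r \<le> e" "r \<le> 1" unfolding r_def using C(1) e_pos by auto
  define D where "D = \<bar>C\<bar> + 1"
  have K: "\<bar>f'' x\<bar> \<le> D * m ^ N" if "x \<in> {0..m}" "m < r" for x m
  proof -
    have "\<bar>f'' x\<bar> \<le> C * x ^ N" using C(2)[of x] that r by auto
    also have "\<dots> \<le> D * x ^ N" using that by (intro mult_right_mono) (auto simp: D_def)
    also have "\<dots> \<le> D * m ^ N" using that by (intro mult_left_mono power_mono) (auto simp: D_def)
    finally show ?thesis .
  qed
  note * = second_order_bound[OF f_deriv f'_deriv K]
  show ?thesis
  proof (rule that[of "\<bar>f' 0\<bar> + D" r]; (intro allI impI)?)
    fix m x :: real assume x: "0 \<le> x \<and> x \<le> m \<and> m < r"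
    have "\<bar>f' x - f' 0\<bar> \<le> D * m ^ N * \<bar>x - 0\<bar>"
      by (rule *(1)) (use x r in auto)
    also have "\<dots> \<le> D * m ^ N * 1"
      using x r by (intro mult_left_mono) (auto simp: D_def)
    finally have "\<bar>f' x\<bar> \<le> \<bar>f' 0\<bar> + D * m ^ N" by linarith
    also have "\<bar>f' 0\<bar> = \<bar>f' 0\<bar> * m ^ N" using f'_0 by auto
    finally show "\<bar>f' x\<bar> \<le> (\<bar>f' 0\<bar> + D) * m ^ N" by (simp add: distrib_right)
  next
    fix m x y :: real assume m: "0 \<le> x \<and> x \<le> m \<and> 0 \<le> y \<and> y \<le> m \<and> m < r"
    then have "\<bar>f y - f x - f' x * (y - x)\<bar> \<le> D * m ^ N * (y - x)\<^sup>2"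
      by (intro *(2)) (use r in auto)
    also have "\<dots> \<le> (\<bar>f' 0\<bar> + D) * m ^ N * (y - x)\<^sup>2"
      using m by (intro mult_right_mono) auto
    finally show "\<bar>f y - f x - f' x * (y - x)\<bar> \<le> (\<bar>f' 0\<bar> + D) * m ^ N * (y - x)\<^sup>2" .
  qed (use r in \<open>auto simp: D_def\<close>)
qed

lemma dominated_deriv: "dominated (\<lambda>z. f' (cmod z)) (\<lambda>z. cmod z ^ N)"
proof -
  obtain C r where Cr: "0 < C" "0 < r" "r \<le> 1"
    "\<forall>m x. 0 \<le> x \<and> x \<le> m \<and> m < r \<longrightarrow> \<bar>f' x\<bar> \<le> C * m ^ N"
    "\<forall>m x y. 0 \<le> x \<and> x \<le> m \<and> 0 \<le> y \<and> y \<le> m \<and> m < r \<longrightarrow>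
       \<bar>f y - f x - f' x * (y - x)\<bar> \<le> C * m ^ N * (y - x)\<^sup>2"
    by (rule estimates)
  show ?thesis
    by (rule dominatedI[of _ C], use eventually_at0_norm_less[OF Cr(2)] in eventually_elim)
       (use Cr(4) in auto)
qed

lemma taylor:
  assumes "dominated V cmod"
  shows "dominated (\<lambda>z. f (cmod (V z)) - f (cmod z) - f' (cmod z) * (cmod (V z) - cmod z))
           (\<lambda>z. (cmod (V z) - cmod z)\<^sup>2 * cmod z ^ N)"
proof -
  obtain C r where Cr: "0 < C" "0 < r" "r \<le> 1"
    "\<forall>m x. 0 \<le> x \<and> x \<le> m \<and> m < r \<longrightarrow> \<bar>f' x\<bar> \<le> C * m ^ N"
    "\<forall>m x y. 0 \<le> x \<and> x \<le> m \<and> 0 \<le> y \<and> y \<le> m \<and> m < r \<longrightarrow>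
       \<bar>f y - f x - f' x * (y - x)\<bar> \<le> C * m ^ N * (y - x)\<^sup>2"
    by (rule estimates)
  obtain K where K: "K \<ge> 1" "\<forall>\<^sub>F z in at 0. cmod (V z) \<le> K * cmod z \<and> K * cmod z < r \<and> z \<noteq> 0"
    by (rule dominated_cmod_less[OF assms Cr(2)])
  show ?thesis
  proof (rule dominated_power_weightI[of _ C K], use K(2) in eventually_elim)
    case (elim z)
    have "cmod z \<le> K * cmod z" using mult_right_mono[OF K(1), of "cmod z"] by simp
    then show ?case by (intro Cr(5)[rule_format]) (use elim in auto)
  qed simp
qed

lemma lipschitz:
  assumes "dominated V cmod" "dominated W cmod"
  shows "dominated (\<lambda>z. f (cmod (V z)) - f (cmod (W z))) (\<lambda>z. cmod (V z - W z) * cmod z ^ N)"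
proof -
  obtain C r where Cr: "0 < C" "0 < r" "r \<le> 1"
    "\<forall>m x. 0 \<le> x \<and> x \<le> m \<and> m < r \<longrightarrow> \<bar>f' x\<bar> \<le> C * m ^ N"
    "\<forall>m x y. 0 \<le> x \<and> x \<le> m \<and> 0 \<le> y \<and> y \<le> m \<and> m < r \<longrightarrow>
       \<bar>f y - f x - f' x * (y - x)\<bar> \<le> C * m ^ N * (y - x)\<^sup>2"
    by (rule estimates)
  note Cr = Cr[rule_format]
  obtain K where K: "K \<ge> 1" "\<forall>\<^sub>F z in at 0. cmod (V z) \<le> K * cmod z \<and> K * cmod z < r \<and> z \<noteq> 0"
    by (rule dominated_cmod_less[OF assms(1) Cr(2)])
  obtain L where L: "L \<ge> 1" "\<forall>\<^sub>F z in at 0. cmod (W z) \<le> L * cmod z \<and> L * cmod z < r \<and> z \<noteq> 0"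
    by (rule dominated_cmod_less[OF assms(2) Cr(2)])
  show ?thesis
  proof (rule dominated_power_weightI[of _ "2 * C" "max K L"], use K(2) L(2) in eventually_elim)
    case (elim z)
    define m where "m = max K L * cmod z"
    have "K * cmod z \<le> m" "L * cmod z \<le> m"
      unfolding m_def by (intro mult_right_mono max.cobounded1 max.cobounded2 norm_ge_zero)+
    with elim have Vm: "cmod (V z) \<le> m" and Wm: "cmod (W z) \<le> m" by linarith+
    have m: "0 \<le> m" "m < r"
    proof -
      show "0 \<le> m" using Vm norm_ge_zero[of "V z"] by linarith
      show "m < r" using elim unfolding m_def max_def by presburger
    qed
    define d where "d = cmod (V z) - cmod (W z)"
    have "\<bar>d\<bar> \<le> 1"
      using Vm Wm m Cr(3) norm_ge_zero[of "V z"] norm_ge_zero[of "W z"] unfolding d_def by linarith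
    then have sq: "d\<^sup>2 \<le> \<bar>d\<bar>"
      using mult_right_mono[of "\<bar>d\<bar>" 1 "\<bar>d\<bar>"] by (simp add: power2_eq_square)
    have "\<bar>f (cmod (V z)) - f (cmod (W z)) - f' (cmod (W z)) * d\<bar> \<le> C * m ^ N * d\<^sup>2"
      unfolding d_def by (rule Cr(5)) (use Vm Wm m in auto)
    also have "\<dots> \<le> C * m ^ N * \<bar>d\<bar>"
      using Cr(1) m sq by (intro mult_left_mono) auto
    finally have 1: "\<bar>f (cmod (V z)) - f (cmod (W z)) - f' (cmod (W z)) * d\<bar> \<le> C * m ^ N * \<bar>d\<bar>" .
    have 2: "\<bar>f' (cmod (W z)) * d\<bar> \<le> C * m ^ N * \<bar>d\<bar>"
      unfolding abs_mult by (intro mult_right_mono Cr(4)) (use Wm m in auto)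
    have "\<bar>f (cmod (V z)) - f (cmod (W z))\<bar> \<le> 2 * C * m ^ N * \<bar>d\<bar>"
      using 1 2 by linarith
    also have "\<dots> \<le> 2 * C * m ^ N * cmod (V z - W z)"
      using Cr(1) m norm_triangle_ineq3[of "V z" "W z"] unfolding d_def by (intro mult_left_mono) auto
    finally show ?case unfolding m_def .
  qed simp
qed

end

text \<open>The data of the model \<open>Re (Z * cis (- q |z|)) = G |z|\<close>: \<open>G\<close> vanishes to infinite order at \<open>0\<close> and is
  positive elsewhere. All the derivatives are one-sided at \<open>0\<close>.\<close>

locale flat_profile =
  fixes G G' G'' q q' q'' :: "real \<Rightarrow> real" and \<epsilon> :: real
  assumes eps_pos: "\<epsilon> > 0"
    and G_0: "G 0 = 0" and G'_0: "G' 0 = 0" and q_0: "q 0 = 0"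
    and G_pos: "\<And>x. 0 < x \<Longrightarrow> x < \<epsilon> \<Longrightarrow> G x > 0"
    and G_deriv: "\<And>x. x \<in> {0..<\<epsilon>} \<Longrightarrow> (G has_real_derivative G' x) (at x within {0..<\<epsilon>})"
    and G'_deriv: "\<And>x. x \<in> {0..<\<epsilon>} \<Longrightarrow> (G' has_real_derivative G'' x) (at x within {0..<\<epsilon>})"
    and G''_flat: "\<And>N. \<exists>C r. r > 0 \<and> (\<forall>x. 0 \<le> x \<and> x < r \<longrightarrow> \<bar>G'' x\<bar> \<le> C * x ^ N)"
    and q_deriv: "\<And>x. x \<in> {0..<\<epsilon>} \<Longrightarrow> (q has_real_derivative q' x) (at x within {0..<\<epsilon>})"
    and q'_deriv: "\<And>x. x \<in> {0..<\<epsilon>} \<Longrightarrow> (q' has_real_derivative q'' x) (at x within {0..<\<epsilon>})"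
    and q''_bounded: "\<exists>C r. r > 0 \<and> (\<forall>x. 0 \<le> x \<and> x < r \<longrightarrow> \<bar>q'' x\<bar> \<le> C)"
begin

lemma radial_G: "radial_function G G' G'' \<epsilon> N"
  by unfold_locales (use eps_pos G_deriv G'_deriv G'_0 G''_flat in auto)

lemma radial_q: "radial_function q q' q'' \<epsilon> 0"
  by unfold_locales (use eps_pos q_deriv q'_deriv q''_bounded in auto)

lemma flat_G': "flat (\<lambda>z. G' (cmod z))"
  unfolding flat_wrt_def using radial_function.dominated_deriv[OF radial_G] by simp

lemma G_taylor:
  assumes "dominated V cmod"
  shows "flat_wrt (\<lambda>z. G (cmod (V z)) - G (cmod z) - G' (cmod z) * (cmod (V z) - cmod z))
           (\<lambda>z. (cmod (V z) - cmod z)\<^sup>2)"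
  unfolding flat_wrt_def using radial_function.taylor[OF radial_G assms] by blast

lemma G_lipschitz:
  assumes "dominated V cmod" "dominated W cmod"
  shows "flat_wrt (\<lambda>z. G (cmod (V z)) - G (cmod (W z))) (\<lambda>z. cmod (V z - W z))"
  unfolding flat_wrt_def using radial_function.lipschitz[OF radial_G assms] by blast

lemma dominated_q': "dominated (\<lambda>z. q' (cmod z)) (\<lambda>_. 1)"
  using radial_function.dominated_deriv[OF radial_q] by simp

lemma q_taylor:
  assumes "dominated V cmod"
  shows "dominated (\<lambda>z. q (cmod (V z)) - q (cmod z) - q' (cmod z) * (cmod (V z) - cmod z))
           (\<lambda>z. (cmod (V z) - cmod z)\<^sup>2)"
  using radial_function.taylor[OF radial_q assms] by simp

lemma q_lipschitz:
  assumes "dominated V cmod" "dominated W cmod"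
  shows "dominated (\<lambda>z. q (cmod (V z)) - q (cmod (W z))) (\<lambda>z. cmod (V z - W z))"
  using radial_function.lipschitz[OF radial_q assms] by simp

lemma flat_G_of:
  assumes "dominated V cmod"
  shows "flat (\<lambda>z. G (cmod (V z)))"
proof -
  have "dominated (\<lambda>_. 0 :: complex) cmod" by (rule dominatedI[of _ 1]) simp
  from G_lipschitz[OF assms this]
  have 1: "flat_wrt (\<lambda>z. G (cmod (V z))) (\<lambda>z. cmod (V z))" by (simp add: G_0)
  have "((\<lambda>z. cmod z) \<longlongrightarrow> cmod 0) (at (0::complex))" by (intro tendsto_intros)
  then have "dominated cmod (\<lambda>_. 1)" by (rule dominated_tendsto)
  then have "dominated (\<lambda>z. cmod (V z)) (\<lambda>_. 1)"
    using dominated_trans[OF assms] dominated_def[of "\<lambda>z. cmod (V z)"] dominated_def[of V] by fastforce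
  then show ?thesis using flat_wrt_dominated_trans[OF 1] by blast
qed

lemma flat_G: "flat (\<lambda>z. G (cmod z))"
proof -
  have "dominated (\<lambda>z. z) cmod" by (rule dominatedI[of _ 1]) simp
  then show ?thesis by (rule flat_G_of)
qed

lemma dominated_q_of:
  assumes "dominated V cmod"
  shows "dominated (\<lambda>z. q (cmod (V z))) cmod"
proof -
  have "dominated (\<lambda>_. 0 :: complex) cmod" by (rule dominatedI[of _ 1]) simp
  from q_lipschitz[OF assms this]
  have 1: "dominated (\<lambda>z. q (cmod (V z))) (\<lambda>z. cmod (V z))" by (simp add: q_0)
  have "dominated (\<lambda>z. cmod (V z)) cmod"
    using assms dominated_def[of "\<lambda>z. cmod (V z)"] dominated_def[of V] by fastforce
  then show ?thesis using dominated_trans[OF 1] by blast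
qed

lemma G_power_bound:
  obtains C r where "0 < C" "0 < r" "r \<le> \<epsilon>" "\<And>x. 0 < x \<Longrightarrow> x < r \<Longrightarrow> G x \<le> C * x ^ N"
proof -
  obtain C r where C: "C > 0" "r > 0"
    "\<And>z. z \<noteq> 0 \<Longrightarrow> cmod z < r \<Longrightarrow> norm (G (cmod z)) \<le> C * cmod z ^ N"
    using flatD[OF flat_G] by metis
  show ?thesis
  proof (rule that[of C "min r \<epsilon>"])
    show "G x \<le> C * x ^ N" if "0 < x" "x < min r \<epsilon>" for x
      using C(3)[of "complex_of_real x"] that by auto
  qed (use C eps_pos in auto)
qed

lemma G_continuous: "continuous_on {0..<\<epsilon>} G"
proof (unfold continuous_on_eq_continuous_within, rule ballI)
  show "continuous (at x within {0..<\<epsilon>}) G" if "x \<in> {0..<\<epsilon>}" for x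
    by (rule DERIV_continuous[OF G_deriv[OF that]])
qed

text \<open>Since \<open>G\<close> vanishes to infinite order, multiplying it by a negative power still gives a
  function that is positive for positive arguments and tends to zero, so it has a maximum.\<close>

lemma weighted_max:
  assumes "0 < r" "r < \<epsilon>"
  obtains x where "0 < x" "x \<le> r" "\<And>y. 0 < y \<Longrightarrow> y \<le> r \<Longrightarrow> G y / y ^ N \<le> G x / x ^ N"
proof (rule attains_max_half_open[of r "\<lambda>x. G x / x ^ N"])
  show "continuous_on {0<..r} (\<lambda>x. G x / x ^ N)"
    by (intro continuous_intros continuous_on_subset[OF G_continuous]) (use assms in auto)
  obtain C s where C: "0 < C" "0 < s" "s \<le> \<epsilon>" "\<And>x. 0 < x \<Longrightarrow> x < s \<Longrightarrow> G x \<le> C * x ^ Suc N"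
    by (rule G_power_bound[of "Suc N"]) blast
  show "((\<lambda>x. G x / x ^ N) \<longlongrightarrow> 0) (at_right 0)"
  proof (rule Lim_null_comparison)
    have "\<forall>\<^sub>F x in at_right 0. 0 < x \<and> x < s"
      using C(2) unfolding eventually_at_right_field by blast
    then show "\<forall>\<^sub>F x in at_right 0. norm (G x / x ^ N) \<le> C * x"
      by eventually_elim (use C(3,4) G_pos in \<open>fastforce simp: field_simps\<close>)
    have "((\<lambda>x. C * x) \<longlongrightarrow> C * 0) (at_right 0)" by (intro tendsto_intros)
    then show "((\<lambda>x. C * x) \<longlongrightarrow> 0) (at_right 0)" by simp
  qed
next
  fix x assume "0 < x" "x \<le> r" "\<And>y. 0 < y \<Longrightarrow> y \<le> r \<Longrightarrow> G y / y ^ N \<le> G x / x ^ N"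
  then show thesis by (rule that)
qed (use assms G_pos in auto)

text \<open>The weight \<open>exp (- x)\<close> detects displacements from \<open>x\<close> to \<open>x - d\<close> with \<open>d\<close> of the order of a power of \<open>x\<close>,
  against which flat relative changes of \<open>G\<close> are negligible.\<close>

lemma exp_weighted_max:
  assumes "0 < r" "r < \<epsilon>"
  obtains x where "0 < x" "x \<le> r" "\<And>y. 0 < y \<Longrightarrow> y \<le> r \<Longrightarrow> G y * exp (- y) \<le> G x * exp (- x)"
proof (rule attains_max_half_open[of r "\<lambda>x. G x * exp (- x)"])
  show "continuous_on {0<..r} (\<lambda>x. G x * exp (- x))"
    by (intro continuous_intros continuous_on_subset[OF G_continuous]) (use assms in auto)
  have "(G \<longlongrightarrow> G 0) (at 0 within {0..<\<epsilon>})"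
    using G_continuous eps_pos by (simp add: continuous_on_def)
  then have "(G \<longlongrightarrow> 0) (at 0 within {0<..<\<epsilon>})"
    unfolding G_0 by (rule tendsto_within_subset) auto
  then have "(G \<longlongrightarrow> 0) (at_right 0)"
    using at_within_nhd[of 0 "{..<\<epsilon>}" "{0<..<\<epsilon>}" "{0<..}"] eps_pos by (simp add: Int_def greaterThanLessThan_def)
  then have "((\<lambda>x. G x * exp (- x)) \<longlongrightarrow> 0 * exp (- 0)) (at_right 0)" by (intro tendsto_intros)
  then show "((\<lambda>x. G x * exp (- x)) \<longlongrightarrow> 0) (at_right 0)" by simp
next
  fix x assume "0 < x" "x \<le> r" "\<And>y. 0 < y \<Longrightarrow> y \<le> r \<Longrightarrow> G y * exp (- y) \<le> G x * exp (- x)"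
  then show thesis by (rule that)
qed (use assms G_pos in auto)

text \<open>If \<open>G'/G\<close> were bounded by \<open>C/x\<close>, then \<open>G\<close> could not decay faster than \<open>x ^ C\<close>.\<close>

lemma log_derivative_unbounded:
  assumes "0 < r" "r < \<epsilon>"
  shows "\<exists>x. 0 < x \<and> x < r \<and> \<bar>G' x\<bar> * x > C * G x"
proof (rule ccontr)
  assume "\<not> ?thesis"
  then have bd: "\<bar>G' x\<bar> * x \<le> C * G x" if "0 < x" "x < r" for x using that by force
  obtain N :: nat where N: "real N > C" using reals_Archimedean2 by blast
  obtain x where x: "0 < x" "x \<le> r" "\<And>y. 0 < y \<Longrightarrow> y \<le> r \<Longrightarrow> G y / y ^ N \<le> G x / x ^ N"
    by (rule weighted_max[OF assms]) blast
  have "G (x/2) / (x/2) ^ N > G x / x ^ N"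
  proof (rule DERIV_neg_imp_decreasing_open[of "x/2" x "\<lambda>x. G x / x ^ N"])
    fix y assume y: "x / 2 < y" "y < x"
    then have y0: "0 < y" "y < r" using x by auto
    have "(G has_real_derivative G' y) (at y)"
    proof -
      have "(G has_real_derivative G' y) (at y within {0<..<\<epsilon>})"
        by (rule DERIV_subset[OF G_deriv]) (use y0 assms(2) in auto)
      then show ?thesis using at_within_open[of y "{0<..<\<epsilon>}"] y0 assms(2) by simp
    qed
    then have D: "((\<lambda>x. G x / x ^ N) has_real_derivative
        (G' y * y ^ N - G y * (N * y ^ (N - 1))) / (y ^ N * y ^ N)) (at y)"
      using y0 by (auto intro!: derivative_eq_intros)
    have "G' y * y < N * G y"
    proof -
      have "G' y * y \<le> C * G y" using bd[OF y0] y0 by (smt (verit) abs_ge_self mult_right_mono)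
      also have "\<dots> < N * G y" using N G_pos[of y] y0 assms(2) by simp
      finally show ?thesis .
    qed
    then have "G' y * y ^ N < G y * (N * y ^ (N - 1))"
    proof (cases N)
      case 0
      with \<open>G' y * y < N * G y\<close> show ?thesis using y0 by (simp add: mult_less_0_iff)
    next
      case (Suc n)
      have "(G' y * y) * y ^ n < (N * G y) * y ^ n"
        using \<open>G' y * y < N * G y\<close> y0 by simp
      then show ?thesis using Suc by (simp add: mult_ac)
    qed
    then have "(G' y * y ^ N - G y * (N * y ^ (N - 1))) / (y ^ N * y ^ N) < 0"
      using y0 by (intro divide_neg_pos) auto
    then show "\<exists>D. ((\<lambda>x. G x / x ^ N) has_real_derivative D) (at y) \<and> D < 0" using D by blast
  next
    show "continuous_on {x / 2..x} (\<lambda>x. G x / x ^ N)"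
      by (intro continuous_intros continuous_on_subset[OF G_continuous]) (use assms x in auto)
  qed (use x in auto)
  with x(3)[of "x/2"] x(1,2) show False by simp
qed

end

section \<open>Further rules for orders of vanishing\<close>

lemma dominated_radius:
  assumes "dominated f g"
  obtains C r where "C > 0" "r > 0" "\<forall>z. z \<noteq> 0 \<and> cmod z < r \<longrightarrow> norm (f z) \<le> C * \<bar>g z\<bar>"
proof -
  obtain C where C: "C > 0" "\<forall>\<^sub>F z in at 0. norm (f z) \<le> C * \<bar>g z\<bar>"
    using assms by (rule dominatedE)
  obtain r where "r > 0" "\<forall>z. z \<noteq> 0 \<and> cmod z < r \<longrightarrow> norm (f z) \<le> C * \<bar>g z\<bar>"
    using C(2) unfolding eventually_at by (auto simp: dist_norm)
  then show ?thesis using C(1) by (intro that)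
qed

lemma eventually_radius:
  assumes "\<forall>\<^sub>F z in at (0::complex). P z"
  obtains r where "r > 0" "\<forall>z. z \<noteq> 0 \<and> cmod z < r \<longrightarrow> P z"
  using assms unfolding eventually_at by (auto simp: dist_norm)

lemma Re_of_real_mult: "Re (of_real r * z) = r * Re z"
  by simp

lemma dominated_one: "dominated (\<lambda>_. c) (\<lambda>_. 1)"
  by (rule dominatedI[of _ "norm c"]) simp

lemma dominated_refl: "dominated g g"
  by (rule dominatedI[of _ 1]) simp

lemma dominated_norm_iff: "dominated (\<lambda>z. norm (f z)) g \<longleftrightarrow> dominated f g"
  unfolding dominated_def by simp

lemma dominated_cmult: "dominated f g \<Longrightarrow> dominated (\<lambda>z. c * f z :: 'b::real_normed_algebra) g"
  using dominated_mult[OF dominated_one[of c], of f g] by simp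

lemma dominated_mult_bounded:
  fixes f f' :: "complex \<Rightarrow> 'b::real_normed_algebra"
  shows "dominated f g \<Longrightarrow> dominated f' (\<lambda>_. 1) \<Longrightarrow> dominated (\<lambda>z. f z * f' z) g"
  using dominated_mult[of f g f' "\<lambda>_. 1"] by simp

lemma dominated_power:
  fixes f :: "complex \<Rightarrow> 'b::real_normed_algebra_1"
  assumes "dominated f h"
  shows "dominated (\<lambda>z. f z ^ n) (\<lambda>z. h z ^ n)"
proof (induction n)
  case 0
  then show ?case using dominated_one[of 1] by simp
next
  case (Suc n)
  then show ?case using dominated_mult[OF assms, of "\<lambda>z. f z ^ n"] by simp
qed

lemma flat_wrt_mult_bounded:
  fixes f f' :: "complex \<Rightarrow> 'b::real_normed_algebra"
  shows "flat_wrt f g \<Longrightarrow> dominated f' (\<lambda>_. 1) \<Longrightarrow> flat_wrt (\<lambda>z. f z * f' z) g"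
  using flat_wrt_mult[of f g f' "\<lambda>_. 1"] by simp

lemma flat_wrt_eventually_eq:
  "flat_wrt f g \<Longrightarrow> \<forall>\<^sub>F z in at 0. f' z = f z \<Longrightarrow> flat_wrt f' g"
  by (erule flat_wrt_cong) (auto elim: eventually_mono)

lemma dominated_eventually_eq:
  "dominated f g \<Longrightarrow> \<forall>\<^sub>F z in at 0. f' z = f z \<Longrightarrow> dominated f' g"
  by (erule dominated_cong) (auto elim: eventually_mono)

lemma flat_wrt_cancel:
  fixes E :: "complex \<Rightarrow> real"
  assumes "flat_wrt (\<lambda>z. g z * E z) g" "\<forall>\<^sub>F z in at 0. g z \<noteq> 0"
  shows "flat E"
  unfolding flat_wrt_def
proof
  fix N
  obtain C where C: "\<forall>\<^sub>F z in at 0. norm (g z * E z) \<le> C * \<bar>g z * cmod z ^ N\<bar>"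
    using flat_wrtD[OF assms(1)] by (rule dominatedE)
  show "dominated E (\<lambda>z. 1 * cmod z ^ N)"
  proof (rule dominatedI[of _ C], use C assms(2) in eventually_elim)
    case (elim z)
    then have "\<bar>g z\<bar> * \<bar>E z\<bar> \<le> \<bar>g z\<bar> * (C * cmod z ^ N)" by (simp add: abs_mult mult_ac)
    then show ?case using elim by simp
  qed
qed

text \<open>A chord of the unit circle is not longer than its arc.\<close>

lemma cmod_cis_diff_le: "cmod (cis a - cis b) \<le> \<bar>a - b\<bar>"
proof -
  have "cis a - cis b = cis b * (cis (a - b) - 1)" by (simp add: algebra_simps cis_mult)
  then have "cmod (cis a - cis b) = cmod (cis (a - b) - 1)" by (simp add: norm_mult)
  also have "\<dots> \<le> \<bar>a - b\<bar>"
  proof -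
    define t where "t = a - b"
    have "(cmod (cis t - 1))\<^sup>2 = (cos t)\<^sup>2 + (sin t)\<^sup>2 + 1 - 2 * cos t"
      unfolding cmod_power2 by (simp add: power2_eq_square algebra_simps)
    also have "\<dots> = 2 - 2 * cos (2 * (t / 2))" by simp
    also have "\<dots> = 4 * (sin (t / 2))\<^sup>2" unfolding cos_double_sin by simp
    also have "\<dots> \<le> 4 * (t / 2)\<^sup>2"
      using abs_sin_x_le_abs_x[of "t / 2"] by (intro mult_left_mono abs_le_square_iff[THEN iffD1]) auto
    also have "\<dots> = \<bar>t\<bar>\<^sup>2" by (simp add: power2_eq_square)
    finally show ?thesis unfolding t_def[symmetric] by (rule power2_le_imp_le) simp
  qed
  finally show ?thesis .
qed

lemma holomorphic_quotient:
  assumes "h holomorphic_on ball 0 R" "R > 0" "h 0 = 0"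
  obtains y where "y holomorphic_on ball 0 R" "y 0 = deriv h 0" "\<forall>z. h z = z * y z"
proof (rule that[of "\<lambda>z. if z = 0 then deriv h 0 else (h z - h 0) / (z - 0)"])
  show "(\<lambda>z. if z = 0 then deriv h 0 else (h z - h 0) / (z - 0)) holomorphic_on ball 0 R"
    by (rule pole_lemma[OF assms(1)]) (use assms(2) in simp)
qed (use assms(3) in auto)

section \<open>The leading terms of a map preserving the model\<close>

text \<open>The Jacobian condition says that \<open>(U, V)\<close> is a local biholomorphism; \<open>coeff1 U 1 0\<close> is the derivative
  of \<open>U\<close> with respect to \<open>Z\<close> at the origin.\<close>

locale profile_map = flat_profile +
  U: separately_holomorphic U R B + V: separately_holomorphic V R B
  for U V :: "complex \<Rightarrow> complex \<Rightarrow> complex" and R B :: real +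
  assumes U00: "U 0 0 = 0" and V00: "V 0 0 = 0"
    and jacobian: "coeff1 U 1 0 * deriv (V 0) 0 \<noteq> deriv (U 0) 0 * coeff1 V 1 0"
    and preserves: "\<And>Z z. Z \<in> ball 0 R \<Longrightarrow> z \<in> ball 0 R \<Longrightarrow> Re (Z * cis (- q (cmod z))) = G (cmod z) \<Longrightarrow>
       Re (U Z z * cis (- q (cmod (V Z z)))) = G (cmod (V Z z))"
begin

abbreviation g :: "complex \<Rightarrow> real" where "g z \<equiv> G (cmod z)"

text \<open>For constant \<open>\<omega>\<close> with real part \<open>1\<close> the point \<open>(test_point \<omega> z, z)\<close> lies on the model, and its
  first component is flat in \<open>z\<close>.\<close>

definition test_point :: "complex \<Rightarrow> complex \<Rightarrow> complex" where
  "test_point \<omega> z = \<omega> * cis (q (cmod z)) * of_real (g z)"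

abbreviation W :: "complex \<Rightarrow> complex \<Rightarrow> complex" where
  "W \<omega> z \<equiv> V (test_point \<omega> z) z"

lemma g_pos: "\<forall>\<^sub>F z in at 0. g z > 0"
  using eventually_at0_norm_less[OF eps_pos] by eventually_elim (use G_pos in auto)

lemma g_tendsto: "(g \<longlongrightarrow> 0) (at 0)"
  by (rule flat_tendsto_0[OF flat_G])

lemma cmod_test_point: "cmod (test_point \<omega> z) = cmod \<omega> * \<bar>g z\<bar>"
  by (simp add: test_point_def norm_mult)

lemma dominated_test_point: "dominated (test_point \<omega>) g"
  by (rule dominatedI[of _ "cmod \<omega>"]) (simp add: cmod_test_point)

lemma test_point_tendsto: "(test_point \<omega> \<longlongrightarrow> 0) (at 0)"
  by (rule dominated_tendsto_0[OF dominated_test_point g_tendsto])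

lemma dominated_test_point_power: "dominated (\<lambda>z. test_point \<omega> z ^ k) (\<lambda>z. g z ^ k)"
  by (rule dominated_power[OF dominated_test_point])

lemma remainder_weight: "dominated (\<lambda>z. cmod (test_point \<omega> z) ^ j) (\<lambda>z. g z ^ j)"
  using dominated_test_point_power[of \<omega> j] by (simp only: dominated_norm_iff flip: norm_power)

lemma U_remainder:
  "dominated (\<lambda>z. U (test_point \<omega> z) z - (\<Sum>i<j. coeff1 U i z * test_point \<omega> z ^ i)) (\<lambda>z. g z ^ j)"
  by (rule dominated_trans[OF U.dominated_coeff1_remainder[OF test_point_tendsto] remainder_weight])

lemma V_remainder:
  "dominated (\<lambda>z. W \<omega> z - (\<Sum>i<j. coeff1 V i z * test_point \<omega> z ^ i)) (\<lambda>z. g z ^ j)"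
  by (rule dominated_trans[OF V.dominated_coeff1_remainder[OF test_point_tendsto] remainder_weight])

lemma test_point_in_ball: "\<forall>\<^sub>F z in at 0. test_point \<omega> z \<in> ball 0 R \<and> z \<in> ball 0 R \<and> z \<noteq> 0"
proof -
  have "\<forall>\<^sub>F z in at 0. dist (test_point \<omega> z) 0 < R"
    using test_point_tendsto U.R_pos by (rule tendstoD)
  then show ?thesis using eventually_at0_norm_less[OF U.R_pos] by eventually_elim auto
qed

lemma equation:
  assumes "Re \<omega> = 1"
  shows "\<forall>\<^sub>F z in at 0. Re (U (test_point \<omega> z) z * cis (- q (cmod (W \<omega> z)))) = G (cmod (W \<omega> z))"
  using test_point_in_ball[of \<omega>]
proof eventually_elim
  case (elim z)
  have "test_point \<omega> z * cis (- q (cmod z)) = \<omega> * of_real (g z)"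
  proof -
    have "test_point \<omega> z * cis (- q (cmod z)) = \<omega> * of_real (g z) * (cis (q (cmod z)) * cis (- q (cmod z)))"
      by (simp only: test_point_def mult_ac)
    then show ?thesis by (simp add: cis_mult)
  qed
  then show ?case using elim assms by (intro preserves) auto
qed

lemma dominated_V0: "dominated (V 0) cmod"
  by (rule holomorphic_dominated_zero[OF V.holo2]) (use V.R_pos V00 in auto)

lemma dominated_g_cmod: "dominated g cmod"
  using flat_wrtD[OF flat_G, of 1] by simp

lemma dominated_W_diff: "dominated (\<lambda>z. W \<omega> z - V 0 z) g"
proof -
  have "dominated (\<lambda>z. W \<omega> z - coeff1 V 0 z) g"
    using V_remainder[of \<omega> 1] by simp
  then show ?thesis
    by (rule dominated_eventually_eq)
       (use test_point_in_ball in \<open>eventually_elim, auto simp: V.coeff1_0\<close>)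
qed

lemma dominated_W: "dominated (W \<omega>) cmod"
  using dominated_add[OF dominated_trans[OF dominated_W_diff dominated_g_cmod] dominated_V0] by simp

lemma bounded_cis: "dominated (\<lambda>z. cis (f z)) (\<lambda>_. 1)"
  by (rule dominatedI[of _ 1]) simp

text \<open>The terms that do not involve \<open>Z\<close> give that \<open>Re (U 0 z * cis (- q |V|))\<close> is flat. The factor \<open>cis\<close>
  is \<open>1 + O(|z|)\<close>, too close to \<open>1\<close> to hide a leading term of \<open>U 0\<close>.\<close>

lemma U0_eq_0:
  assumes "z \<in> ball 0 R"
  shows "U 0 z = 0"
proof (rule ccontr)
  assume nz: "U 0 z \<noteq> 0"
  have holo: "U 0 holomorphic_on ball 0 R" by (rule U.holo2) (use U.R_pos in simp)
  obtain k c C r where kc: "0 < k" "0 < c" "0 < r" "r \<le> R"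
    "\<forall>z. cmod z < r \<longrightarrow> cmod (U 0 z) \<le> C * cmod z ^ k"
    "\<forall>x \<kappa>. 0 < x \<and> x < r \<longrightarrow> (\<exists>z. cmod z = x \<and> c * cmod \<kappa> * x ^ k \<le> Re (\<kappa> * U 0 z))"
    by (rule holomorphic_direction[OF holo U.R_pos U00 assms nz])
  let ?c = "\<lambda>z. cis (- q (cmod (W 1 z)))"
  have rem: "dominated (\<lambda>z. U (test_point 1 z) z - U 0 z) g"
  proof -
    have "dominated (\<lambda>z. U (test_point 1 z) z - coeff1 U 0 z) g"
      using U_remainder[of 1 1] by simp
    then show ?thesis
      by (rule dominated_eventually_eq)
         (use test_point_in_ball in \<open>eventually_elim, auto simp: U.coeff1_0\<close>)
  qed
  have "dominated (\<lambda>z. (U (test_point 1 z) z - U 0 z) * ?c z) g"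
    by (rule dominated_mult_bounded[OF rem bounded_cis])
  then have "flat (\<lambda>z. Re ((U (test_point 1 z) z - U 0 z) * ?c z))"
    by (intro flat_wrt_Re dominated_flat_wrt_trans[OF _ flat_G])
  then have "flat (\<lambda>z. G (cmod (W 1 z)) - Re ((U (test_point 1 z) z - U 0 z) * ?c z))"
    by (intro flat_wrt_diff flat_G_of dominated_W)
  moreover have "\<forall>\<^sub>F z in at 0. Re (U 0 z * ?c z) =
      G (cmod (W 1 z)) - Re ((U (test_point 1 z) z - U 0 z) * ?c z)"
    using equation[of 1, OF one_complex.sel(1)]
    by eventually_elim (simp only: left_diff_distrib minus_complex.sel)
  ultimately have fl: "flat (\<lambda>z. Re (U 0 z * ?c z))" by (rule flat_wrt_eventually_eq)
  have dU: "dominated (U 0) (\<lambda>z. cmod z ^ k)"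
    by (rule dominatedI[of _ C], use eventually_at0_norm_less[OF kc(3)] in eventually_elim)
       (use kc(5) in auto)
  have "dominated (\<lambda>z. ?c z - 1) (\<lambda>z. q (cmod (W 1 z)))"
  proof (rule dominatedI[of _ 1], rule always_eventually, rule allI)
    show "norm (?c z - 1) \<le> 1 * \<bar>q (cmod (W 1 z))\<bar>" for z
      using cmod_cis_diff_le[of "- q (cmod (W 1 z))" 0] by simp
  qed
  then have dc: "dominated (\<lambda>z. ?c z - 1) cmod"
    by (rule dominated_trans) (rule dominated_q_of[OF dominated_W])
  have "dominated (\<lambda>z. Re (U 0 z * ?c z) - Re (U 0 z * (?c z - 1))) (\<lambda>z. cmod z ^ Suc k)"
  proof (rule dominated_diff)
    show "dominated (\<lambda>z. Re (U 0 z * ?c z)) (\<lambda>z. cmod z ^ Suc k)"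
      using flat_wrtD[OF fl, of "Suc k"] by simp
    show "dominated (\<lambda>z. Re (U 0 z * (?c z - 1))) (\<lambda>z. cmod z ^ Suc k)"
      using dominated_Re[OF dominated_mult[OF dU dc]] by (simp add: mult.commute)
  qed
  then have "dominated (\<lambda>z. Re (U 0 z)) (\<lambda>z. cmod z ^ Suc k)" by (simp add: algebra_simps)
  then obtain D s where D: "D > 0" "s > 0"
    "\<forall>z. z \<noteq> 0 \<and> cmod z < s \<longrightarrow> norm (Re (U 0 z)) \<le> D * \<bar>cmod z ^ Suc k\<bar>"
    by (rule dominated_radius)
  show False
  proof (rule power_contradiction[of c "min r s" k D])
    fix x assume x: "0 < x" "x < min r s"
    then obtain z where z: "cmod z = x" "c * cmod 1 * x ^ k \<le> Re (1 * U 0 z)"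
      using kc(6)[rule_format, of x 1] by auto
    then have "norm (Re (U 0 z)) \<le> D * \<bar>cmod z ^ Suc k\<bar>" using D(3) x by auto
    moreover have "\<bar>cmod z ^ Suc k\<bar> = x ^ Suc k" using z x by simp
    moreover have "c * x ^ k \<le> Re (U 0 z)" using z by simp
    ultimately show "c * x ^ k \<le> D * x ^ Suc k" by (simp only: real_norm_def)
  qed (use kc D in auto)
qed

lemma deriv_U0: "deriv (U 0) 0 = 0"
proof -
  have "\<forall>\<^sub>F z in nhds 0. U 0 z = 0"
    using U0_eq_0 U.R_pos by (intro eventually_nhds_in_open[of "ball 0 R" 0, THEN eventually_mono]) auto
  then have "deriv (U 0) 0 = deriv (\<lambda>_. 0) 0" by (rule deriv_cong_ev) simp
  then show ?thesis by simp
qed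

definition b :: complex where "b = deriv (V 0) 0"

abbreviation u :: "complex \<Rightarrow> complex" where "u \<equiv> coeff1 U 1"

lemma b_nonzero: "b \<noteq> 0" and u_nonzero: "u 0 \<noteq> 0"
  using jacobian unfolding b_def deriv_U0 by auto

lemma u_holomorphic: "u holomorphic_on ball 0 R"
  by (rule U.coeff1_holomorphic)

lemma U_second_order:
  "dominated (\<lambda>z. U (test_point \<omega> z) z - test_point \<omega> z * u z) (\<lambda>z. g z * g z)"
proof -
  have "dominated (\<lambda>z. U (test_point \<omega> z) z - (\<Sum>i<2. coeff1 U i z * test_point \<omega> z ^ i)) (\<lambda>z. g z * g z)"
    using U_remainder[of \<omega> 2] by (simp only: power2_eq_square)
  then show ?thesis
    by (rule dominated_eventually_eq)
       (use test_point_in_ball in \<open>eventually_elim, auto simp: U.coeff1_0 U0_eq_0 numeral_2_eq_2\<close>)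
qed

text \<open>The modulus of \<open>w\<close> is that of \<open>u\<close>; its phase collects the change of \<open>q\<close> under \<open>V 0\<close>.\<close>

definition w :: "complex \<Rightarrow> complex" where
  "w z = u z * cis (q (cmod z) - q (cmod (V 0 z)))"

definition ratio :: "complex \<Rightarrow> real" where
  "ratio z = G (cmod (V 0 z)) / g z"

lemma u_bounded: "dominated u (\<lambda>_. 1)"
  by (rule holomorphic_dominated[OF u_holomorphic U.R_pos])

text \<open>This is the part of order \<open>G\<close> of the invariance equation. Replacing \<open>V\<close> by \<open>V 0\<close> inside \<open>q\<close> costs
  \<open>O(G)\<close>, which is multiplied by \<open>Z = O(G)\<close>; inside \<open>G\<close> it costs \<open>O(G)\<close> times the flat derivative of \<open>G\<close>.\<close>

lemma first_order:
  assumes "Re \<omega> = 1"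
  shows "flat (\<lambda>z. Re (\<omega> * w z) - ratio z)"
proof (rule flat_wrt_cancel[of g])
  let ?c = "\<lambda>z. cis (- q (cmod (W \<omega> z)))" and ?d = "\<lambda>z. cis (- q (cmod (V 0 z)))"
  have WV: "dominated (\<lambda>z. cmod (W \<omega> z - V 0 z)) g"
    using dominated_W_diff by (simp add: dominated_norm_iff)
  have gg: "flat_wrt (\<lambda>z. g z * g z) g"
    by (rule flat_wrt_flat_weight[OF dominated_refl flat_G])
  have "dominated (\<lambda>z. ?d z - ?c z) (\<lambda>z. q (cmod (W \<omega> z)) - q (cmod (V 0 z)))"
  proof (rule dominatedI[of _ 1], rule always_eventually, rule allI)
    show "norm (?d z - ?c z) \<le> 1 * \<bar>q (cmod (W \<omega> z)) - q (cmod (V 0 z))\<bar>" for z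
      using cmod_cis_diff_le[of "- q (cmod (V 0 z))" "- q (cmod (W \<omega> z))"] by simp
  qed
  then have "dominated (\<lambda>z. ?d z - ?c z) g"
    using dominated_trans[OF dominated_trans[OF _ q_lipschitz[OF dominated_W dominated_V0]] WV] by blast
  from dominated_mult[OF dominated_mult_bounded[OF dominated_test_point u_bounded, of \<omega>] this]
  have 1: "flat_wrt (\<lambda>z. Re (test_point \<omega> z * u z * (?d z - ?c z))) g"
    by (intro flat_wrt_Re) (rule dominated_flat_wrt_trans[OF _ gg])
  have 2: "flat_wrt (\<lambda>z. Re ((U (test_point \<omega> z) z - test_point \<omega> z * u z) * ?c z)) g"
    by (intro flat_wrt_Re dominated_flat_wrt_trans[OF _ gg] dominated_mult_bounded U_second_order bounded_cis)
  have 3: "flat_wrt (\<lambda>z. G (cmod (W \<omega> z)) - G (cmod (V 0 z))) g"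
    by (rule flat_wrt_dominated_trans[OF G_lipschitz[OF dominated_W dominated_V0] WV])
  from flat_wrt_add[OF flat_wrt_diff[OF 1 2] 3]
  show "flat_wrt (\<lambda>z. g z * (Re (\<omega> * w z) - ratio z)) g"
  proof (rule flat_wrt_eventually_eq, use equation[OF assms] g_pos in eventually_elim)
    case (elim z)
    have e: "of_real (g z) * (\<omega> * w z) = test_point \<omega> z * u z * ?d z"
      by (simp add: test_point_def w_def cis_divide[symmetric] divide_inverse mult_ac flip: cis_inverse)
    have "g z * Re (\<omega> * w z) = Re (test_point \<omega> z * u z * ?d z)"
      unfolding e[symmetric] by simp
    moreover have "g z * ratio z = G (cmod (V 0 z))" using elim(2) by (simp add: ratio_def)
    moreover have "Re (test_point \<omega> z * u z * (?d z - ?c z)) = Re (test_point \<omega> z * u z * ?d z) - Re (test_point \<omega> z * u z * ?c z)"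
      by (simp only: right_diff_distrib minus_complex.sel)
    moreover have "Re ((U (test_point \<omega> z) z - test_point \<omega> z * u z) * ?c z) =
        Re (U (test_point \<omega> z) z * ?c z) - Re (test_point \<omega> z * u z * ?c z)"
      by (simp only: left_diff_distrib minus_complex.sel)
    ultimately show ?case using elim(1) unfolding right_diff_distrib by linarith
  qed
  show "\<forall>\<^sub>F z in at 0. g z \<noteq> 0" using g_pos by eventually_elim auto
qed

text \<open>Subtract the equations for \<open>\<omega> = 1\<close> and \<open>\<omega> = 1 + \<i>\<close>.\<close>

lemma flat_Im_w: "flat (\<lambda>z. Im (w z))"
proof -
  have "flat (\<lambda>z. (Re (1 * w z) - ratio z) - (Re (Complex 1 1 * w z) - ratio z))"
    by (intro flat_wrt_diff first_order) auto
  then show ?thesis by simp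
qed

lemma flat_Re_w: "flat (\<lambda>z. Re (w z) - ratio z)"
  using first_order[of 1] by simp

lemma cmod_w: "cmod (w z) = cmod (u z)"
  by (simp add: w_def norm_mult)

text \<open>The ratio is nonnegative and flatly close to \<open>Re w\<close>, whose modulus tends to that of \<open>u 0\<close> since \<open>Im w\<close>
  tends to \<open>0\<close>.\<close>

lemma ratio_tendsto: "(ratio \<longlongrightarrow> cmod (u 0)) (at 0)"
proof -
  note holomorphic_isCont_0[OF u_holomorphic U.R_pos]
  then have "((\<lambda>z. sqrt ((cmod (u z))\<^sup>2 - (Im (w z))\<^sup>2)) \<longlongrightarrow> sqrt ((cmod (u 0))\<^sup>2 - 0\<^sup>2)) (at 0)"
    by (intro tendsto_intros flat_tendsto_0[OF flat_Im_w])
  moreover have "sqrt ((cmod (u z))\<^sup>2 - (Im (w z))\<^sup>2) = \<bar>Re (w z)\<bar>" for z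
    unfolding cmod_w[symmetric] cmod_power2 by simp
  ultimately have 1: "((\<lambda>z. \<bar>Re (w z)\<bar>) \<longlongrightarrow> cmod (u 0)) (at 0)" by simp
  have "((\<lambda>z. \<bar>ratio z\<bar> - \<bar>Re (w z)\<bar>) \<longlongrightarrow> 0) (at 0)"
  proof (rule Lim_null_comparison)
    show "\<forall>\<^sub>F z in at 0. norm (\<bar>ratio z\<bar> - \<bar>Re (w z)\<bar>) \<le> \<bar>Re (w z) - ratio z\<bar>"
      by (rule always_eventually) auto
    show "((\<lambda>z. \<bar>Re (w z) - ratio z\<bar>) \<longlongrightarrow> 0) (at 0)"
      by (rule tendsto_rabs_zero[OF flat_tendsto_0[OF flat_Re_w]])
  qed
  from tendsto_add[OF this 1] have 2: "((\<lambda>z. \<bar>ratio z\<bar>) \<longlongrightarrow> cmod (u 0)) (at 0)" by simp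
  have "\<forall>\<^sub>F z in at 0. cmod (V 0 z) < \<epsilon>"
    using tendstoD[OF holomorphic_isCont_0[OF V.holo2 V.R_pos] eps_pos, of 0] V.R_pos V00 by simp
  then have "\<forall>\<^sub>F z in at 0. \<bar>ratio z\<bar> = ratio z"
    using g_pos
  proof eventually_elim
    case (elim z)
    have "G (cmod (V 0 z)) \<ge> 0" using G_pos[of "cmod (V 0 z)"] elim G_0 by (cases "V 0 z = 0") auto
    then show ?case using elim(2) by (simp add: ratio_def)
  qed
  then show ?thesis using 2 by (rule Lim_transform_eventually[rotated])
qed

section \<open>The map is a rotation to first order\<close>

lemma V0_continuous_ray: "r < R \<Longrightarrow> continuous_on {0..r} (\<lambda>x. cmod (V 0 (of_real x)))"
  by (intro continuous_intros continuous_on_compose2[OF holomorphic_on_imp_continuous_on[OF V.holo2]])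
     (use V.R_pos in auto)

definition v :: "complex \<Rightarrow> complex" where
  "v = (SOME y. y holomorphic_on ball 0 R \<and> y 0 = b \<and> (\<forall>z. V 0 z = z * y z))"

lemma v: "v holomorphic_on ball 0 R" "v 0 = b" "V 0 z = z * v z"
proof -
  have holo: "V 0 holomorphic_on ball 0 R" by (rule V.holo2) (use V.R_pos in simp)
  have "\<exists>y. y holomorphic_on ball 0 R \<and> y 0 = b \<and> (\<forall>z. V 0 z = z * y z)"
    unfolding b_def by (rule holomorphic_quotient[OF holo V.R_pos V00]) blast
  from someI_ex[OF this] show "v holomorphic_on ball 0 R" "v 0 = b" "V 0 z = z * v z"
    unfolding v_def by blast+
qed

lemma ratio_bounds:
  obtains c C where "0 < c" "0 < C"
    "\<forall>\<^sub>F z in at 0. c * g z \<le> G (cmod (V 0 z)) \<and> G (cmod (V 0 z)) \<le> C * g z"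
proof (rule that)
  have u: "0 < cmod (u 0)" using u_nonzero by simp
  show "0 < cmod (u 0) / 2" "0 < 2 * cmod (u 0)" using u by auto
  have "\<forall>\<^sub>F z in at 0. cmod (u 0) / 2 < ratio z"
    by (rule order_tendstoD(1)[OF ratio_tendsto]) (use u in linarith)
  moreover have "\<forall>\<^sub>F z in at 0. ratio z < 2 * cmod (u 0)"
    by (rule order_tendstoD(2)[OF ratio_tendsto]) (use u in linarith)
  ultimately show "\<forall>\<^sub>F z in at 0. cmod (u 0) / 2 * g z \<le> G (cmod (V 0 z)) \<and> G (cmod (V 0 z)) \<le> 2 * cmod (u 0) * g z"
    using g_pos
  proof eventually_elim
    case (elim z)
    then have "G (cmod (V 0 z)) = ratio z * g z" by (simp add: ratio_def)
    then show ?case using elim by (auto intro!: mult_right_mono)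
  qed
qed

text \<open>A contraction moves a maximum point of \<open>G x / x ^ N\<close> to a smaller radius. There \<open>G\<close> has lost at most
  a fixed factor while \<open>x ^ N\<close> has lost a factor that is arbitrarily large with \<open>N\<close>.\<close>

lemma not_contracting: "\<not> cmod b < 1"
proof
  assume "cmod b < 1"
  then obtain \<rho> where \<rho>: "cmod b < \<rho>" "\<rho> < 1" using dense by blast
  then have \<rho>0: "0 < \<rho>" by (meson le_less_trans norm_ge_zero)
  obtain c C where c: "0 < c" "0 < C"
    "\<forall>\<^sub>F z in at 0. c * g z \<le> G (cmod (V 0 z)) \<and> G (cmod (V 0 z)) \<le> C * g z"
    by (rule ratio_bounds)
  have lim: "((\<lambda>z. cmod (v z)) \<longlongrightarrow> cmod b) (at 0)"
    using tendsto_norm[OF holomorphic_isCont_0[OF v(1) V.R_pos]] by (simp add: v(2))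
  have "\<forall>\<^sub>F z in at 0. cmod (v z) < \<rho>" by (rule order_tendstoD(2)[OF lim \<rho>(1)])
  moreover have "\<forall>\<^sub>F z in at 0. 0 < cmod (v z)"
    by (rule order_tendstoD(1)[OF lim]) (use b_nonzero in simp)
  moreover note c(3)
  ultimately have "\<forall>\<^sub>F z in at 0. c * g z \<le> G (cmod (V 0 z)) \<and> cmod (v z) < \<rho> \<and> 0 < cmod (v z)"
    by eventually_elim auto
  then obtain r where r: "r > 0"
    "\<forall>z. z \<noteq> 0 \<and> cmod z < r \<longrightarrow> c * g z \<le> G (cmod (V 0 z)) \<and> cmod (v z) < \<rho> \<and> 0 < cmod (v z)"
    by (rule eventually_radius)
  \<comment> \<open>with this \<open>N\<close> the contraction increases \<open>G x / x ^ N\<close>\<close>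
  obtain N where N: "1 / c < (1 / \<rho>) ^ N"
    using real_arch_pow[of "1 / \<rho>" "1 / c"] \<rho> \<rho>0 by auto
  obtain x where x: "0 < x" "x \<le> min r \<epsilon> / 2"
    "\<And>y. 0 < y \<Longrightarrow> y \<le> min r \<epsilon> / 2 \<Longrightarrow> G y / y ^ N \<le> G x / x ^ N"
    by (rule weighted_max[of "min r \<epsilon> / 2" N]) (use r eps_pos in auto)
  define y where "y = cmod (V 0 (of_real x))"
  have xr: "x < r" "x < \<epsilon>" using x r eps_pos by auto
  have Gy: "c * G x \<le> G y" and vx: "cmod (v (of_real x)) < \<rho>" "0 < cmod (v (of_real x))"
    using r(2)[rule_format, of "of_real x"] x xr unfolding y_def by auto
  have y: "0 < y" "y \<le> \<rho> * x"
    unfolding y_def v(3) norm_mult using vx x by (auto simp: mult.commute)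
  have yx: "y \<le> x" using y \<rho>(2) x(1) by (smt (verit) mult_less_cancel_right2)
  have Gx: "G x > 0" using G_pos x xr by auto
  have "1 < c * (1 / \<rho>) ^ N" using N c(1) by (simp only: pos_divide_less_eq mult.commute)
  then have "1 * (G x / x ^ N) < (c * (1 / \<rho>) ^ N) * (G x / x ^ N)"
    using Gx x(1) by (intro mult_strict_right_mono) auto
  also have "\<dots> = (c * G x) / (\<rho> * x) ^ N"
    by (simp add: power_mult_distrib power_divide)
  also have "\<dots> \<le> G y / (\<rho> * x) ^ N"
    using Gy \<rho>0 x by (intro divide_right_mono) auto
  also have "\<dots> \<le> G y / y ^ N"
  proof (rule divide_left_mono)
    show "y ^ N \<le> (\<rho> * x) ^ N" using y by (intro power_mono) auto
    show "0 \<le> G y" using order_trans[OF _ Gy] c(1) Gx by simp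
    show "0 < (\<rho> * x) ^ N * y ^ N" using \<rho>0 x(1) y(1) by simp
  qed
  also have "\<dots> \<le> G x / x ^ N" by (rule x(3)) (use y yx x in auto)
  finally show False by simp
qed

text \<open>As for contractions, but the maximum is compared with its preimage, which the intermediate value
  theorem finds on the positive ray.\<close>

lemma not_expanding: "\<not> 1 < cmod b"
proof
  assume "1 < cmod b"
  then obtain \<rho> where \<rho>: "1 < \<rho>" "\<rho> < cmod b" using dense by blast
  obtain c C where c: "0 < c" "0 < C"
    "\<forall>\<^sub>F z in at 0. c * g z \<le> G (cmod (V 0 z)) \<and> G (cmod (V 0 z)) \<le> C * g z"
    by (rule ratio_bounds)
  have "((\<lambda>z. cmod (v z)) \<longlongrightarrow> cmod b) (at 0)"
    using tendsto_norm[OF holomorphic_isCont_0[OF v(1) V.R_pos]] by (simp add: v(2))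
  then have "\<forall>\<^sub>F z in at 0. \<rho> < cmod (v z)"
    using \<rho> by (auto dest: order_tendstoD)
  with c(3) have "\<forall>\<^sub>F z in at 0. G (cmod (V 0 z)) \<le> C * g z \<and> \<rho> < cmod (v z)"
    by eventually_elim auto
  then obtain r where r: "r > 0"
    "\<forall>z. z \<noteq> 0 \<and> cmod z < r \<longrightarrow> G (cmod (V 0 z)) \<le> C * g z \<and> \<rho> < cmod (v z)"
    by (rule eventually_radius)
  \<comment> \<open>with this \<open>N\<close> the expansion decreases \<open>G x / x ^ N\<close>\<close>
  obtain N where N: "C < \<rho> ^ N" using real_arch_pow[OF \<rho>(1)] by blast
  define m where "m = Min {r, \<epsilon>, R}"
  define s where "s = m / 2"
  have "0 < m" unfolding m_def using r(1) eps_pos V.R_pos by simp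
  moreover have "m \<le> r" "m \<le> \<epsilon>" "m \<le> R" unfolding m_def by (rule Min_le; simp)+
  ultimately have s: "0 < s" "s < r" "s < \<epsilon>" "s < R" unfolding s_def by linarith+
  obtain x where x: "0 < x" "x \<le> s" "\<And>y. 0 < y \<Longrightarrow> y \<le> s \<Longrightarrow> G y / y ^ N \<le> G x / x ^ N"
    by (rule weighted_max[of s N]) (use s in auto)
  define T where "T y = cmod (V 0 (of_real y))" for y
  have T: "T y \<ge> \<rho> * y" "G (T y) \<le> C * G y" if "0 < y" "y \<le> s" for y
  proof -
    have "y < r" using that s by simp
    then have "G (T y) \<le> C * G y \<and> \<rho> < cmod (v (of_real y))"
      using r(2)[rule_format, of "of_real y"] that unfolding T_def by auto
    then show "T y \<ge> \<rho> * y" "G (T y) \<le> C * G y"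
      unfolding T_def v(3) norm_mult using that by (auto simp: mult.commute)
  qed
  have "\<exists>y\<ge>0. y \<le> x \<and> T y = x"
  proof (rule IVT')
    show "T 0 \<le> x" using x V00 by (simp add: T_def)
    have "1 * x \<le> \<rho> * x" using \<rho>(1) x(1) by (intro mult_right_mono) auto
    then show "x \<le> T x" using T(1)[OF x(1,2)] by linarith
    show "continuous_on {0..x} T"
      unfolding T_def using V0_continuous_ray[of x] x s by simp
  qed (use x in auto)
  then obtain y where y: "0 \<le> y" "y \<le> x" "T y = x" by blast
  have y0: "0 < y" using y x V00 by (cases "y = 0") (auto simp: T_def)
  have ys: "y \<le> s" using y x by simp
  have yx: "\<rho> * y \<le> x" and Gxy: "G x \<le> C * G y" using T[OF y0 ys] y(3) by auto
  have Gy: "G y > 0" by (rule G_pos) (use y0 ys s in auto)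
  have Gx: "G x > 0" by (rule G_pos) (use x s in auto)
  have "G x / x ^ N \<le> G x / (\<rho> * y) ^ N"
    using yx \<rho>(1) y0 x(1) Gx by (intro divide_left_mono power_mono) auto
  also have "\<dots> \<le> C * G y / (\<rho> * y) ^ N"
    using Gxy \<rho>(1) y0 by (intro divide_right_mono) auto
  also have "\<dots> < G y / y ^ N"
    using N Gy y0 \<rho>(1) by (simp add: field_simps)
  also have "\<dots> \<le> G x / x ^ N" by (rule x(3)[OF y0 ys])
  finally show False by simp
qed

lemma cmod_b: "cmod b = 1"
  using not_contracting not_expanding by linarith

lemma cmod_V0: "cmod (V 0 z) = cmod z * cmod (cnj b * v z)"
  by (simp add: v(3) norm_mult cmod_b)

text \<open>Since \<open>v\<close> takes a unimodular value at \<open>0\<close> and is not constant, each small circle has a direction in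
  which its modulus exceeds \<open>1\<close> and one in which it drops below \<open>1\<close> by a power of the radius.\<close>

lemma v_directions:
  assumes "x0 \<in> ball 0 R" "v x0 \<noteq> b"
  obtains k c r where "0 < k" "0 < c" "0 < r"
    "\<forall>x. 0 < x \<and> x < r \<longrightarrow> (\<exists>z. cmod z = x \<and> 1 < cmod (cnj b * v z))"
    "\<forall>x. 0 < x \<and> x < r \<longrightarrow> (\<exists>z. cmod z = x \<and> cmod (cnj b * v z) \<le> 1 - c * x ^ k)"
proof -
  define h where "h z = cnj b * v z - 1" for z
  have bb: "cnj b * b = 1" using cmod_b by (simp add: complex_norm_square[symmetric] mult.commute)
  have h: "h holomorphic_on ball 0 R" "h 0 = 0"
    unfolding h_def by (auto intro!: holomorphic_intros v(1) simp: v(2) bb)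
  have hx: "h x0 \<noteq> 0"
  proof
    assume "h x0 = 0"
    then have "b * (cnj b * v x0) = b * 1" unfolding h_def by simp
    then show False using assms(2) bb by (metis mult.assoc mult.commute mult.right_neutral mult_1)
  qed
  obtain k c C r where kc: "0 < k" "0 < c" "0 < r" "r \<le> R"
    "\<forall>z. cmod z < r \<longrightarrow> cmod (h z) \<le> C * cmod z ^ k"
    "\<forall>x \<kappa>. 0 < x \<and> x < r \<longrightarrow> (\<exists>z. cmod z = x \<and> c * cmod \<kappa> * x ^ k \<le> Re (\<kappa> * h z))"
    by (rule holomorphic_direction[OF h(1) V.R_pos h(2) assms(1) hx])
  define s where "s = Min {r, 1, c / (C\<^sup>2 + 1)}"
  have s: "0 < s" "s \<le> r" "s \<le> 1" "s \<le> c / (C\<^sup>2 + 1)"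
    unfolding s_def using kc by (auto simp: add_nonneg_pos)
  show ?thesis
  proof (rule that[of k "c / 2" s]; (intro allI impI)?)
    fix x assume x: "0 < x \<and> x < s"
    then obtain z where z: "cmod z = x" "c * cmod 1 * x ^ k \<le> Re (1 * h z)"
      using kc(6)[rule_format, of x 1] s by auto
    have "0 < c * x ^ k" using x kc by simp
    then have "1 < Re (1 + h z)" using z by simp
    also have "\<dots> \<le> cmod (1 + h z)" by (rule complex_Re_le_cmod)
    finally show "\<exists>z. cmod z = x \<and> 1 < cmod (cnj b * v z)" using z(1) by (auto simp: h_def)
  next
    fix x assume x: "0 < x \<and> x < s"
    then obtain z where z: "cmod z = x" "c * cmod (-1) * x ^ k \<le> Re (-1 * h z)"
      using kc(6)[rule_format, of x "-1"] s by auto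
    have xk: "x ^ k \<le> x" using x s kc(1) power_decreasing[of 1 k x] by simp
    have "C\<^sup>2 * x ^ k \<le> C\<^sup>2 * x" using xk by (intro mult_left_mono) auto
    also have "\<dots> \<le> (C\<^sup>2 + 1) * x" using x by (intro mult_right_mono) auto
    also have "\<dots> \<le> (C\<^sup>2 + 1) * (c / (C\<^sup>2 + 1))" using x s by (intro mult_left_mono) auto
    also have "\<dots> = c" using zero_le_power2[of C] by (simp add: field_simps add_nonneg_eq_0_iff)
    finally have Cc: "C\<^sup>2 * x ^ k \<le> c" .
    have "cmod (h z) \<le> C * x ^ k" using kc(5)[rule_format, of z] z(1) x s by auto
    then have "(cmod (h z))\<^sup>2 \<le> (C * x ^ k)\<^sup>2" by (intro power_mono) auto
    also have "\<dots> = (C\<^sup>2 * x ^ k) * x ^ k" by (simp add: power2_eq_square)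
    also have "\<dots> \<le> c * x ^ k" using Cc x by (intro mult_right_mono) auto
    finally have h2: "(cmod (h z))\<^sup>2 \<le> c * x ^ k" .
    have "(cmod (1 + h z))\<^sup>2 = 1 + 2 * Re (h z) + (cmod (h z))\<^sup>2"
      unfolding cmod_power2 by (simp add: power2_eq_square algebra_simps)
    also have "\<dots> \<le> 1 - c * x ^ k" using z(2) h2 by simp
    finally have sq: "(cmod (1 + h z))\<^sup>2 \<le> 1 - c * x ^ k" .
    also have "\<dots> \<le> (1 - c / 2 * x ^ k)\<^sup>2"
    proof -
      define t where "t = c / 2 * x ^ k"
      have "c * x ^ k = 2 * t" by (simp add: t_def)
      moreover have "(1 - t)\<^sup>2 = 1 - 2 * t + t\<^sup>2" by (simp add: power2_eq_square algebra_simps)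
      ultimately show ?thesis unfolding t_def[symmetric] by simp
    qed
    finally have *: "(cmod (1 + h z))\<^sup>2 \<le> (1 - c / 2 * x ^ k)\<^sup>2" .
    have "0 \<le> 1 - c * x ^ k" using sq zero_le_power2 order_trans by blast
    then have "cmod (1 + h z) \<le> 1 - c / 2 * x ^ k"
      using * kc(2) x by (intro power2_le_imp_le[OF *]) (simp add: field_simps)
    then show "\<exists>z. cmod z = x \<and> cmod (cnj b * v z) \<le> 1 - c / 2 * x ^ k"
      using z(1) by (auto simp: h_def)
  qed (use kc s in auto)
qed

text \<open>The circle is connected and, unless \<open>v\<close> is constant, the modulus of \<open>V 0\<close> takes values on both sides of the radius on it.\<close>

lemma unimodular_point_on_circles:
  obtains r where "0 < r" "\<forall>x. 0 < x \<and> x < r \<longrightarrow> (\<exists>z. cmod z = x \<and> cmod (V 0 z) = x)"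
proof (cases "\<exists>x0\<in>ball 0 R. v x0 \<noteq> b")
  case False
  have "\<exists>z. cmod z = x \<and> cmod (V 0 z) = x" if "0 < x \<and> x < R" for x
    using False that cmod_b by (intro exI[of _ "of_real x"]) (auto simp: v(3) norm_mult)
  then show ?thesis using that[of R] V.R_pos by blast
next
  case True
  then obtain x0 where x0: "x0 \<in> ball 0 R" "v x0 \<noteq> b" by blast
  obtain k c r where r: "0 < k" "0 < c" "0 < r"
    "\<forall>x. 0 < x \<and> x < r \<longrightarrow> (\<exists>z. cmod z = x \<and> 1 < cmod (cnj b * v z))"
    "\<forall>x. 0 < x \<and> x < r \<longrightarrow> (\<exists>z. cmod z = x \<and> cmod (cnj b * v z) \<le> 1 - c * x ^ k)"
    by (rule v_directions[OF x0])
  have "\<exists>z. cmod z = x \<and> cmod (V 0 z) = x" if x: "0 < x \<and> x < min r R" for x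
  proof -
    define S where "S = (\<lambda>z. cmod (V 0 z)) ` sphere 0 x"
    have "connected (sphere (0::complex) x)" by (rule connected_sphere) simp
    moreover have "continuous_on (sphere 0 x) (\<lambda>z. cmod (V 0 z))"
      by (intro continuous_intros continuous_on_subset[OF holomorphic_on_imp_continuous_on[OF V.holo2]])
         (use V.R_pos x in auto)
    ultimately have conn: "connected S" unfolding S_def by (intro connected_continuous_image)
    obtain z1 where z1: "cmod z1 = x" "1 < cmod (cnj b * v z1)" using r(4) x by auto
    obtain z2 where z2: "cmod z2 = x" "cmod (cnj b * v z2) \<le> 1 - c * x ^ k" using r(5) x by auto
    have "x \<le> cmod (V 0 z1)" unfolding cmod_V0 z1(1) using z1(2) x by simp
    moreover have "0 < c * x ^ k" using r x by simp
    then have "cmod (V 0 z2) \<le> x" unfolding cmod_V0 z2(1) using z2(2) x by (intro mult_left_le) auto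
    ultimately have "x \<in> S"
      using connected_contains_Icc[OF conn, of "cmod (V 0 z2)" "cmod (V 0 z1)"] z1(1) z2(1)
      unfolding S_def by auto
    then show ?thesis unfolding S_def by auto
  qed
  then show ?thesis using that[of "min r R"] r(3) V.R_pos by auto
qed

text \<open>At a point with \<open>|V 0 z| = |z|\<close> the phase of \<open>w\<close> is that of \<open>u\<close> and the ratio is \<open>1\<close>, so \<open>u - 1\<close> is as
  small there as any power of \<open>|z|\<close>.\<close>

lemma u_eq_1:
  assumes "z \<in> ball 0 R"
  shows "u z = 1"
proof -
  have "u z - 1 = 0"
  proof (rule holomorphic_eq_0_if_flat_on_circles[of "\<lambda>z. u z - 1" R, OF _ U.R_pos _ assms])
    show "(\<lambda>z. u z - 1) holomorphic_on ball 0 R"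
      by (intro holomorphic_intros u_holomorphic)
    fix N
    obtain r where r: "0 < r" "\<forall>x. 0 < x \<and> x < r \<longrightarrow> (\<exists>z. cmod z = x \<and> cmod (V 0 z) = x)"
      by (rule unimodular_point_on_circles)
    have "dominated (\<lambda>z. Re (w z) - ratio z) (\<lambda>z. cmod z ^ N)"
      using flat_wrtD[OF flat_Re_w] by simp
    then obtain C1 r1 where 1: "C1 > 0" "r1 > 0"
      "\<forall>z. z \<noteq> 0 \<and> cmod z < r1 \<longrightarrow> norm (Re (w z) - ratio z) \<le> C1 * \<bar>cmod z ^ N\<bar>"
      by (rule dominated_radius)
    have "dominated (\<lambda>z. Im (w z)) (\<lambda>z. cmod z ^ N)"
      using flat_wrtD[OF flat_Im_w] by simp
    then obtain C2 r2 where 2: "C2 > 0" "r2 > 0"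
      "\<forall>z. z \<noteq> 0 \<and> cmod z < r2 \<longrightarrow> norm (Im (w z)) \<le> C2 * \<bar>cmod z ^ N\<bar>"
      by (rule dominated_radius)
    show "\<exists>C r. 0 < r \<and> (\<forall>x. 0 < x \<and> x < r \<longrightarrow> (\<exists>z. cmod z = x \<and> cmod (u z - 1) \<le> C * x ^ N))"
    proof (rule exI[of _ "C1 + C2"], rule exI[of _ "Min {r, r1, r2, \<epsilon>}"], intro conjI allI impI)
      fix x assume x: "0 < x \<and> x < Min {r, r1, r2, \<epsilon>}"
      then obtain z where z: "cmod z = x" "cmod (V 0 z) = x" using r(2) by auto
      have "w z = u z" by (simp add: w_def z)
      moreover have "ratio z = 1" using G_pos[of x] x by (simp add: ratio_def z)
      moreover have "z \<noteq> 0" "cmod z < r1" "cmod z < r2" using z x by auto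
      ultimately have "\<bar>Re (u z) - 1\<bar> \<le> C1 * x ^ N" "\<bar>Im (u z)\<bar> \<le> C2 * x ^ N"
        using 1(3) 2(3) z x by fastforce+
      then have "cmod (u z - 1) \<le> (C1 + C2) * x ^ N"
        using cmod_le[of "u z - 1"] by (simp add: distrib_right)
      then show "\<exists>z. cmod z = x \<and> cmod (u z - 1) \<le> (C1 + C2) * x ^ N" using z(1) by blast
    qed (use r(1) 1(2) 2(2) eps_pos in auto)
  qed
  then show ?thesis by simp
qed

text \<open>Now \<open>|w| = 1\<close> and \<open>Im w\<close> is flat, so \<open>Re w\<close> is flatly close to \<open>1\<close> or \<open>- 1\<close>, and its sign is that of the
  ratio.\<close>

lemma flat_ratio: "flat (\<lambda>z. ratio z - 1)"
proof -
  have u0: "cmod (u 0) = 1" using u_eq_1[of 0] U.R_pos by simp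
  have "((\<lambda>z. (Re (w z) - ratio z) + ratio z) \<longlongrightarrow> 0 + cmod (u 0)) (at 0)"
    by (intro tendsto_add ratio_tendsto flat_tendsto_0 flat_Re_w)
  then have "((\<lambda>z. Re (w z)) \<longlongrightarrow> 1) (at 0)" using u0 by simp
  then have ev: "\<forall>\<^sub>F z in at 0. 0 < Re (w z)" by (rule order_tendstoD) simp
  have "flat (\<lambda>z. Re (w z) - 1)"
  proof (rule flat_wrt_cong[OF flat_Im_w], use ev eventually_at0_norm_less[OF U.R_pos] in eventually_elim)
    case (elim z)
    have "cmod (w z) = 1" using u_eq_1[of z] elim unfolding cmod_w by simp
    then have sq: "(Re (w z))\<^sup>2 + (Im (w z))\<^sup>2 = 1" using cmod_power2[of "w z"] by simp
    then have "(1 - Re (w z)) * (1 + Re (w z)) = (Im (w z))\<^sup>2" by (simp add: power2_eq_square algebra_simps)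
    moreover have "Re (w z) \<le> 1" using complex_Re_le_cmod[of "w z"] \<open>cmod (w z) = 1\<close> by simp
    then have "(1 - Re (w z)) * 1 \<le> (1 - Re (w z)) * (1 + Re (w z))"
      using elim(1) by (intro mult_left_mono) auto
    moreover have "(Im (w z))\<^sup>2 \<le> \<bar>Im (w z)\<bar>"
    proof -
      have "\<bar>Im (w z)\<bar> \<le> 1" using abs_Im_le_cmod[of "w z"] \<open>cmod (w z) = 1\<close> by simp
      then have "\<bar>Im (w z)\<bar> * \<bar>Im (w z)\<bar> \<le> 1 * \<bar>Im (w z)\<bar>" by (intro mult_right_mono) auto
      then show ?thesis by (simp add: power2_eq_square)
    qed
    ultimately show ?case using \<open>Re (w z) \<le> 1\<close> by simp
  qed
  from flat_wrt_diff[OF this flat_Re_w] show ?thesis by simp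
qed

text \<open>Otherwise \<open>V 0\<close> moves some point of each circle inwards by at least \<open>c * x ^ Suc k\<close> while it changes \<open>G\<close>
  by a factor \<open>1 + flat\<close>. At a maximum of \<open>G x * exp (- x)\<close> the gain in \<open>exp (- x)\<close> outweighs the change
  of \<open>G\<close>.\<close>

lemma V0_linear:
  assumes "z \<in> ball 0 R"
  shows "V 0 z = b * z"
proof (rule ccontr)
  assume "V 0 z \<noteq> b * z"
  then have "v z \<noteq> b" by (auto simp: v(3))
  then obtain k c r where r: "0 < k" "0 < c" "0 < r"
    "\<forall>x. 0 < x \<and> x < r \<longrightarrow> (\<exists>z. cmod z = x \<and> 1 < cmod (cnj b * v z))"
    "\<forall>x. 0 < x \<and> x < r \<longrightarrow> (\<exists>z. cmod z = x \<and> cmod (cnj b * v z) \<le> 1 - c * x ^ k)"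
    by (rule v_directions[OF assms])
  have "dominated (\<lambda>z. ratio z - 1) (\<lambda>z. cmod z ^ (k + 2))"
    using flat_wrtD[OF flat_ratio, of "k + 2"] by (simp only: mult_1)
  then obtain C r1 where 1: "C > 0" "r1 > 0"
    "\<forall>z. z \<noteq> 0 \<and> cmod z < r1 \<longrightarrow> norm (ratio z - 1) \<le> C * \<bar>cmod z ^ (k + 2)\<bar>"
    by (rule dominated_radius)
  have lim: "((\<lambda>z. cmod (v z)) \<longlongrightarrow> cmod b) (at 0)"
    using tendsto_norm[OF holomorphic_isCont_0[OF v(1) V.R_pos]] by (simp add: v(2))
  have "\<forall>\<^sub>F z in at 0. 0 < cmod (v z)"
    by (rule order_tendstoD(1)[OF lim]) (use b_nonzero in simp)
  then obtain r2 where 2: "r2 > 0" "\<forall>z. z \<noteq> 0 \<and> cmod z < r2 \<longrightarrow> 0 < cmod (v z)"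
    by (rule eventually_radius)
  define m where "m = Min {r, r1, r2, \<epsilon>, 1, c / (C * (1 + c))}"
  define s where "s = m / 2"
  have "0 < c / (C * (1 + c))" using 1(1) r(2) by simp
  then have "0 < m" unfolding m_def using r(3) 1(2) 2(1) eps_pos by simp
  moreover have "m \<le> r" "m \<le> r1" "m \<le> r2" "m \<le> \<epsilon>" "m \<le> 1" "m \<le> c / (C * (1 + c))"
    unfolding m_def by (rule Min_le; simp)+
  ultimately have s: "0 < s" "s < r" "s < r1" "s < r2" "s < \<epsilon>" "s < 1" "s < c / (C * (1 + c))"
    unfolding s_def by linarith+
  obtain x where x: "0 < x" "x \<le> s" "\<And>y. 0 < y \<Longrightarrow> y \<le> s \<Longrightarrow> G y * exp (- y) \<le> G x * exp (- x)"
    by (rule exp_weighted_max[of s]) (use s in auto)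
  obtain z' where z': "cmod z' = x" "cmod (cnj b * v z') \<le> 1 - c * x ^ k" using r(5) x s by auto
  have z'0: "z' \<noteq> 0" using z' x by auto
  define y where "y = cmod (V 0 z')"
  define d where "d = c * x ^ Suc k"
  have "x ^ Suc k \<le> 1" by (rule power_le_one) (use x s in auto)
  then have d: "0 < d" "d \<le> c"
    unfolding d_def using r(2) x(1) by (auto intro!: mult_left_le simp del: power_Suc)
  have yx: "y \<le> x - d"
  proof -
    have "y \<le> x * (1 - c * x ^ k)" unfolding y_def cmod_V0 z'(1) using z'(2) x by (intro mult_left_mono) auto
    then show ?thesis by (simp add: d_def algebra_simps)
  qed
  have y0: "0 < y" unfolding y_def v(3) norm_mult using z'0 2(2) z' x s by auto
  have Gx: "0 < G x" using G_pos x s by auto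
  have "norm (ratio z' - 1) \<le> C * \<bar>cmod z' ^ (k + 2)\<bar>" using 1(3) z'0 z' x s by auto
  then have rat: "ratio z' \<ge> 1 - C * x ^ (k + 2)" using x by (simp add: z' abs_le_iff)
  have "G y = ratio z' * G x" using Gx by (simp add: ratio_def y_def z')
  then have Gy: "G y \<ge> (1 - C * x ^ (k + 2)) * G x" using rat Gx by simp
  have small: "C * x ^ (k + 2) * (1 + d) < d"
  proof -
    have "x * (C * (1 + c)) \<le> s * (C * (1 + c))" using x(2) 1(1) r(2) by (intro mult_right_mono) auto
    also have "\<dots> < c" using s(7) 1(1) r(2) by (simp add: pos_less_divide_eq)
    finally have "x * (C * (1 + c)) < c" .
    then have "x ^ Suc k * (x * (C * (1 + c))) < x ^ Suc k * c" using x(1) by simp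
    then have "C * x ^ (k + 2) * (1 + c) < d" by (simp add: d_def mult_ac)
    moreover have "C * x ^ (k + 2) * (1 + d) \<le> C * x ^ (k + 2) * (1 + c)"
      using d 1(1) x(1) by (intro mult_left_mono) auto
    ultimately show ?thesis by simp
  qed
  have d1: "C * x ^ (k + 2) < 1"
  proof -
    have "C * x ^ (k + 2) * (1 + d) < 1 + d" using small d by linarith
    then show ?thesis using d by simp
  qed
  have "1 < (1 - C * x ^ (k + 2)) * (1 + d)" using small by (simp add: algebra_simps)
  also have "\<dots> \<le> (1 - C * x ^ (k + 2)) * exp d"
    using d1 exp_ge_add_one_self[of d] by (intro mult_left_mono) auto
  finally have "G x * exp (- x) * 1 < G x * exp (- x) * ((1 - C * x ^ (k + 2)) * exp d)"
    using Gx by (intro mult_strict_left_mono) auto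
  also have "\<dots> = ((1 - C * x ^ (k + 2)) * G x) * exp (- (x - d))"
    by (simp add: exp_diff exp_minus divide_inverse mult_ac)
  also have "\<dots> \<le> G y * exp (- y)"
    using Gy yx G_pos[of y] y0 yx d x s by (intro mult_mono) auto
  also have "\<dots> \<le> G x * exp (- x)" by (rule x(3)) (use y0 yx d x in auto)
  finally show False by simp
qed

end

section \<open>The higher-order terms\<close>

lemma cmod_cis_second_order: "cmod (cis t - 1 - \<i> * of_real t) \<le> 2 * t\<^sup>2"
proof -
  have c: "\<bar>1 - cos s\<bar> \<le> s\<^sup>2 / 2" for s :: real
  proof -
    have "1 - cos s = 1 - cos (2 * (s / 2))" by simp
    also have "\<dots> = 2 * (sin (s / 2))\<^sup>2" unfolding cos_double_sin by simp
    finally have "1 - cos s = 2 * (sin (s / 2))\<^sup>2" .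
    moreover have "(sin (s / 2))\<^sup>2 \<le> (s / 2)\<^sup>2"
      using abs_sin_x_le_abs_x[of "s / 2"] by (rule abs_le_square_iff[THEN iffD1])
    moreover have "(s / 2)\<^sup>2 = s\<^sup>2 / 4" by (simp add: power_divide)
    ultimately show ?thesis using zero_le_power2[of "sin (s / 2)"] by linarith
  qed
  have s: "\<bar>sin t - t\<bar> \<le> t\<^sup>2"
  proof -
    have d: "norm (1 - cos s) \<le> \<bar>t\<bar>" if "s \<in> closed_segment 0 t" for s
    proof -
      have "\<bar>s\<bar> \<le> \<bar>t\<bar>" using that by (auto simp: closed_segment_eq_real_ivl split: if_splits)
      moreover have "\<bar>1 - cos s\<bar> \<le> \<bar>s\<bar>"
      proof (cases "\<bar>s\<bar> \<le> 2")
        case True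
        have "\<bar>s\<bar> * \<bar>s\<bar> \<le> 2 * \<bar>s\<bar>" using True by (intro mult_right_mono) auto
        then show ?thesis using c[of s] by (simp add: power2_eq_square)
      next
        case False
        then show ?thesis using cos_le_one[of s] cos_ge_minus_one[of s] by linarith
      qed
      ultimately show ?thesis by simp
    qed
    have "norm ((t - sin t) - (0 - sin 0)) \<le> \<bar>t\<bar> * norm (t - 0)"
      by (rule field_differentiable_bound[of "closed_segment 0 t" "\<lambda>s. s - sin s" "\<lambda>s. 1 - cos s"])
         (use d in \<open>auto intro!: derivative_eq_intros\<close>)
    then show ?thesis by (simp add: power2_eq_square abs_minus_commute flip: abs_mult)
  qed
  have "cmod (cis t - 1 - \<i> * of_real t) \<le> \<bar>cos t - 1\<bar> + \<bar>sin t - t\<bar>"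
    using cmod_le[of "cis t - 1 - \<i> * of_real t"] by simp
  also have "\<dots> \<le> t\<^sup>2 / 2 + t\<^sup>2" using c[of t] s by (simp add: abs_minus_commute)
  also have "\<dots> \<le> 2 * t\<^sup>2" using zero_le_power2[of t] by linarith
  finally show ?thesis .
qed

text \<open>First-order expansion of the distance to the origin, with an error that is quadratic in the
  displacement.\<close>

lemma cmod_add_expansion:
  assumes z: "z \<noteq> 0" and d: "cmod d \<le> cmod z / 2"
  shows "\<bar>cmod (z + d) - cmod z - Re (cnj z * d) / cmod z\<bar> \<le> (cmod d)\<^sup>2 / cmod z"
proof -
  define a s where "a = cmod z" and "s = Re (cnj z * d) / cmod z"
  have a: "0 < a" using z by (simp add: a_def)
  have "\<bar>Re (cnj z * d)\<bar> \<le> a * cmod d"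
    using abs_Re_le_cmod[of "cnj z * d"] by (simp add: norm_mult a_def)
  then have sd: "\<bar>s\<bar> \<le> cmod d" using a by (simp add: s_def a_def[symmetric] field_simps)
  have as: "a / 2 \<le> a + s" using sd d unfolding a_def[symmetric] by linarith
  have s2: "s\<^sup>2 \<le> (cmod d)\<^sup>2" using sd abs_le_square_iff[of s "cmod d"] by simp
  have "(cmod (z + d))\<^sup>2 = a\<^sup>2 + 2 * Re (cnj z * d) + (cmod d)\<^sup>2"
    unfolding a_def cmod_power2 by (simp add: power2_eq_square algebra_simps)
  also have "Re (cnj z * d) = a * s" using a by (simp add: s_def a_def)
  finally have eq: "(cmod (z + d))\<^sup>2 = (a + s)\<^sup>2 + ((cmod d)\<^sup>2 - s\<^sup>2)"
    by (simp add: power2_eq_square algebra_simps)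
  have lower: "a + s \<le> cmod (z + d)"
    by (rule power2_le_imp_le) (use eq s2 in auto)
  define e where "e = (cmod d)\<^sup>2 / a"
  have e0: "0 \<le> e" using a by (simp add: e_def)
  have "(cmod d)\<^sup>2 = a * e" using a by (simp add: e_def)
  also have "\<dots> \<le> (2 * (a + s)) * e" using as e0 by (intro mult_right_mono) auto
  finally have "(cmod d)\<^sup>2 \<le> 2 * (a + s) * e" .
  moreover have "(a + s + e)\<^sup>2 = (a + s)\<^sup>2 + 2 * (a + s) * e + e\<^sup>2"
    by (simp add: power2_eq_square algebra_simps)
  ultimately have "(cmod (z + d))\<^sup>2 \<le> (a + s + e)\<^sup>2"
    using eq zero_le_power2[of s] zero_le_power2[of e] by linarith
  then have "cmod (z + d) \<le> a + s + e"
    by (rule power2_le_imp_le) (use as a e0 in linarith)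
  with lower e0 show ?thesis unfolding s_def e_def a_def by linarith
qed

text \<open>The points \<open>\<omega>\<close> with real part \<open>1\<close> are the \<open>cis \<phi> / cos \<phi>\<close>. On them the expression of order \<open>n + 1\<close> in the
  invariance equation is, up to a power of \<open>cos \<phi>\<close>, a trigonometric polynomial in \<open>\<phi>\<close> with only two
  frequencies.\<close>

lemma amplitude_identity:
  fixes A B :: complex and p q \<phi> :: real
  assumes "cos \<phi> \<noteq> 0" "n \<ge> 1"
  defines "\<omega> \<equiv> cis \<phi> / of_real (cos \<phi>)"
  shows "cos \<phi> ^ Suc n * (Re (\<omega> ^ Suc n * A) + (Im \<omega> * q - p) * Re (\<omega> ^ n * B))
    = Re (cis (Suc n * \<phi>) * (A - Complex p q * B / 2)) - Re (cis (real (n - 1) * \<phi>) * (Complex p (- q) * B / 2))"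
proof -
  let ?c = "cos \<phi>"
  have pw: "of_real (?c ^ m) * \<omega> ^ m = cis (m * \<phi>)" for m
    unfolding \<omega>_def power_divide using assms(1) by (simp add: Complex.DeMoivre)
  have Im\<omega>: "?c * Im \<omega> = sin \<phi>" using assms(1) by (simp add: \<omega>_def Im_divide_of_real)
  have 1: "?c ^ Suc n * Re (\<omega> ^ Suc n * A) = Re (cis (Suc n * \<phi>) * A)"
  proof -
    have "?c ^ Suc n * Re (\<omega> ^ Suc n * A) = Re (of_real (?c ^ Suc n) * \<omega> ^ Suc n * A)"
      by (simp only: mult.assoc Re_of_real_mult)
    then show ?thesis unfolding pw .
  qed
  have 2: "?c ^ n * Re (\<omega> ^ n * B) = Re (cis (n * \<phi>) * B)"
  proof -
    have "?c ^ n * Re (\<omega> ^ n * B) = Re (of_real (?c ^ n) * \<omega> ^ n * B)"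
      by (simp only: mult.assoc Re_of_real_mult)
    then show ?thesis unfolding pw .
  qed
  have plus: "cis (Suc n * \<phi>) = cis (n * \<phi>) * cis \<phi>" by (simp add: cis_mult algebra_simps)
  have minus: "cis (real (n - 1) * \<phi>) = cis (n * \<phi>) * cis (- \<phi>)"
    using assms(2) by (simp add: cis_mult algebra_simps of_nat_diff)
  have "cis \<phi> * Complex p q + cis (- \<phi>) * Complex p (- q) = of_real (2 * (p * ?c - q * sin \<phi>))"
    by (simp add: complex_eq_iff)
  then have "cis (n * \<phi>) * B * (cis \<phi> * Complex p q + cis (- \<phi>) * Complex p (- q))
      = of_real (2 * (p * ?c - q * sin \<phi>)) * (cis (n * \<phi>) * B)" by simp
  then have "cis (Suc n * \<phi>) * (Complex p q * B / 2) + cis (real (n - 1) * \<phi>) * (Complex p (- q) * B / 2)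
      = of_real (p * ?c - q * sin \<phi>) * (cis (n * \<phi>) * B)"
    unfolding plus minus by (simp add: field_simps)
  then have sum: "Re (cis (Suc n * \<phi>) * (Complex p q * B / 2)) + Re (cis (real (n - 1) * \<phi>) * (Complex p (- q) * B / 2))
      = (p * ?c - q * sin \<phi>) * Re (cis (n * \<phi>) * B)"
    by (metis Re_complex_of_real plus_complex.sel(1) mult_zero_left diff_zero times_complex.sel(1) Im_complex_of_real)
  have diff: "Re (cis (Suc n * \<phi>) * (A - Complex p q * B / 2))
      = Re (cis (Suc n * \<phi>) * A) - Re (cis (Suc n * \<phi>) * (Complex p q * B / 2))"
    by (simp only: right_diff_distrib minus_complex.sel)
  have neg: "(sin \<phi> * q - p * ?c) * t = - ((p * ?c - q * sin \<phi>) * t)" for t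
    by (simp add: algebra_simps)
  have "?c ^ Suc n * ((Im \<omega> * q - p) * Re (\<omega> ^ n * B)) = (?c * Im \<omega> * q - p * ?c) * (?c ^ n * Re (\<omega> ^ n * B))"
    by (simp only: power_Suc left_diff_distrib right_diff_distrib mult_ac)
  then have "?c ^ Suc n * ((Im \<omega> * q - p) * Re (\<omega> ^ n * B))
      = - ((p * ?c - q * sin \<phi>) * Re (cis (n * \<phi>) * B))"
    unfolding 2 Im\<omega> by (simp only: neg)
  then have "?c ^ Suc n * (Re (\<omega> ^ Suc n * A) + (Im \<omega> * q - p) * Re (\<omega> ^ n * B))
      = Re (cis (Suc n * \<phi>) * A) + - ((p * ?c - q * sin \<phi>) * Re (cis (n * \<phi>) * B))"
    unfolding distrib_left[of "?c ^ Suc n"] 1 by (rule arg_cong)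
  then show ?thesis unfolding sum[symmetric] diff by (simp only: minus_add_distrib diff_conv_add_uminus add.assoc)
qed

text \<open>With \<open>X\<close> and \<open>Y\<close> the amplitudes of the frequencies \<open>n + 1\<close> and \<open>n - 1\<close>, the angles \<open>0\<close> and \<open>\<plusminus> pi / (2 * (n + 1))\<close> suffice: at the last two
  the frequency \<open>n + 1\<close> contributes \<open>\<mp> Im X\<close>, so the sum isolates \<open>Re Y\<close> and the difference bounds \<open>Im X\<close>
  by \<open>s = sin \<psi> < 1\<close> times \<open>Im Y\<close>, up to flat errors. For \<open>n = 1\<close> the second frequency is zero and \<open>Im Y\<close> is not determined,
  which is why the conclusion bounds \<open>Im X\<close> in terms of \<open>Im Y\<close>.\<close>

lemma flat_amplitudes:
  fixes A B :: "complex \<Rightarrow> complex" and p q :: "complex \<Rightarrow> real"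
  assumes n: "n \<ge> 1"
    and fl: "\<And>\<omega>. Re \<omega> = 1 \<Longrightarrow>
      flat (\<lambda>z. Re (\<omega> ^ Suc n * A z) + (Im \<omega> * q z - p z) * Re (\<omega> ^ n * B z))"
  obtains s where "0 \<le> s" "s < 1"
    "flat (\<lambda>z. Re (A z - Complex (p z) (q z) * B z / 2))"
    "flat (\<lambda>z. Re (Complex (p z) (- q z) * B z / 2))"
    "flat (\<lambda>z. Im (A z - Complex (p z) (q z) * B z / 2) - s * Im (Complex (p z) (- q z) * B z / 2))"
proof -
  define X where "X z = A z - Complex (p z) (q z) * B z / 2" for z
  define Y where "Y z = Complex (p z) (- q z) * B z / 2" for z
  define f where "f \<phi> z = Re (cis (Suc n * \<phi>) * X z) - Re (cis (real (n - 1) * \<phi>) * Y z)"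
    for \<phi> :: real and z
  have f: "flat (f \<phi>)" if "cos \<phi> \<noteq> 0" for \<phi>
  proof -
    define \<omega> where "\<omega> = cis \<phi> / of_real (cos \<phi>)"
    have "Re \<omega> = 1" using that by (simp add: \<omega>_def Re_divide_of_real)
    note flat_wrt_mult_bounded[OF fl[OF this] dominated_one[of "cos \<phi> ^ Suc n"]]
    moreover have "f \<phi> z = cos \<phi> ^ Suc n *
        (Re (\<omega> ^ Suc n * A z) + (Im \<omega> * q z - p z) * Re (\<omega> ^ n * B z))" for z
      unfolding f_def X_def Y_def \<omega>_def by (simp only: amplitude_identity[OF that n])
    then have "f \<phi> = (\<lambda>z. (Re (\<omega> ^ Suc n * A z) + (Im \<omega> * q z - p z) * Re (\<omega> ^ n * B z)) * cos \<phi> ^ Suc n)"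
      by (simp only: mult.commute[of "cos \<phi> ^ Suc n"] fun_eq_iff) simp
    ultimately show ?thesis by (simp only:)
  qed
  \<comment> \<open>at this angle \<open>cis (Suc n * \<phi>) = \<i>\<close>\<close>
  define \<phi> where "\<phi> = pi / (2 * Suc n)"
  define \<psi> where "\<psi> = real (n - 1) * \<phi>"
  have \<phi>: "0 < \<phi>" "\<phi> < pi / 2" using n pi_gt_zero by (auto simp: \<phi>_def field_simps)
  have \<psi>: "0 \<le> \<psi>" "\<psi> < pi / 2"
  proof -
    show "0 \<le> \<psi>" using \<phi> by (simp add: \<psi>_def)
    have "\<psi> < Suc n * \<phi>" unfolding \<psi>_def using \<phi>(1) by (intro mult_strict_right_mono) auto
    also have "\<dots> = pi / 2" by (simp add: \<phi>_def field_simps)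
    finally show "\<psi> < pi / 2" .
  qed
  have S: "Suc n * \<phi> = pi / 2" by (simp add: \<phi>_def field_simps)
  have c: "cos \<phi> \<noteq> 0" using cos_gt_zero_pi[of \<phi>] \<phi> by simp
  have f0: "f 0 z = Re (X z) - Re (Y z)" for z by (simp add: f_def)
  have f1: "f \<phi> z = - Im (X z) - (cos \<psi> * Re (Y z) - sin \<psi> * Im (Y z))" for z
    unfolding f_def S \<psi>_def[symmetric] by simp
  have f2: "f (- \<phi>) z = Im (X z) - (cos \<psi> * Re (Y z) + sin \<psi> * Im (Y z))" for z
  proof -
    have "Suc n * - \<phi> = - (pi / 2)" "real (n - 1) * - \<phi> = - \<psi>" using S by (simp_all add: \<psi>_def)
    note e = this
    show ?thesis unfolding f_def e by simp
  qed
  have cp: "0 < cos \<psi>" using cos_gt_zero_pi[of \<psi>] \<psi> by simp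
  have fl1: "flat (f \<phi>)" and fl2: "flat (f (- \<phi>))" and fl0: "flat (f 0)" using f c by auto
  have "flat (\<lambda>z. (f \<phi> z + f (- \<phi>) z) * (- 1 / (2 * cos \<psi>)))"
    by (intro flat_wrt_mult_bounded flat_wrt_add fl1 fl2 dominated_one)
  moreover have "(f \<phi> z + f (- \<phi>) z) * (- 1 / (2 * cos \<psi>)) = Re (Y z)" for z
    unfolding f1 f2 using cp by (simp add: field_simps)
  ultimately have Y: "flat (\<lambda>z. Re (Y z))" by simp
  from flat_wrt_add[OF fl0 Y] have X: "flat (\<lambda>z. Re (X z))" unfolding f0 by simp
  have "flat (\<lambda>z. (f (- \<phi>) z - f \<phi> z) * (1 / 2))"
    by (intro flat_wrt_mult_bounded flat_wrt_diff fl1 fl2 dominated_one)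
  moreover have "(f (- \<phi>) z - f \<phi> z) * (1 / 2) = Im (X z) - sin \<psi> * Im (Y z)" for z
    unfolding f1 f2 by (simp add: field_simps)
  ultimately have XY: "flat (\<lambda>z. Im (X z) - sin \<psi> * Im (Y z))" by (simp only:)
  have "sin \<psi> < 1"
  proof -
    have "(sin \<psi>)\<^sup>2 < 1" using sin_cos_squared_add[of \<psi>] cp by (smt (verit) zero_less_power2)
    then show ?thesis by (simp add: power2_less_1_iff abs_less_iff)
  qed
  moreover have "0 \<le> sin \<psi>" using \<psi> by (intro sin_ge_zero) auto
  ultimately show ?thesis using that[of "sin \<psi>"] X Y XY unfolding X_def Y_def by blast
qed

context profile_map begin

lemma g_power_mono:
  assumes "k \<le> m"
  shows "dominated (\<lambda>z. g z ^ m) (\<lambda>z. g z ^ k)"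
proof -
  have "dominated g (\<lambda>_. 1)" by (rule dominated_tendsto[OF g_tendsto])
  then have "dominated (\<lambda>z. g z ^ (m - k)) (\<lambda>_. 1)" using dominated_power[of g "\<lambda>_. 1" "m - k"] by simp
  from dominated_mult_bounded[OF dominated_refl[of "\<lambda>z. g z ^ k"] this]
  have "dominated (\<lambda>z. g z ^ k * g z ^ (m - k)) (\<lambda>z. g z ^ k)" .
  moreover have "g z ^ k * g z ^ (m - k) = g z ^ m" for z
    using assms by (simp flip: power_add)
  ultimately show ?thesis by simp
qed

lemma g_power_flat:
  assumes "k < m"
  shows "flat_wrt (\<lambda>z. g z ^ m) (\<lambda>z. g z ^ k)"
proof (rule dominated_flat_wrt_trans[OF g_power_mono])
  show "Suc k \<le> m" using assms by simp
  show "flat_wrt (\<lambda>z. g z ^ Suc k) (\<lambda>z. g z ^ k)"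
    by (rule flat_wrt_flat_weight[OF _ flat_G]) (simp add: dominated_refl)
qed

lemma flat_div_cmod:
  assumes "flat f"
  shows "flat (\<lambda>z. f z / cmod z :: real)"
  unfolding flat_wrt_def
proof
  fix N
  have "dominated f (\<lambda>z. cmod z ^ Suc N)" using flat_wrtD[OF assms, of "Suc N"] by simp
  then obtain C where C: "\<forall>\<^sub>F z in at 0. norm (f z) \<le> C * \<bar>cmod z ^ Suc N\<bar>" by (rule dominatedE)
  show "dominated (\<lambda>z. f z / cmod z) (\<lambda>z. 1 * cmod z ^ N)"
    by (rule dominatedI[of _ C], use C eventually_at0_norm_less[of 1, OF zero_less_one] in eventually_elim)
       (simp add: field_simps)
qed

lemma bounded_coeff1_U: "dominated (coeff1 U i) (\<lambda>_. 1)"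
  by (rule holomorphic_dominated[OF U.coeff1_holomorphic U.R_pos])

lemma bounded_coeff1_V: "dominated (coeff1 V i) (\<lambda>_. 1)"
  by (rule holomorphic_dominated[OF V.coeff1_holomorphic V.R_pos])

context
  fixes n :: nat
  assumes n: "n \<ge> 1"
    and U_lower: "\<And>i z. 2 \<le> i \<Longrightarrow> i \<le> n \<Longrightarrow> z \<in> ball 0 R \<Longrightarrow> coeff1 U i z = 0"
    and V_lower: "\<And>i z. 1 \<le> i \<Longrightarrow> i < n \<Longrightarrow> z \<in> ball 0 R \<Longrightarrow> coeff1 V i z = 0"
begin

definition lead_U :: "complex \<Rightarrow> complex" where "lead_U = coeff1 U (Suc n)"

text \<open>Only the modulus of \<open>V\<close> enters the equation, so \<open>V\<close> may be multiplied by \<open>cnj b\<close>, which normalises its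
  linear part to \<open>z\<close>.\<close>

definition lead_V :: "complex \<Rightarrow> complex" where "lead_V z = cnj b * coeff1 V n z"

lemma U_expansion:
  "dominated (\<lambda>z. U (test_point \<omega> z) z - (test_point \<omega> z + test_point \<omega> z ^ Suc n * lead_U z)) (\<lambda>z. g z ^ (n + 2))"
proof -
  note U_remainder[of \<omega> "n + 2"]
  then show ?thesis
  proof (rule dominated_eventually_eq, use test_point_in_ball[of \<omega>] in eventually_elim)
    case (elim z)
    have "(\<Sum>i<n + 2. coeff1 U i z * test_point \<omega> z ^ i)
        = (\<Sum>i<Suc n. coeff1 U i z * test_point \<omega> z ^ i) + coeff1 U (Suc n) z * test_point \<omega> z ^ Suc n"
      by simp
    also have "(\<Sum>i<Suc n. coeff1 U i z * test_point \<omega> z ^ i) = (\<Sum>i\<in>{1}. coeff1 U i z * test_point \<omega> z ^ i)"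
    proof (rule sum.mono_neutral_right)
      show "\<forall>i\<in>{..<Suc n} - {1}. coeff1 U i z * test_point \<omega> z ^ i = 0"
      proof
        fix i assume i: "i \<in> {..<Suc n} - {1}"
        show "coeff1 U i z * test_point \<omega> z ^ i = 0"
        proof (cases "i = 0")
          case True
          then show ?thesis using elim by (simp add: U.coeff1_0 U0_eq_0)
        next
          case False
          then show ?thesis using i elim by (simp add: U_lower)
        qed
      qed
    qed (use n in auto)
    also have "\<dots> = test_point \<omega> z" using elim u_eq_1 by simp
    finally show ?case by (simp add: lead_U_def)
  qed
qed

lemma V_expansion:
  "dominated (\<lambda>z. cnj b * W \<omega> z - (z + test_point \<omega> z ^ n * lead_V z)) (\<lambda>z. g z ^ Suc n)"
proof -
  note V_remainder[of \<omega> "Suc n"]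
  then have "dominated (\<lambda>z. cnj b * (W \<omega> z - (\<Sum>i<Suc n. coeff1 V i z * test_point \<omega> z ^ i))) (\<lambda>z. g z ^ Suc n)"
    by (rule dominated_cmult)
  then show ?thesis
  proof (rule dominated_eventually_eq, use test_point_in_ball[of \<omega>] in eventually_elim)
    case (elim z)
    have bb: "cnj b * b = 1" using cmod_b by (simp add: complex_norm_square[symmetric] mult.commute)
    have "(\<Sum>i<Suc n. coeff1 V i z * test_point \<omega> z ^ i)
        = (\<Sum>i<n. coeff1 V i z * test_point \<omega> z ^ i) + coeff1 V n z * test_point \<omega> z ^ n"
      by simp
    also have "(\<Sum>i<n. coeff1 V i z * test_point \<omega> z ^ i) = (\<Sum>i\<in>{0}. coeff1 V i z * test_point \<omega> z ^ i)"
    proof (rule sum.mono_neutral_right)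
      show "\<forall>i\<in>{..<n} - {0}. coeff1 V i z * test_point \<omega> z ^ i = 0"
        using V_lower elim by auto
    qed (use n in auto)
    also have "\<dots> = b * z" using elim by (simp add: V.coeff1_0 V0_linear)
    finally have "cnj b * (W \<omega> z - (\<Sum>i<Suc n. coeff1 V i z * test_point \<omega> z ^ i))
        = cnj b * W \<omega> z - ((cnj b * b) * z + cnj b * (coeff1 V n z * test_point \<omega> z ^ n))"
      by (simp only: right_diff_distrib distrib_left mult.assoc)
    then show ?case unfolding bb lead_V_def by (simp only: mult_1 mult_ac)
  qed
qed

lemma bounded_lead_U: "dominated lead_U (\<lambda>_. 1)"
  unfolding lead_U_def by (rule bounded_coeff1_U)

lemma bounded_lead_V: "dominated lead_V (\<lambda>_. 1)"
proof -
  have "dominated (\<lambda>z. cnj b * coeff1 V n z) (\<lambda>_. 1)" by (rule dominated_cmult[OF bounded_coeff1_V])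
  then show ?thesis by (rule dominated_eventually_eq) (simp add: lead_V_def)
qed

text \<open>The first-order change of the radius \<open>|z|\<close> under the displacement of \<open>z\<close> by \<open>Z ^ n * lead_V z\<close>.\<close>

definition \<sigma> :: "complex \<Rightarrow> complex \<Rightarrow> real" where
  "\<sigma> \<omega> z = Re (cnj z * (test_point \<omega> z ^ n * lead_V z)) / cmod z"

lemma dominated_\<sigma>: "dominated (\<sigma> \<omega>) (\<lambda>z. g z ^ n)"
proof -
  have "dominated (\<lambda>z. test_point \<omega> z ^ n * lead_V z) (\<lambda>z. g z ^ n)"
    by (rule dominated_mult_bounded[OF dominated_test_point_power bounded_lead_V])
  then show ?thesis
  proof (rule dominated_cong, use eventually_at0_norm_less[of 1, OF zero_less_one] in eventually_elim)
    case (elim z)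
    have "\<bar>Re (cnj z * (test_point \<omega> z ^ n * lead_V z))\<bar> \<le> cmod z * cmod (test_point \<omega> z ^ n * lead_V z)"
      using abs_Re_le_cmod[of "cnj z * (test_point \<omega> z ^ n * lead_V z)"] by (simp add: norm_mult)
    then show ?case using elim by (simp add: \<sigma>_def field_simps)
  qed
qed

text \<open>The quadratic error in the expansion of the modulus is of order \<open>G ^ (2 * n) / |z|\<close>, which does not
  exceed \<open>G ^ (n + 1) / |z|\<close> because \<open>n \<ge> 1\<close>.\<close>

lemma radius_expansion:
  "dominated (\<lambda>z. cmod (W \<omega> z) - cmod z - \<sigma> \<omega> z) (\<lambda>z. g z ^ Suc n / cmod z)"
proof -
  let ?V = "\<lambda>z. cnj b * W \<omega> z"
  let ?D = "\<lambda>z. ?V z - z"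
  have Zn: "dominated (\<lambda>z. test_point \<omega> z ^ n * lead_V z) (\<lambda>z. g z ^ n)"
    by (rule dominated_mult_bounded[OF dominated_test_point_power bounded_lead_V])
  have "dominated (\<lambda>z. (?V z - (z + test_point \<omega> z ^ n * lead_V z)) + test_point \<omega> z ^ n * lead_V z) (\<lambda>z. g z ^ n)"
    by (rule dominated_add[OF dominated_trans[OF V_expansion g_power_mono] Zn]) simp
  then have D: "dominated ?D (\<lambda>z. g z ^ n)" by (simp add: algebra_simps)
  have gn: "flat (\<lambda>z. g z ^ n)" using g_power_flat[of 0 n] n by simp
  have Dflat: "flat ?D" by (rule dominated_flat_wrt_trans[OF D gn])
  obtain C1 where C1: "C1 > 0" "\<forall>\<^sub>F z in at 0. norm (?D z) \<le> C1 * \<bar>g z ^ n\<bar>"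
    using D by (rule dominatedE)
  obtain C2 where C2: "C2 > 0" "\<forall>\<^sub>F z in at 0. norm (?V z - (z + test_point \<omega> z ^ n * lead_V z)) \<le> C2 * \<bar>g z ^ Suc n\<bar>"
    using V_expansion[of \<omega>] by (rule dominatedE)
  obtain C3 r where C3: "C3 > 0" "r > 0" "\<And>z. z \<noteq> 0 \<Longrightarrow> cmod z < r \<Longrightarrow> norm (?D z) \<le> C3 * cmod z ^ 2"
    using flatD[OF Dflat, of 2] by metis
  have "r' > 0" if "r' = Min {r, 1 / (2 * C3), 1}" for r' using C3 that by simp
  then have "\<forall>\<^sub>F z::complex in at 0. z \<noteq> 0 \<and> cmod z < Min {r, 1 / (2 * C3), 1}"
    by (intro eventually_at0_norm_less) blast
  moreover have "\<forall>\<^sub>F z in at 0. g z < 1"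
    using g_tendsto by (rule order_tendstoD) simp
  ultimately have "\<forall>\<^sub>F z in at 0. norm (cmod (W \<omega> z) - cmod z - \<sigma> \<omega> z) \<le> (C1\<^sup>2 + C2) * \<bar>g z ^ Suc n / cmod z\<bar>"
    using C1(2) C2(2) g_pos
  proof eventually_elim
    case (elim z)
    then have z: "z \<noteq> 0" "cmod z < r" "cmod z < 1 / (2 * C3)" "cmod z < 1" by auto
    let ?a = "cmod z"
    have "norm (?D z) \<le> C3 * ?a ^ 2" using C3(3) z by blast
    also have "\<dots> = (C3 * ?a) * ?a" by (simp add: power2_eq_square)
    also have "\<dots> \<le> (1 / 2) * ?a"
      using z(3) C3(1) by (intro mult_right_mono) (auto simp: field_simps)
    finally have small: "cmod (?D z) \<le> ?a / 2" by simp
    have 1: "\<bar>cmod (z + ?D z) - ?a - Re (cnj z * ?D z) / ?a\<bar> \<le> (cmod (?D z))\<^sup>2 / ?a"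
      by (rule cmod_add_expansion[OF z(1) small])
    have W: "cmod (z + ?D z) = cmod (W \<omega> z)" by (simp add: norm_mult cmod_b)
    have gn1: "(g z ^ n)\<^sup>2 \<le> g z ^ Suc n"
    proof -
      have "g z ^ (n + n) \<le> g z ^ Suc n" using elim n by (intro power_decreasing) auto
      then show ?thesis by (simp add: power2_eq_square power_add)
    qed
    have "(cmod (?D z))\<^sup>2 \<le> (C1 * g z ^ n)\<^sup>2"
      using elim by (intro power_mono) auto
    also have "\<dots> \<le> C1\<^sup>2 * g z ^ Suc n"
      unfolding power_mult_distrib using gn1 by (intro mult_left_mono) auto
    finally have 2: "(cmod (?D z))\<^sup>2 / ?a \<le> C1\<^sup>2 * g z ^ Suc n / ?a" by (rule divide_right_mono) simp
    have "\<bar>Re (cnj z * (?D z - test_point \<omega> z ^ n * lead_V z))\<bar> \<le> ?a * cmod (?D z - test_point \<omega> z ^ n * lead_V z)"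
      using abs_Re_le_cmod[of "cnj z * (?D z - test_point \<omega> z ^ n * lead_V z)"] by (simp add: norm_mult)
    also have "?D z - test_point \<omega> z ^ n * lead_V z = ?V z - (z + test_point \<omega> z ^ n * lead_V z)" by simp
    also have "?a * cmod \<dots> \<le> 1 * (C2 * g z ^ Suc n)"
      using elim z by (intro mult_mono) auto
    finally have "\<bar>Re (cnj z * (?D z - test_point \<omega> z ^ n * lead_V z))\<bar> / ?a \<le> C2 * g z ^ Suc n / ?a"
      by (intro divide_right_mono) (simp_all only: mult_1 norm_ge_zero diff_diff_eq)
    moreover have "Re (cnj z * (?D z - test_point \<omega> z ^ n * lead_V z)) / ?a = Re (cnj z * ?D z) / ?a - \<sigma> \<omega> z"
      unfolding \<sigma>_def right_diff_distrib[of "cnj z" "?D z"] minus_complex.sel diff_divide_distrib ..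
    ultimately have 3: "\<bar>Re (cnj z * ?D z) / ?a - \<sigma> \<omega> z\<bar> \<le> C2 * g z ^ Suc n / ?a"
      by (metis abs_divide abs_norm_cancel)
    have "\<bar>cmod (W \<omega> z) - ?a - \<sigma> \<omega> z\<bar> \<le> C1\<^sup>2 * g z ^ Suc n / ?a + C2 * g z ^ Suc n / ?a"
      using 1 2 3 unfolding W by linarith
    also have "\<dots> = (C1\<^sup>2 + C2) * \<bar>g z ^ Suc n / ?a\<bar>"
      using elim by (simp add: field_simps)
    finally show ?case by simp
  qed
  then show ?thesis by (rule dominatedI)
qed

lemma weight_G':
  assumes "dominated f (\<lambda>z. g z ^ Suc n / cmod z)"
  shows "flat_wrt (\<lambda>z. G' (cmod z) * f z) (\<lambda>z. g z ^ Suc n)"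
proof -
  have "dominated (\<lambda>z. G' (cmod z) * f z) (\<lambda>z. (G' (cmod z) / cmod z) * g z ^ Suc n)"
    using dominated_mult[OF dominated_refl[of "\<lambda>z. G' (cmod z)"] assms] by simp
  then show ?thesis by (rule flat_wrt_flat_weight[OF _ flat_div_cmod[OF flat_G']])
qed

lemma weight_flat:
  assumes "dominated f (\<lambda>z. g z ^ Suc n / cmod z)"
  shows "flat_wrt f (\<lambda>z. g z ^ n)"
proof -
  have "dominated f (\<lambda>z. (g z / cmod z) * g z ^ n)" using assms by simp
  then show ?thesis by (rule flat_wrt_flat_weight[OF _ flat_div_cmod[OF flat_G]])
qed

lemma dominated_radius_change: "dominated (\<lambda>z. cmod (W \<omega> z) - cmod z) (\<lambda>z. g z ^ n)"
  using dominated_add[OF flat_wrt_dominated[OF weight_flat[OF radius_expansion[of \<omega>]]] dominated_\<sigma>[of \<omega>]] by simp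

lemma dominated_radius_change_square: "dominated (\<lambda>z. (cmod (W \<omega> z) - cmod z)\<^sup>2) (\<lambda>z. g z ^ Suc n)"
proof -
  have "dominated (\<lambda>z. (cmod (W \<omega> z) - cmod z)\<^sup>2) (\<lambda>z. g z ^ (n + n))"
    using dominated_mult[OF dominated_radius_change dominated_radius_change, of \<omega> \<omega>]
    by (simp only: power2_eq_square power_add)
  then show ?thesis by (rule dominated_trans[OF _ g_power_mono]) (use n in simp)
qed

lemma G_expansion:
  "flat_wrt (\<lambda>z. G (cmod (W \<omega> z)) - g z - G' (cmod z) * \<sigma> \<omega> z) (\<lambda>z. g z ^ Suc n)"
proof -
  have 1: "flat_wrt (\<lambda>z. G (cmod (W \<omega> z)) - g z - G' (cmod z) * (cmod (W \<omega> z) - cmod z)) (\<lambda>z. g z ^ Suc n)"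
    by (rule flat_wrt_dominated_trans[OF G_taylor[OF dominated_W] dominated_radius_change_square])
  show ?thesis
    by (rule flat_wrt_eventually_eq[OF flat_wrt_add[OF 1 weight_G'[OF radius_expansion[of \<omega>]]]])
       (simp add: algebra_simps)
qed

lemma q_expansion:
  "flat_wrt (\<lambda>z. q (cmod (W \<omega> z)) - q (cmod z) - q' (cmod z) * \<sigma> \<omega> z) (\<lambda>z. g z ^ n)"
proof -
  have "dominated (\<lambda>z. q (cmod (W \<omega> z)) - q (cmod z) - q' (cmod z) * (cmod (W \<omega> z) - cmod z)) (\<lambda>z. g z ^ Suc n)"
    by (rule dominated_trans[OF q_taylor[OF dominated_W] dominated_radius_change_square])
  then have 1: "flat_wrt (\<lambda>z. q (cmod (W \<omega> z)) - q (cmod z) - q' (cmod z) * (cmod (W \<omega> z) - cmod z)) (\<lambda>z. g z ^ n)"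
    by (rule dominated_flat_wrt_trans[OF _ g_power_flat]) simp
  have 2: "flat_wrt (\<lambda>z. (cmod (W \<omega> z) - cmod z - \<sigma> \<omega> z) * q' (cmod z)) (\<lambda>z. g z ^ n)"
    by (rule flat_wrt_mult_bounded[OF weight_flat[OF radius_expansion] dominated_q'])
  show ?thesis
    by (rule flat_wrt_eventually_eq[OF flat_wrt_add[OF 1 2]]) (simp add: algebra_simps)
qed

lemma dominated_q_change: "dominated (\<lambda>z. q (cmod (W \<omega> z)) - q (cmod z)) (\<lambda>z. g z ^ n)"
proof -
  have "dominated (\<lambda>z. \<sigma> \<omega> z * q' (cmod z)) (\<lambda>z. g z ^ n)"
    by (rule dominated_mult_bounded[OF dominated_\<sigma> dominated_q'])
  from dominated_add[OF flat_wrt_dominated[OF q_expansion[of \<omega>]] this]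
  show ?thesis by (rule dominated_eventually_eq) (simp add: algebra_simps)
qed

lemma cis_expansion:
  "flat_wrt (\<lambda>z. cis (q (cmod z) - q (cmod (W \<omega> z))) - (1 - \<i> * of_real (q' (cmod z) * \<sigma> \<omega> z))) (\<lambda>z. g z ^ n)"
proof -
  let ?t = "\<lambda>z. q (cmod z) - q (cmod (W \<omega> z))"
  have t: "dominated ?t (\<lambda>z. g z ^ n)"
    by (rule dominated_eventually_eq[OF dominated_minus[OF dominated_q_change[of \<omega>]]]) simp
  have "dominated (\<lambda>z. cis (?t z) - 1 - \<i> * of_real (?t z)) (\<lambda>z. ?t z * ?t z)"
  proof (rule dominatedI[of _ 2], rule always_eventually, rule allI)
    show "norm (cis (?t z) - 1 - \<i> * of_real (?t z)) \<le> 2 * \<bar>?t z * ?t z\<bar>" for z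
      using cmod_cis_second_order[of "?t z"] by (simp add: power2_eq_square)
  qed
  then have "dominated (\<lambda>z. cis (?t z) - 1 - \<i> * of_real (?t z)) (\<lambda>z. g z ^ n * g z ^ n)"
    by (rule dominated_trans[OF _ dominated_mult[OF t t]])
  then have 1: "flat_wrt (\<lambda>z. cis (?t z) - 1 - \<i> * of_real (?t z)) (\<lambda>z. g z ^ n)"
    by (rule dominated_flat_wrt_trans)
       (use g_power_flat[of n "n + n"] n in \<open>simp add: power_add\<close>)
  have 2: "flat_wrt (\<lambda>z. of_real (q (cmod (W \<omega> z)) - q (cmod z) - q' (cmod z) * \<sigma> \<omega> z) * \<i>) (\<lambda>z. g z ^ n)"
    by (rule flat_wrt_mult_bounded[OF flat_wrt_of_real[OF q_expansion] dominated_one])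
  show ?thesis
    by (rule flat_wrt_eventually_eq[OF flat_wrt_diff[OF 1 2]]) (simp add: algebra_simps)
qed

lemma left_side_expansion:
  "flat_wrt (\<lambda>z. Re (U (test_point \<omega> z) z * cis (- q (cmod (W \<omega> z))))
      - g z * Re (\<omega> * (1 - \<i> * of_real (q' (cmod z) * \<sigma> \<omega> z) + test_point \<omega> z ^ n * lead_U z))) (\<lambda>z. g z ^ Suc n)"
proof -
  let ?c = "\<lambda>z. cis (q (cmod z) - q (cmod (W \<omega> z)))"
  let ?l = "\<lambda>z. 1 - \<i> * of_real (q' (cmod z) * \<sigma> \<omega> z)"
  let ?e = "\<lambda>z. cis (- q (cmod (W \<omega> z)))"
  let ?P = "\<lambda>z. test_point \<omega> z ^ n * lead_U z"
  have "dominated (\<lambda>z. (U (test_point \<omega> z) z - (test_point \<omega> z + test_point \<omega> z ^ Suc n * lead_U z)) * ?e z) (\<lambda>z. g z ^ (n + 2))"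
    by (rule dominated_mult_bounded[OF U_expansion bounded_cis])
  then have 1: "flat_wrt (\<lambda>z. (U (test_point \<omega> z) z - (test_point \<omega> z + test_point \<omega> z ^ Suc n * lead_U z)) * ?e z) (\<lambda>z. g z ^ Suc n)"
    by (rule dominated_flat_wrt_trans[OF _ g_power_flat]) simp
  have P: "dominated ?P (\<lambda>z. g z ^ n)"
    by (rule dominated_mult_bounded[OF dominated_test_point_power bounded_lead_U])
  have "dominated (\<lambda>z. ?c z - 1) (\<lambda>z. q (cmod (W \<omega> z)) - q (cmod z))"
  proof (rule dominatedI[of _ 1], rule always_eventually, rule allI)
    show "norm (?c z - 1) \<le> 1 * \<bar>q (cmod (W \<omega> z)) - q (cmod z)\<bar>" for z
      using cmod_cis_diff_le[of "q (cmod z) - q (cmod (W \<omega> z))" 0] by (simp add: abs_minus_commute)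
  qed
  then have "dominated (\<lambda>z. ?c z - 1) (\<lambda>z. g z ^ n)"
    by (rule dominated_trans[OF _ dominated_q_change])
  from dominated_mult[OF this P] have "dominated (\<lambda>z. (?c z - 1) * ?P z) (\<lambda>z. g z ^ (n + n))"
    by (simp only: power_add)
  then have "flat_wrt (\<lambda>z. (?c z - 1) * ?P z) (\<lambda>z. g z ^ n)"
    by (rule dominated_flat_wrt_trans[OF _ g_power_flat]) (use n in simp)
  from flat_wrt_add[OF cis_expansion[of \<omega>] this]
  have "flat_wrt (\<lambda>z. ?c z * (1 + ?P z) - (?l z + ?P z)) (\<lambda>z. g z ^ n)"
    by (rule flat_wrt_eventually_eq) (simp add: algebra_simps)
  from flat_wrt_mult[OF this dominated_cmult[OF dominated_of_real[OF dominated_refl[of g]], of \<omega>]]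
  have 2: "flat_wrt (\<lambda>z. (?c z * (1 + ?P z) - (?l z + ?P z)) * (\<omega> * of_real (g z))) (\<lambda>z. g z ^ Suc n)"
    by (simp only: power_Suc2)
  have "Re ((U (test_point \<omega> z) z - (test_point \<omega> z + test_point \<omega> z ^ Suc n * lead_U z)) * ?e z)
       + Re ((?c z * (1 + ?P z) - (?l z + ?P z)) * (\<omega> * of_real (g z)))
      = Re (U (test_point \<omega> z) z * ?e z) - g z * Re (\<omega> * (?l z + ?P z))" for z
  proof -
    have "?c z = cis (q (cmod z)) * ?e z" by (simp add: cis_mult)
    then have "\<omega> * of_real (g z) * ?c z = test_point \<omega> z * ?e z"
      by (simp only: test_point_def mult_ac)
    then have "\<omega> * of_real (g z) * ?c z * (1 + ?P z) = (test_point \<omega> z + test_point \<omega> z ^ Suc n * lead_U z) * ?e z"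
      by (simp add: algebra_simps)
    then have "(U (test_point \<omega> z) z - (test_point \<omega> z + test_point \<omega> z ^ Suc n * lead_U z)) * ?e z
        + (?c z * (1 + ?P z) - (?l z + ?P z)) * (\<omega> * of_real (g z))
      = U (test_point \<omega> z) z * ?e z - of_real (g z) * (\<omega> * (?l z + ?P z))"
      by (simp add: algebra_simps)
    from arg_cong[OF this, of Re] show ?thesis
      by (simp only: plus_complex.sel minus_complex.sel Re_of_real_mult)
  qed
  then show ?thesis using flat_wrt_add[OF flat_wrt_Re[OF 1] flat_wrt_Re[OF 2]] by simp
qed

text \<open>Divide the invariance equation by \<open>g ^ Suc n\<close>. The terms of lower order cancel because \<open>U\<close> and \<open>V\<close>
  agree with \<open>Z\<close> and \<open>b * z\<close> up to the orders considered before.\<close>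

lemma higher_order:
  assumes "Re \<omega> = 1"
  shows "flat (\<lambda>z. Re (\<omega> ^ Suc n * (cis (n * q (cmod z)) * lead_U z))
    + (Im \<omega> * q' (cmod z) - G' (cmod z) / g z) * Re (\<omega> ^ n * (cis (n * q (cmod z)) * lead_V z * cnj z / cmod z)))"
    (is "flat ?E")
proof (rule flat_wrt_cancel[where g = "\<lambda>z. g z ^ Suc n"])
  show "\<forall>\<^sub>F z in at 0. g z ^ Suc n \<noteq> 0" using g_pos by eventually_elim auto
  have ev: "\<forall>\<^sub>F z in at 0. g z ^ Suc n * ?E z =
     (G (cmod (W \<omega> z)) - g z - G' (cmod z) * \<sigma> \<omega> z)
     - (Re (U (test_point \<omega> z) z * cis (- q (cmod (W \<omega> z))))
      - g z * Re (\<omega> * (1 - \<i> * of_real (q' (cmod z) * \<sigma> \<omega> z) + test_point \<omega> z ^ n * lead_U z)))"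
    using equation[OF assms] g_pos
  proof eventually_elim
    case (elim z)
    define s where "s = Re (\<omega> ^ n * (cis (n * q (cmod z)) * lead_V z * cnj z / cmod z))"
    have Zn: "test_point \<omega> z ^ n = of_real (g z ^ n) * (\<omega> ^ n * cis (n * q (cmod z)))"
      by (simp add: test_point_def power_mult_distrib Complex.DeMoivre mult_ac)
    have "cnj z * (test_point \<omega> z ^ n * lead_V z) / of_real (cmod z)
        = of_real (g z ^ n) * (\<omega> ^ n * (cis (n * q (cmod z)) * lead_V z * cnj z / cmod z))"
      unfolding Zn by (simp add: mult_ac)
    moreover have "\<sigma> \<omega> z = Re (cnj z * (test_point \<omega> z ^ n * lead_V z) / of_real (cmod z))"
      unfolding \<sigma>_def Re_divide_of_real ..
    ultimately have \<sigma>: "\<sigma> \<omega> z = g z ^ n * s"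
      by (simp only: s_def Re_of_real_mult)
    have "\<omega> * (test_point \<omega> z ^ n * lead_U z) = of_real (g z ^ n) * (\<omega> ^ Suc n * (cis (n * q (cmod z)) * lead_U z))"
      unfolding Zn by (simp add: mult_ac)
    then have lead_U: "Re (\<omega> * (test_point \<omega> z ^ n * lead_U z)) = g z ^ n * Re (\<omega> ^ Suc n * (cis (n * q (cmod z)) * lead_U z))"
      by (simp only: Re_of_real_mult)
    have "Re (\<omega> * (1 - \<i> * of_real (q' (cmod z) * \<sigma> \<omega> z) + test_point \<omega> z ^ n * lead_U z))
        = Re \<omega> + Im \<omega> * (q' (cmod z) * \<sigma> \<omega> z) + Re (\<omega> * (test_point \<omega> z ^ n * lead_U z))"
      unfolding distrib_left right_diff_distrib by simp
    then have lin: "Re (\<omega> * (1 - \<i> * of_real (q' (cmod z) * \<sigma> \<omega> z) + test_point \<omega> z ^ n * lead_U z))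
        = 1 + Im \<omega> * (q' (cmod z) * (g z ^ n * s)) + g z ^ n * Re (\<omega> ^ Suc n * (cis (n * q (cmod z)) * lead_U z))"
      using assms unfolding lead_U \<sigma> by simp
    define r where "r = Re (\<omega> ^ Suc n * (cis (n * q (cmod z)) * lead_U z))"
    show ?case
      unfolding lin unfolding elim(1) s_def[symmetric] \<sigma> r_def[symmetric] using elim(2) by (simp add: field_simps)
  qed
  show "flat_wrt (\<lambda>z. g z ^ Suc n * ?E z) (\<lambda>z. g z ^ Suc n)"
    by (rule flat_wrt_eventually_eq[OF flat_wrt_diff[OF G_expansion left_side_expansion] ev])
qed

lemma log_derivative_not_bounded:
  "\<not> (\<forall>\<^sub>F z in at (0::complex). \<bar>G' (cmod z) / g z\<bar> * cmod z \<le> D)"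
proof
  assume "\<forall>\<^sub>F z in at (0::complex). \<bar>G' (cmod z) / g z\<bar> * cmod z \<le> D"
  then obtain r where r: "r > 0" "\<forall>z::complex. z \<noteq> 0 \<and> cmod z < r \<longrightarrow> \<bar>G' (cmod z) / g z\<bar> * cmod z \<le> D"
    by (rule eventually_radius)
  obtain x where x: "0 < x" "x < min r (\<epsilon> / 2)" "\<bar>G' x\<bar> * x > D * G x"
  proof -
    have "min r (\<epsilon> / 2) < \<epsilon>" "0 < min r (\<epsilon> / 2)" using r(1) eps_pos by (auto simp: min_def)
    then show ?thesis using log_derivative_unbounded[of "min r (\<epsilon> / 2)" D] that by blast
  qed
  have "\<bar>G' x / G x\<bar> * x \<le> D" using r(2)[rule_format, of "of_real x"] x by simp
  moreover have "0 < G x" using G_pos x eps_pos by auto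
  ultimately show False using x(3) by (simp add: field_simps)
qed

text \<open>Put \<open>\<kappa> = G'/G - \<i> q'\<close>. The separated equations bound \<open>\<kappa> * lead_V\<close>, because \<open>lead_U\<close> is bounded. If
  \<open>lead_V\<close> vanishes to order at most one, then \<open>G'/G = O(1/|z|)\<close>, which is impossible. If it vanishes to
  higher order, then \<open>lead_V z / z\<close> has no constant term, so it can be rotated into any direction on
  a circle, and the flatness of the real part of \<open>\<kappa> * lead_V z / z\<close>, up to a unimodular factor that
  depends only on \<open>|z|\<close>, makes \<open>\<kappa>\<close> itself bounded, which is impossible as well. So \<open>lead_V = 0\<close>, and
  then \<open>lead_U\<close> is flat.\<close>

lemma higher_coefficients_vanish:
  assumes "z \<in> ball 0 R"
  shows "lead_V z = 0 \<and> lead_U z = 0"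
proof -
  define p where "p z = G' (cmod z) / g z" for z :: complex
  define e where "e z = cis (n * q (cmod z))" for z :: complex
  define \<kappa> where "\<kappa> z = Complex (p z) (- q' (cmod z))" for z
  define X where "X z = e z * lead_U z - Complex (p z) (q' (cmod z)) * (e z * lead_V z * cnj z / cmod z) / 2" for z
  define Y where "Y z = \<kappa> z * (e z * lead_V z * cnj z / cmod z) / 2" for z
  have "flat (\<lambda>z. Re (\<omega> ^ Suc n * (e z * lead_U z))
      + (Im \<omega> * q' (cmod z) - p z) * Re (\<omega> ^ n * (e z * lead_V z * cnj z / cmod z)))" if "Re \<omega> = 1" for \<omega>
    using higher_order[OF that] unfolding e_def p_def .
  then obtain s where s: "0 \<le> s" "s < 1" 
    "flat (\<lambda>z. Re (X z))" "flat (\<lambda>z. Re (Y z))" "flat (\<lambda>z. Im (X z) - s * Im (Y z))"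
    unfolding X_def Y_def \<kappa>_def by (rule flat_amplitudes[OF n])
  have cmod_Y: "cmod (Y z) = cmod (\<kappa> z) * cmod (lead_V z) / 2" if "z \<noteq> 0" for z
    using that by (simp add: Y_def norm_mult norm_divide e_def)
  have p_le: "\<bar>p z\<bar> \<le> cmod (\<kappa> z)" for z
    using abs_Re_le_cmod[of "\<kappa> z"] by (simp add: \<kappa>_def)
  have cmod_e: "cmod (e z) = 1" for z by (simp add: e_def)
  obtain K where K: "\<forall>\<^sub>F z in at 0. cmod (Y z) \<le> K"
  proof -
    obtain C where C: "\<forall>\<^sub>F z in at 0. cmod (lead_U z) \<le> C * \<bar>1\<bar>" using bounded_lead_U by (rule dominatedE)
    have "\<forall>\<^sub>F z in at 0. \<bar>Re (X z)\<bar> < 1"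
      using tendstoD[OF flat_tendsto_0[OF s(3)], of 1] by simp
    moreover have "\<forall>\<^sub>F z in at 0. \<bar>Im (X z) - s * Im (Y z)\<bar> < 1"
      using tendstoD[OF flat_tendsto_0[OF s(5)], of 1] by simp
    ultimately have "\<forall>\<^sub>F z in at 0. cmod (Y z) \<le> (C + 2) / (1 - s)"
      using C
    proof eventually_elim
      case (elim z)
      have "cmod (Complex (p z) (q' (cmod z))) = cmod (\<kappa> z)" by (simp add: \<kappa>_def cmod_def)
      then have "cmod (Y z) = cmod (Complex (p z) (q' (cmod z)) * (e z * lead_V z * cnj z / cmod z) / 2)"
        unfolding Y_def norm_mult norm_divide by (simp only:)
      also have "\<dots> = cmod (e z * lead_U z - X z)" unfolding X_def by (simp only: diff_diff_eq2 add_diff_cancel_left')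
      also have "\<dots> \<le> cmod (e z * lead_U z) + cmod (X z)" by (rule norm_triangle_ineq4)
      also have "cmod (e z * lead_U z) = cmod (lead_U z)" by (simp add: norm_mult cmod_e)
      finally have "cmod (Y z) \<le> C + (\<bar>Re (X z)\<bar> + \<bar>Im (X z)\<bar>)"
        using elim(3) cmod_le[of "X z"] by simp
      moreover have "\<bar>Im (X z)\<bar> \<le> 1 + s * \<bar>Im (Y z)\<bar>"
        using elim(2) abs_mult[of s "Im (Y z)"] s(1) by linarith
      moreover have "s * \<bar>Im (Y z)\<bar> \<le> s * cmod (Y z)"
        by (intro mult_left_mono abs_Im_le_cmod s(1))
      ultimately have "cmod (Y z) - s * cmod (Y z) \<le> C + 2" using elim(1) by linarith
      then show ?case using s(2) by (simp add: pos_le_divide_eq algebra_simps)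
    qed
    then show ?thesis using that by blast
  qed
  have lead_V_holo: "lead_V holomorphic_on ball 0 R"
    unfolding lead_V_def by (intro holomorphic_intros V.coeff1_holomorphic)
  have no_linear_bound: False if c: "c > 0" "\<forall>\<^sub>F z in at 0. c * cmod z \<le> cmod (lead_V z)" for c
  proof -
    have "\<forall>\<^sub>F z in at (0::complex). \<bar>G' (cmod z) / g z\<bar> * cmod z \<le> 2 * K / c"
      using K c(2) eventually_at0_norm_less[of 1, OF zero_less_one]
    proof eventually_elim
      case (elim z)
      have "\<bar>p z\<bar> * (c * cmod z) \<le> cmod (\<kappa> z) * cmod (lead_V z)"
        using elim c(1) by (intro mult_mono p_le) auto
      also have "\<dots> = 2 * cmod (Y z)" using elim by (simp add: cmod_Y)
      also have "\<dots> \<le> 2 * K" using elim by simp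
      finally show ?case using c(1) by (simp add: p_def pos_le_divide_eq mult_ac)
    qed
    then show False using log_derivative_not_bounded by blast
  qed
  have lead_V_0: "lead_V z = 0" if z: "z \<in> ball 0 R" for z
  proof (rule ccontr)
    assume nz: "lead_V z \<noteq> 0"
    have B00: "lead_V 0 = 0"
    proof (rule ccontr)
      assume B0: "lead_V 0 \<noteq> 0"
      have "((\<lambda>z. cmod (lead_V z)) \<longlongrightarrow> cmod (lead_V 0)) (at 0)"
        by (intro tendsto_norm holomorphic_isCont_0[OF lead_V_holo V.R_pos])
      then have "\<forall>\<^sub>F z in at 0. cmod (lead_V 0) / 2 < cmod (lead_V z)"
        by (rule order_tendstoD) (use B0 in simp)
      then have "\<forall>\<^sub>F z in at 0. cmod (lead_V 0) / 2 * cmod z \<le> cmod (lead_V z)"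
        using eventually_at0_norm_less[of 1, OF zero_less_one]
      proof eventually_elim
        case (elim z)
        have "cmod (lead_V 0) / 2 * cmod z \<le> cmod (lead_V 0) / 2 * 1" using elim by (intro mult_left_mono) auto
        then show ?case using elim by simp
      qed
      then show False using no_linear_bound[of "cmod (lead_V 0) / 2"] B0 by simp
    qed
    obtain y where y: "y holomorphic_on ball 0 R" "y 0 = deriv lead_V 0" "\<forall>z. lead_V z = z * y z"
      by (rule holomorphic_quotient[OF lead_V_holo V.R_pos B00])
    have y0: "y 0 = 0"
    proof (rule ccontr)
      assume Y0: "y 0 \<noteq> 0"
      have "((\<lambda>z. cmod (y z)) \<longlongrightarrow> cmod (y 0)) (at 0)"
        by (intro tendsto_norm holomorphic_isCont_0[OF y(1) V.R_pos])
      then have "\<forall>\<^sub>F z in at 0. cmod (y 0) / 2 < cmod (y z)"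
        by (rule order_tendstoD) (use Y0 in simp)
      then have "\<forall>\<^sub>F z in at 0. cmod (y 0) / 2 * cmod z \<le> cmod (lead_V z)"
      proof eventually_elim
        case (elim z)
        then show ?case using mult_right_mono[of "cmod (y 0) / 2" "cmod (y z)" "cmod z"]
          by (simp add: y(3) norm_mult mult.commute)
      qed
      then show False using no_linear_bound[of "cmod (y 0) / 2"] Y0 by simp
    qed
    have yz: "y z \<noteq> 0" using nz y(3) by auto
    obtain k c C r where kc: "0 < k" "0 < c" "0 < r" "r \<le> R"
      "\<forall>z. cmod z < r \<longrightarrow> cmod (y z) \<le> C * cmod z ^ k"
      "\<forall>x \<kappa>. 0 < x \<and> x < r \<longrightarrow> (\<exists>z. cmod z = x \<and> c * cmod \<kappa> * x ^ k \<le> Re (\<kappa> * y z))"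
      by (rule holomorphic_direction[OF y(1) V.R_pos y0 z yz])
    have "dominated (\<lambda>z. Re (Y z)) (\<lambda>z. cmod z ^ Suc k)"
      using flat_wrtD[OF s(4), of "Suc k"] by simp
    then obtain D r1 where D: "D > 0" "r1 > 0"
      "\<forall>z. z \<noteq> 0 \<and> cmod z < r1 \<longrightarrow> norm (Re (Y z)) \<le> D * \<bar>cmod z ^ Suc k\<bar>"
      by (rule dominated_radius)
    have r': "0 < Min {r, r1, 1}" using kc D by simp
    have "\<forall>\<^sub>F z in at (0::complex). \<bar>G' (cmod z) / g z\<bar> * cmod z \<le> 2 * D / c"
      using eventually_at0_norm_less[OF r']
    proof eventually_elim
      case (elim z)
      define x where "x = cmod z"
      have x: "0 < x" "x < r" "x < r1" "x < 1" using elim by (auto simp: x_def)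
      define \<kappa>' where "\<kappa>' = \<kappa> z * e z * of_real x"
      obtain z' where z': "cmod z' = x" "c * cmod \<kappa>' * x ^ k \<le> Re (\<kappa>' * y z')"
        using kc(6) x by blast
      have same: "\<kappa> z' = \<kappa> z" "e z' = e z" using z'(1) by (simp_all add: \<kappa>_def p_def e_def x_def)
      have z'0: "z' \<noteq> 0" using z' x by auto
      have "z' * cnj z' = of_real x * of_real x"
        using complex_norm_square[of z'] z'(1) by (simp add: power2_eq_square)
      note zz = this
      have "Y z' = \<kappa> z * (e z * (of_real x * of_real x) * y z' / of_real x) / 2"
      proof -
        have "e z * (z' * y z') * cnj z' = e z * (z' * cnj z') * y z'" by (simp only: mult_ac)
        then show ?thesis unfolding Y_def same y(3)[rule_format] z'(1) zz by (simp only:)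
      qed
      also have "\<dots> = \<kappa>' * y z' / 2" using x by (simp add: \<kappa>'_def)
      finally have "2 * Y z' = \<kappa>' * y z'" by (simp only:) simp
      moreover have "Re (2 * Y z') = 2 * Re (Y z')" by simp
      ultimately have "Re (\<kappa>' * y z') = 2 * Re (Y z')" by (simp only:)
      moreover have "\<bar>Re (Y z')\<bar> \<le> D * x ^ Suc k"
        using D(3)[rule_format, of z'] z'(1) z'0 x by (simp del: power_Suc)
      ultimately have "c * cmod \<kappa>' * x ^ k \<le> 2 * (D * x ^ Suc k)" using z'(2) by linarith
      moreover have "cmod \<kappa>' = cmod (\<kappa> z) * x" using x by (simp add: \<kappa>'_def norm_mult cmod_e)
      ultimately have "(c * cmod (\<kappa> z)) * x ^ Suc k \<le> (2 * D) * x ^ Suc k"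
        by (simp only: power_Suc mult_ac)
      then have "c * cmod (\<kappa> z) \<le> 2 * D" using x by simp
      then have "cmod (\<kappa> z) \<le> 2 * D / c" using kc(2) by (simp add: pos_le_divide_eq mult.commute)
      moreover have "\<bar>p z\<bar> * x \<le> cmod (\<kappa> z) * 1" using x p_le by (intro mult_mono) auto
      ultimately show ?case by (simp add: p_def x_def)
    qed
    then show False using log_derivative_not_bounded by blast
  qed
  have "lead_U z = 0"
  proof (rule holomorphic_eq_0_if_flat[OF _ U.R_pos _ assms])
    show "lead_U holomorphic_on ball 0 R" unfolding lead_U_def by (rule U.coeff1_holomorphic)
    have ev: "\<forall>\<^sub>F z in at 0. X z = e z * lead_U z \<and> Y z = 0"
      using eventually_at0_norm_less[OF V.R_pos] by eventually_elim (simp add: X_def Y_def lead_V_0)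
    have "flat (\<lambda>z. complex_of_real (Re (X z)) + \<i> * complex_of_real (Im (X z) - s * Im (Y z)))"
      by (intro flat_wrt_add flat_wrt_of_real s flat_wrt_cong[OF flat_wrt_of_real[OF s(5)]])
         (simp add: norm_mult)
    then show "flat lead_U"
    proof (rule flat_wrt_cong, use ev in eventually_elim)
      case (elim z)
      then have "complex_of_real (Re (X z)) + \<i> * complex_of_real (Im (X z) - s * Im (Y z)) = e z * lead_U z"
        by (simp add: complex_eq_iff)
      then show ?case by (simp add: norm_mult cmod_e)
    qed
  qed
  then show ?thesis using lead_V_0[OF assms] by simp
qed

end

theorem rotation:
  "cmod b = 1" "\<And>Z z. Z \<in> ball 0 R \<Longrightarrow> z \<in> ball 0 R \<Longrightarrow> U Z z = Z \<and> V Z z = b * z"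
proof -
  have step: "\<forall>z\<in>ball 0 R. coeff1 V n z = 0 \<and> coeff1 U (Suc n) z = 0" if "n \<ge> 1" for n
    using that
  proof (induction n rule: less_induct)
    case (less n)
    have Ul: "coeff1 U i z = 0" if "2 \<le> i" "i \<le> n" "z \<in> ball 0 R" for i z
      using less.IH[of "i - 1"] that by auto
    have Vl: "coeff1 V i z = 0" if "1 \<le> i" "i < n" "z \<in> ball 0 R" for i z
      using less.IH[of i] that by auto
    show ?case
    proof
      fix z :: complex assume z: "z \<in> ball 0 R"
      have "lead_V n z = 0 \<and> lead_U n z = 0"
        by (rule higher_coefficients_vanish[OF less.prems Ul Vl z])
      moreover have "lead_U n = coeff1 U (Suc n)" by (rule lead_U_def[OF less.prems Ul Vl])
      moreover have "lead_V n z = cnj b * coeff1 V n z" by (rule lead_V_def[OF less.prems Ul Vl])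
      ultimately show "coeff1 V n z = 0 \<and> coeff1 U (Suc n) z = 0" using b_nonzero by simp
    qed
  qed
  show "cmod b = 1" by (rule cmod_b)
  fix Z z :: complex assume Z: "Z \<in> ball 0 R" and z: "z \<in> ball 0 R"
  have "(\<lambda>j. coeff1 U j z * Z ^ j) sums (\<Sum>j\<in>{1}. coeff1 U j z * Z ^ j)"
  proof (rule sums_finite)
    fix j :: nat assume "j \<notin> {1}"
    then consider "j = 0" | i where "j = Suc i" "i \<ge> 1" by (cases j) auto
    then show "coeff1 U j z * Z ^ j = 0"
    proof cases
      case 1
      then show ?thesis using z by (simp add: U.coeff1_0 U0_eq_0)
    next
      case 2
      then show ?thesis using step[of i] z by simp
    qed
  qed simp
  moreover have "(\<lambda>j. coeff1 V j z * Z ^ j) sums (\<Sum>j\<in>{0}. coeff1 V j z * Z ^ j)"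
    by (rule sums_finite) (use step z in auto)
  ultimately show "U Z z = Z \<and> V Z z = b * z"
    using sums_unique2[OF U.coeff1_sums[OF z Z]] sums_unique2[OF V.coeff1_sums[OF z Z]] z
      u_eq_1 V0_linear by (auto simp: V.coeff1_0)
qed

end

section \<open>Holomorphic functions of two variables\<close>

text \<open>Complex differentiability at a point, for one component of a map.\<close>

definition holo2_at :: "(complex \<times> complex \<Rightarrow> complex) \<Rightarrow> complex \<times> complex \<Rightarrow> bool" where
  "holo2_at h x \<longleftrightarrow> (\<exists>L. (h has_derivative L) (at x) \<and> (\<forall>c v w. L (c * v, c * w) = c * L (v, w)))"

lemma holo2_atI:
  "(h has_derivative L) (at x) \<Longrightarrow> (\<And>c v w. L (c * v, c * w) = c * L (v, w)) \<Longrightarrow> holo2_at h x"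
  unfolding holo2_at_def by blast

lemma holo2_at_fst: "holo2_at fst x"
  by (rule holo2_atI[OF has_derivative_fst[OF has_derivative_ident]]) simp

lemma holo2_at_snd: "holo2_at snd x"
  by (rule holo2_atI[OF has_derivative_snd[OF has_derivative_ident]]) simp

lemma holo2_at_const: "holo2_at (\<lambda>_. k) x"
  by (rule holo2_atI[OF has_derivative_const]) simp

lemma holo2_at_mult:
  assumes "holo2_at h x" "holo2_at k x"
  shows "holo2_at (\<lambda>y. h y * k y) x"
proof -
  obtain L M where L: "(h has_derivative L) (at x)" "\<forall>c v w. L (c * v, c * w) = c * L (v, w)"
    and M: "(k has_derivative M) (at x)" "\<forall>c v w. M (c * v, c * w) = c * M (v, w)"
    using assms unfolding holo2_at_def by blast
  show ?thesis
    by (rule holo2_atI[OF has_derivative_mult[OF L(1) M(1)]]) (use L(2) M(2) in \<open>simp add: algebra_simps\<close>)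
qed

lemma holo2_at_compose:
  assumes "holo2_at h x" "k field_differentiable (at (h x))"
  shows "holo2_at (\<lambda>y. k (h y)) x"
proof -
  obtain L where L: "(h has_derivative L) (at x)" "\<forall>c v w. L (c * v, c * w) = c * L (v, w)"
    using assms(1) unfolding holo2_at_def by blast
  obtain D where "(k has_field_derivative D) (at (h x))"
    using assms(2) unfolding field_differentiable_def by blast
  then have "(k has_derivative (*) D) (at (h x))" by (simp add: has_field_derivative_def)
  from diff_chain_at[OF L(1) this] have "((\<lambda>y. k (h y)) has_derivative (\<lambda>v. D * L v)) (at x)"
    by (simp add: o_def)
  then show ?thesis by (rule holo2_atI) (use L(2) in simp)
qed

lemma holo2_at_compose2:
  assumes "holo2_at f1 x" "holo2_at f2 x" "holo2_at h (f1 x, f2 x)"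
  shows "holo2_at (\<lambda>y. h (f1 y, f2 y)) x"
proof -
  obtain L1 L2 M where L: "(f1 has_derivative L1) (at x)" "\<forall>c v w. L1 (c * v, c * w) = c * L1 (v, w)"
      "(f2 has_derivative L2) (at x)" "\<forall>c v w. L2 (c * v, c * w) = c * L2 (v, w)"
      "(h has_derivative M) (at (f1 x, f2 x))" "\<forall>c v w. M (c * v, c * w) = c * M (v, w)"
    using assms unfolding holo2_at_def by blast
  have "((\<lambda>y. (f1 y, f2 y)) has_derivative (\<lambda>v. (L1 v, L2 v))) (at x)"
    by (rule has_derivative_Pair[OF L(1,3)])
  from diff_chain_at[OF this L(5)] have "((\<lambda>y. h (f1 y, f2 y)) has_derivative (\<lambda>v. M (L1 v, L2 v))) (at x)"
    by (simp add: o_def)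
  then show ?thesis by (rule holo2_atI) (use L in simp)
qed

lemma holo2_at_comp:
  assumes "holo2_at (\<lambda>y. fst (f y)) x" "holo2_at (\<lambda>y. snd (f y)) x" "holo2_at h (f x)"
  shows "holo2_at (\<lambda>y. h (f y)) x"
  using holo2_at_compose2[of "\<lambda>y. fst (f y)" x "\<lambda>y. snd (f y)" h] assms by simp

lemma holo2_at_isCont: "holo2_at h x \<Longrightarrow> isCont h x"
  unfolding holo2_at_def using has_derivative_continuous by blast

lemma holo2_at_cong:
  assumes "holo2_at h x" "\<forall>\<^sub>F y in nhds x. k y = h y"
  shows "holo2_at k x"
proof -
  obtain L where L: "(h has_derivative L) (at x)" "\<forall>c v w. L (c * v, c * w) = c * L (v, w)"
    using assms(1) unfolding holo2_at_def by blast
  have "(k has_derivative L) (at x)"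
  proof (rule has_derivative_transform_eventually[OF L(1)])
    show "\<forall>\<^sub>F y in at x. h y = k y"
      unfolding eventually_at_filter using assms(2) by eventually_elim simp
    show "h x = k x" using eventually_nhds_x_imp_x[OF assms(2)] by simp
  qed simp
  then show ?thesis by (rule holo2_atI) (use L(2) in simp)
qed

lemma holomorphic2_on_iff_holo2_at:
  "holomorphic2_on f S \<longleftrightarrow> (\<forall>x\<in>S. holo2_at (\<lambda>y. fst (f y)) x \<and> holo2_at (\<lambda>y. snd (f y)) x)"
proof (intro iffI ballI)
  fix x assume "holomorphic2_on f S" "x \<in> S"
  then obtain L where L: "(f has_derivative L) (at x)"
    "\<forall>c v w. L (c * v, c * w) = (c * fst (L (v, w)), c * snd (L (v, w)))"
    unfolding holomorphic2_on_def by blast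
  show "holo2_at (\<lambda>y. fst (f y)) x \<and> holo2_at (\<lambda>y. snd (f y)) x"
    by (intro conjI holo2_atI[OF has_derivative_fst[OF L(1)]] holo2_atI[OF has_derivative_snd[OF L(1)]])
       (use L(2) in simp)+
next
  assume *: "\<forall>x\<in>S. holo2_at (\<lambda>y. fst (f y)) x \<and> holo2_at (\<lambda>y. snd (f y)) x"
  show "holomorphic2_on f S"
    unfolding holomorphic2_on_def
  proof
    fix x assume "x \<in> S"
    with * obtain L1 L2 where L: "((\<lambda>y. fst (f y)) has_derivative L1) (at x)"
      "\<forall>c v w. L1 (c * v, c * w) = c * L1 (v, w)"
      "((\<lambda>y. snd (f y)) has_derivative L2) (at x)" "\<forall>c v w. L2 (c * v, c * w) = c * L2 (v, w)"
      unfolding holo2_at_def by blast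
    have "(f has_derivative (\<lambda>v. (L1 v, L2 v))) (at x)"
      using has_derivative_Pair[OF L(1,3)] by simp
    then show "\<exists>L. (f has_derivative L) (at x) \<and>
        (\<forall>c v w. L (c * v, c * w) = (c * fst (L (v, w)), c * snd (L (v, w))))"
      by (intro exI[of _ "\<lambda>v. (L1 v, L2 v)"]) (use L in simp)
  qed
qed

lemma holo2_at_slices:
  assumes "(h has_derivative L) (at (Z, z))" "\<forall>c v w. L (c * v, c * w) = c * L (v, w)"
  shows "((\<lambda>Z. h (Z, z)) has_field_derivative L (1, 0)) (at Z)"
    and "((\<lambda>z. h (Z, z)) has_field_derivative L (0, 1)) (at z)"
proof -
  have "((\<lambda>Z. (Z, z)) has_derivative (\<lambda>v. (v, 0))) (at Z)"
    by (auto intro!: derivative_eq_intros)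
  from diff_chain_at[OF this assms(1)] have "((\<lambda>Z. h (Z, z)) has_derivative (\<lambda>v. L (v, 0))) (at Z)"
    by (simp add: o_def)
  moreover have "(\<lambda>v. L (v, 0)) = (*) (L (1, 0))"
  proof
    fix v
    have "L (v * 1, v * 0) = v * L (1, 0)" by (rule assms(2)[rule_format])
    then show "L (v, 0) = L (1, 0) * v" unfolding mult_1_right mult_zero_right mult.commute[of v "L (1, 0)"] .
  qed
  ultimately show "((\<lambda>Z. h (Z, z)) has_field_derivative L (1, 0)) (at Z)"
    by (simp add: has_field_derivative_def)
  have "((\<lambda>z. (Z, z)) has_derivative (\<lambda>v. (0, v))) (at z)"
    by (auto intro!: derivative_eq_intros)
  from diff_chain_at[OF this assms(1)] have "((\<lambda>z. h (Z, z)) has_derivative (\<lambda>v. L (0, v))) (at z)"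
    by (simp add: o_def)
  moreover have "(\<lambda>v. L (0, v)) = (*) (L (0, 1))"
  proof
    fix v
    have "L (v * 0, v * 1) = v * L (0, 1)" by (rule assms(2)[rule_format])
    then show "L (0, v) = L (0, 1) * v" unfolding mult_1_right mult_zero_right mult.commute[of v "L (0, 1)"] .
  qed
  ultimately show "((\<lambda>z. h (Z, z)) has_field_derivative L (0, 1)) (at z)"
    by (simp add: has_field_derivative_def)
qed

lemma holo2_at_holomorphic_slices:
  assumes "\<And>Z z. Z \<in> S \<Longrightarrow> z \<in> T \<Longrightarrow> holo2_at h (Z, z)"
  shows "z \<in> T \<Longrightarrow> (\<lambda>Z. h (Z, z)) holomorphic_on S" "Z \<in> S \<Longrightarrow> (\<lambda>z. h (Z, z)) holomorphic_on T"
proof -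
  have *: "(\<lambda>Z. h (Z, z)) field_differentiable (at Z) \<and> (\<lambda>z. h (Z, z)) field_differentiable (at z)"
    if "Z \<in> S" "z \<in> T" for Z z
    using assms[OF that] holo2_at_slices unfolding holo2_at_def field_differentiable_def by metis
  show "z \<in> T \<Longrightarrow> (\<lambda>Z. h (Z, z)) holomorphic_on S" "Z \<in> S \<Longrightarrow> (\<lambda>z. h (Z, z)) holomorphic_on T"
    unfolding holomorphic_on_def using * field_differentiable_at_within by blast+
qed

lemma eventually_polydisc:
  assumes "\<forall>\<^sub>F x in nhds (0::complex \<times> complex). P x"
  obtains r where "r > 0" "\<forall>Z\<in>ball 0 r. \<forall>z\<in>ball 0 r. P (Z, z)"
proof -
  obtain d where d: "d > 0" "\<forall>x::complex \<times> complex. dist x 0 < d \<longrightarrow> P x"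
    using assms unfolding eventually_nhds_metric by (elim exE conjE)
  have "P (Z, z)" if "Z \<in> ball 0 (d / 2)" "z \<in> ball 0 (d / 2)" for Z z
  proof -
    have "norm (Z, z) \<le> norm Z + norm z" by (rule norm_Pair_le)
    also have "\<dots> < d" using that by simp
    finally show ?thesis using d(2) by simp
  qed
  then show ?thesis using that[of "d / 2"] d(1) by simp
qed

section \<open>Profiles from smooth data\<close>

lemma partials_open_cong:
  assumes "open S" "x \<in> S"
  shows "partials UNIV vs f x = partials S vs f x"
  using assms(2)
proof (induction vs arbitrary: x)
  case (Cons v vs)
  have "(partials UNIV vs f has_derivative L) (at x) \<longleftrightarrow> (partials S vs f has_derivative L) (at x)" for L
    by (intro iffI; erule has_derivative_transform_within_open[OF _ assms(1) Cons.prems]) (simp_all add: Cons.IH)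
  then show ?case
    using at_within_open[OF Cons.prems assms(1)] by (simp add: frechet_derivative_def)
qed simp

text \<open>Smoothness in the plane enters only through the derivatives along the real axis, which determine a
  radial function.\<close>

lemma partials_radial_deriv:
  fixes f :: "complex \<Rightarrow> real"
  assumes "smooth_on (ball 0 e) f" "\<bar>x\<bar> < e"
  shows "((\<lambda>x. partials (ball 0 e) (replicate k 1) f (of_real x)) has_real_derivative
      partials (ball 0 e) (replicate (Suc k) 1) f (of_real x)) (at x)"
proof -
  let ?h = "partials (ball 0 e) (replicate k 1) f"
  have x: "complex_of_real x \<in> ball 0 e" using assms(2) by simp
  have "replicate k (1::complex) \<in> lists Basis" by (auto simp: Basis_complex_def)
  then have "?h differentiable_on ball 0 e" using assms(1) unfolding smooth_on_def by blast
  then have "?h differentiable (at (of_real x) within ball 0 e)" using x unfolding differentiable_on_def by blast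
  then have d: "(?h has_derivative frechet_derivative ?h (at (of_real x) within ball 0 e)) (at (of_real x))"
    unfolding frechet_derivative_works using at_within_open[OF x open_ball] by simp
  have "(complex_of_real has_derivative complex_of_real) (at x)"
    by (rule bounded_linear_imp_has_derivative[OF bounded_linear_of_real])
  from diff_chain_at[OF this d]
  have c: "((\<lambda>x. ?h (of_real x)) has_derivative
      (\<lambda>t. frechet_derivative ?h (at (of_real x) within ball 0 e) (of_real t))) (at x)"
    by (simp add: o_def)
  have "frechet_derivative ?h (at (of_real x) within ball 0 e) (of_real t)
      = frechet_derivative ?h (at (of_real x) within ball 0 e) 1 * t" for t
    using linear_scale[OF has_derivative_linear[OF d], of t 1] by (simp add: scaleR_conv_of_real)
  with c show ?thesis by (simp add: has_field_derivative_def)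
qed

text \<open>Integrating \<open>N\<close> times from zero turns boundedness of a high derivative into the bound.\<close>

lemma flat_sequence_bound:
  fixes D :: "nat \<Rightarrow> real \<Rightarrow> real"
  assumes e: "e > 0" and d: "\<And>k x. \<bar>x\<bar> < e \<Longrightarrow> (D k has_real_derivative D (Suc k) x) (at x)"
    and z: "\<And>k. D k 0 = 0"
  shows "\<exists>C r. r > 0 \<and> (\<forall>x. 0 \<le> x \<and> x < r \<longrightarrow> \<bar>D k x\<bar> \<le> C * x ^ N)"
proof (induction N arbitrary: k)
  case 0
  have "isCont (D k) 0" using DERIV_isCont[OF d[of 0 k]] e by simp
  then have "\<exists>s>0. \<forall>x. dist x 0 < s \<longrightarrow> dist (D k x) (D k 0) < 1"
    unfolding continuous_at_eps_delta by simp
  then obtain s where s: "s > 0" "\<forall>x. dist x 0 < s \<longrightarrow> dist (D k x) (D k 0) < 1" by blast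
  have "\<bar>D k x\<bar> \<le> 1 * x ^ 0" if "0 \<le> x \<and> x < s" for x
    using s(2)[rule_format, of x] that z[of k] by (simp add: dist_real_def)
  then show ?case using s(1) by blast
next
  case (Suc N)
  obtain C r where C: "r > 0" "\<forall>x. 0 \<le> x \<and> x < r \<longrightarrow> \<bar>D (Suc k) x\<bar> \<le> C * x ^ N"
    using Suc.IH[of "Suc k"] by blast
  have "\<bar>D k x\<bar> \<le> \<bar>C\<bar> * x ^ Suc N" if x: "0 \<le> x \<and> x < min r e" for x
  proof -
    have "norm (D k x - D k 0) \<le> (\<bar>C\<bar> * x ^ N) * norm (x - 0)"
    proof (rule field_differentiable_bound[of "{0..x}" _ "D (Suc k)"])
      fix y assume y: "y \<in> {0..x}"
      show "(D k has_field_derivative D (Suc k) y) (at y within {0..x})"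
        by (rule has_field_derivative_at_within[OF d]) (use x y in auto)
      have "\<bar>D (Suc k) y\<bar> \<le> C * y ^ N" using C(2) x y by auto
      also have "\<dots> \<le> \<bar>C\<bar> * y ^ N" using y by (intro mult_right_mono) auto
      also have "\<dots> \<le> \<bar>C\<bar> * x ^ N" using y by (intro mult_left_mono power_mono) auto
      finally show "norm (D (Suc k) y) \<le> \<bar>C\<bar> * x ^ N" by simp
    qed (use x in auto)
    then show ?thesis using x z[of k] by (simp add: mult_ac)
  qed
  then show ?case using C(1) e by (intro exI[of _ "min r e"] exI[of _ "\<bar>C\<bar>"]) auto
qed

lemma smooth_on_interval_deriv:
  fixes q :: "real \<Rightarrow> real"
  assumes "smooth_on {0..<e} q" "x \<in> {0..<e}"
  shows "(partials {0..<e} (replicate k 1) q has_real_derivative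
      partials {0..<e} (replicate (Suc k) 1) q x) (at x within {0..<e})"
proof -
  let ?h = "partials {0..<e} (replicate k 1) q"
  have "replicate k (1::real) \<in> lists Basis" by auto
  then have "?h differentiable_on {0..<e}" using assms(1) unfolding smooth_on_def by blast
  then have "?h differentiable (at x within {0..<e})" using assms(2) unfolding differentiable_on_def by blast
  then have d: "(?h has_derivative frechet_derivative ?h (at x within {0..<e})) (at x within {0..<e})"
    unfolding frechet_derivative_works .
  have "frechet_derivative ?h (at x within {0..<e}) t = frechet_derivative ?h (at x within {0..<e}) 1 * t" for t
    using linear_scale[OF has_derivative_linear[OF d], of t 1] by simp
  then have "frechet_derivative ?h (at x within {0..<e}) = (*) (frechet_derivative ?h (at x within {0..<e}) 1)"
    by (intro ext)
  with d show ?thesis by (simp add: has_field_derivative_def)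
qed

lemma flat_profile_of_smooth:
  fixes p q :: "real \<Rightarrow> real"
  assumes e: "e > 0" and q: "smooth_on {0..<e} q" "q 0 = 0"
    and p: "smooth_on (ball 0 e) (flat_fun p)" "vanishes_to_infinite_order (flat_fun p) 0"
  obtains G' G'' q' q'' where
    "flat_profile (\<lambda>x. flat_fun p (of_real x)) G' G'' q q' q'' e"
proof -
  define D where "D k x = partials (ball 0 e) (replicate k 1) (flat_fun p) (of_real x)" for k x
  define Q where "Q k = partials {0..<e} (replicate k 1) q" for k
  have D: "(D k has_real_derivative D (Suc k) x) (at x)" if "\<bar>x\<bar> < e" for k x
    unfolding D_def by (rule partials_radial_deriv[OF p(1) that])
  have D0: "D k 0 = 0" for k
  proof -
    have "replicate k (1::complex) \<in> lists Basis" by (auto simp: Basis_complex_def)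
    then have "partials UNIV (replicate k 1) (flat_fun p) 0 = 0"
      using p(2) unfolding vanishes_to_infinite_order_def by blast
    moreover have "partials UNIV (replicate k 1) (flat_fun p) 0 = partials (ball 0 e) (replicate k 1) (flat_fun p) 0"
      by (rule partials_open_cong) (use e in auto)
    ultimately show ?thesis by (simp add: D_def)
  qed
  have Q: "(Q k has_real_derivative Q (Suc k) x) (at x within {0..<e})" if "x \<in> {0..<e}" for k x
    unfolding Q_def by (rule smooth_on_interval_deriv[OF q(1) that])
  have D_0: "D 0 = (\<lambda>x. flat_fun p (of_real x))" by (simp add: D_def fun_eq_iff)
  have Q_0: "Q 0 = q" by (simp add: Q_def)
  have Qb: "\<exists>C r. r > 0 \<and> (\<forall>x. 0 \<le> x \<and> x < r \<longrightarrow> \<bar>Q 2 x\<bar> \<le> C)"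
  proof -
    have "continuous (at 0 within {0..<e}) (Q 2)"
      by (rule DERIV_continuous[OF Q]) (use e in simp)
    then obtain s where s: "s > 0" "\<forall>x\<in>{0..<e}. dist x 0 < s \<longrightarrow> dist (Q 2 x) (Q 2 0) < 1"
      unfolding continuous_within_eps_delta by (metis zero_less_one)
    have "\<bar>Q 2 x\<bar> \<le> \<bar>Q 2 0\<bar> + 1" if "0 \<le> x \<and> x < min s e" for x
      using s(2)[rule_format, of x] that by (simp add: dist_real_def)
    then show ?thesis using s(1) e by (intro exI[of _ "min s e"] exI[of _ "\<bar>Q 2 0\<bar> + 1"]) auto
  qed
  have "flat_profile (D 0) (D 1) (D 2) (Q 0) (Q 1) (Q 2) e"
  proof
    show "\<exists>C r. r > 0 \<and> (\<forall>x. 0 \<le> x \<and> x < r \<longrightarrow> \<bar>D 2 x\<bar> \<le> C * x ^ N)" for N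
      by (rule flat_sequence_bound[where D = D, OF e D D0])
    show "(D 0 has_real_derivative D 1 x) (at x within {0..<e})" if "x \<in> {0..<e}" for x
      using has_field_derivative_at_within[OF D[of x 0]] that by simp
    show "(D 1 has_real_derivative D 2 x) (at x within {0..<e})" if "x \<in> {0..<e}" for x
      using has_field_derivative_at_within[OF D[of x 1]] that by (simp add: numeral_2_eq_2)
    show "(Q 0 has_real_derivative Q 1 x) (at x within {0..<e})" if "x \<in> {0..<e}" for x
      using Q[OF that, of 0] by simp
    show "(Q 1 has_real_derivative Q 2 x) (at x within {0..<e})" if "x \<in> {0..<e}" for x
      using Q[OF that, of 1] by (simp add: numeral_2_eq_2)
    show "0 < D 0 x" if "0 < x" "x < e" for x
      using that by (simp add: D_0 flat_fun_def)
  qed (use e D0 Qb q(2) in \<open>simp_all add: Q_0\<close>)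
  then show ?thesis unfolding D_0 Q_0 by (rule that)
qed

section \<open>Straightening coordinates\<close>

text \<open>The first component of the straightening map, before the factor \<open>exp (\<i> * antideriv z2)\<close>. The value
  at \<open>\<alpha> = 0\<close> is the limit as \<open>\<alpha>\<close> tends to \<open>0\<close>.\<close>

definition rectify :: "real \<Rightarrow> complex \<Rightarrow> complex" where
  "rectify \<alpha> z = (if \<alpha> = 0 then - z else (exp (- (of_real \<alpha> * z)) - 1) / of_real \<alpha>)"

definition unrectify :: "real \<Rightarrow> complex \<Rightarrow> complex" where
  "unrectify \<alpha> Z = (if \<alpha> = 0 then - Z else - (1 / of_real \<alpha>) * Ln (1 + of_real \<alpha> * Z))"

lemma rectify_0 [simp]: "rectify \<alpha> 0 = 0" and unrectify_0 [simp]: "unrectify \<alpha> 0 = 0"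
  by (simp_all add: rectify_def unrectify_def)

lemma one_plus_small:
  assumes "cmod (of_real \<alpha> * Z) < 1"
  shows "0 < Re (1 + of_real \<alpha> * Z)" "1 + of_real \<alpha> * Z \<noteq> 0" "1 + of_real \<alpha> * Z \<notin> \<real>\<^sub>\<le>\<^sub>0"
proof -
  show 1: "0 < Re (1 + of_real \<alpha> * Z)"
    using abs_Re_le_cmod[of "of_real \<alpha> * Z"] assms by simp
  then show "1 + of_real \<alpha> * Z \<noteq> 0" by force
  show "1 + of_real \<alpha> * Z \<notin> \<real>\<^sub>\<le>\<^sub>0" using 1 complex_nonpos_Reals_iff by force
qed

lemma rectify_differentiable: "rectify \<alpha> field_differentiable (at z)"
proof (cases "\<alpha> = 0")
  case True
  have "(\<lambda>z. - z) field_differentiable (at z)"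
    by (intro field_differentiable_minus field_differentiable_ident)
  then show ?thesis using True by (simp add: rectify_def[abs_def])
next
  case False
  have "(\<lambda>z. (exp (- (of_real \<alpha> * z)) - 1) / of_real \<alpha>) holomorphic_on UNIV"
    by (intro holomorphic_intros) (use False in auto)
  then show ?thesis using False by (simp add: rectify_def[abs_def] holomorphic_on_def)
qed

lemma unrectify_differentiable:
  assumes "cmod (of_real \<alpha> * Z) < 1"
  shows "unrectify \<alpha> field_differentiable (at Z)"
proof (cases "\<alpha> = 0")
  case True
  have "(\<lambda>z. - z) field_differentiable (at Z)"
    by (intro field_differentiable_minus field_differentiable_ident)
  then show ?thesis using True by (simp add: unrectify_def[abs_def])
next
  case False
  have "((\<lambda>Z. - (1 / of_real \<alpha>) * Ln (1 + of_real \<alpha> * Z)) has_field_derivative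
      - (1 / of_real \<alpha>) * (1 / (1 + of_real \<alpha> * Z) * of_real \<alpha>)) (at Z)"
    using one_plus_small(3)[OF assms] by (auto intro!: derivative_eq_intros simp: divide_inverse)
  then show ?thesis using False unfolding field_differentiable_def by (auto simp: unrectify_def[abs_def])
qed

lemma unrectify_rectify:
  assumes "\<bar>\<alpha> * Im z\<bar> < pi"
  shows "unrectify \<alpha> (rectify \<alpha> z) = z"
proof (cases "\<alpha> = 0")
  case False
  have "Ln (exp (- (of_real \<alpha> * z))) = - (of_real \<alpha> * z)"
    by (rule Ln_exp) (use assms in auto)
  then show ?thesis using False by (simp add: unrectify_def rectify_def)
qed (simp add: unrectify_def rectify_def)

lemma rectify_unrectify:
  assumes "cmod (of_real \<alpha> * Z) < 1"
  shows "rectify \<alpha> (unrectify \<alpha> Z) = Z"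
  using one_plus_small(2)[OF assms] by (simp add: unrectify_def rectify_def)

text \<open>The principal logarithm of a number in the right half plane has imaginary part below \<open>pi / 2\<close>, so
  \<open>unrectify\<close> ends in the strip on which \<open>rectify\<close> is injective.\<close>

lemma Im_unrectify:
  assumes "cmod (of_real \<alpha> * Z) < 1"
  shows "\<bar>\<alpha> * Im (unrectify \<alpha> Z)\<bar> < pi"
proof (cases "\<alpha> = 0")
  case False
  have "\<bar>Im (Ln (1 + of_real \<alpha> * Z))\<bar> < pi / 2"
    using Re_Ln_pos_lt[OF one_plus_small(2)[OF assms]] one_plus_small(1)[OF assms] by blast
  moreover have "of_real \<alpha> * unrectify \<alpha> Z = - Ln (1 + of_real \<alpha> * Z)" using False by (simp add: unrectify_def)
  then have "\<alpha> * Im (unrectify \<alpha> Z) = - Im (Ln (1 + of_real \<alpha> * Z))"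
    by (metis Im_complex_of_real Re_complex_of_real add.right_neutral mult_zero_left times_complex.sel(2) uminus_complex.sel(2))
  ultimately show ?thesis using pi_gt_zero by simp
qed simp

lemma isCont_nhds: "isCont f x \<Longrightarrow> (f \<longlongrightarrow> f x) (nhds x)"
  by (simp add: isCont_def tendsto_at_iff_tendsto_nhds)

lemma tendsto_fst_nhds: "(fst \<longlongrightarrow> fst x) (nhds (x :: complex \<times> complex))"
  and tendsto_snd_nhds: "(snd \<longlongrightarrow> snd x) (nhds (x :: complex \<times> complex))"
  by (rule tendsto_fst[OF filterlim_ident] tendsto_snd[OF filterlim_ident])+

lemmas tendsto_coordinates = tendsto_rabs tendsto_mult tendsto_const tendsto_Im tendsto_norm
  tendsto_fst_nhds tendsto_snd_nhds

locale model =
  fixes \<epsilon> \<delta> \<alpha> :: real and a :: "complex \<Rightarrow> complex" and c :: "nat \<Rightarrow> complex" and p q :: "real \<Rightarrow> real"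
  assumes \<epsilon>: "\<epsilon> > 0" and \<delta>: "\<delta> > 0"
    and a_sums: "\<And>z. z \<in> ball 0 \<epsilon> \<Longrightarrow> (\<lambda>n. c (Suc n) * z ^ Suc n) sums a z"
    and q_0: "q 0 = 0" and q_cont: "continuous (at 0 within {0..<\<epsilon>}) q"
    and P1_pos: "\<And>z. z \<in> ball 0 \<epsilon> \<Longrightarrow> 1 + \<alpha> * P1_fun c p q z > 0"
begin

definition antideriv :: "complex \<Rightarrow> complex" where
  "antideriv z = (\<Sum>n. c (Suc n) / of_nat (Suc n) * z ^ Suc n)"

lemma antideriv_derivative:
  assumes "z \<in> ball 0 \<epsilon>"
  obtains D where "(antideriv has_field_derivative D) (at z)" "z * D = a z"
    "summable (\<lambda>n. c (Suc n) / of_nat (Suc n) * z ^ Suc n)"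
proof -
  define d where "d n = c n / of_nat n" for n
  have sm: "summable (\<lambda>n. d n * w ^ n)" if w: "w \<in> ball 0 \<epsilon>" for w
  proof -
    define K where "K = complex_of_real ((cmod w + \<epsilon>) / 2)"
    have "cmod K = (cmod w + \<epsilon>) / 2" unfolding K_def norm_of_real using \<epsilon> norm_ge_zero[of w] by simp
    then have K: "cmod w < cmod K" "K \<in> ball 0 \<epsilon>" using w by auto
    have "summable (\<lambda>n. c (Suc n) * K ^ Suc n)" using a_sums[OF K(2)] by (rule sums_summable)
    then have "summable (\<lambda>n. c n * K ^ n)" by (subst (asm) summable_Suc_iff)
    then have "summable (\<lambda>n. cmod (c n * w ^ n))" by (rule powser_insidea) (rule K(1))
    then show ?thesis
    proof (rule summable_comparison_test')
      show "norm (d n * w ^ n) \<le> cmod (c n * w ^ n)" if "0 \<le> n" for n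
      proof (cases n)
        case (Suc m)
        have "cmod (c n) / real n \<le> cmod (c n) / 1" by (rule divide_left_mono) (use Suc in auto)
        from mult_right_mono[OF this norm_ge_zero[of "w ^ n"]]
        show ?thesis by (simp add: d_def norm_mult norm_divide)
      qed (simp add: d_def)
    qed
  qed
  have Ad: "antideriv w = (\<Sum>n. d n * w ^ n)" if "w \<in> ball 0 \<epsilon>" for w
    using suminf_split_head[OF sm[OF that]] by (simp add: antideriv_def d_def)
  define K where "K = complex_of_real ((cmod z + \<epsilon>) / 2)"
  have "cmod K = (cmod z + \<epsilon>) / 2" unfolding K_def norm_of_real using \<epsilon> norm_ge_zero[of z] by simp
  then have K: "cmod z < cmod K" "K \<in> ball 0 \<epsilon>" using assms by auto
  have "((\<lambda>w. \<Sum>n. d n * w ^ n) has_field_derivative (\<Sum>n. diffs d n * z ^ n)) (at z)"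
    by (rule termdiffs_strong[OF sm[OF K(2)] K(1)])
  then have D: "(antideriv has_field_derivative (\<Sum>n. diffs d n * z ^ n)) (at z)"
    by (rule has_field_derivative_transform_within_open[OF _ open_ball assms]) (simp add: Ad)
  have diffs: "diffs d = (\<lambda>n. c (Suc n))" by (simp add: diffs_def d_def fun_eq_iff del: of_nat_Suc)
  have "z * (\<Sum>n. c (Suc n) * z ^ n) = a z"
  proof (cases "z = 0")
    case True
    have "(\<lambda>n. c (Suc n) * z ^ Suc n) sums 0" using True by simp
    then show ?thesis using sums_unique2[OF a_sums[OF assms]] True by simp
  next
    case False
    have "(\<lambda>n. c (Suc n) * z ^ Suc n * (1 / z)) sums (a z * (1 / z))"
      by (rule sums_mult2[OF a_sums[OF assms]])
    moreover have "c (Suc n) * z ^ Suc n * (1 / z) = c (Suc n) * z ^ n" for n using False by simp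
    ultimately have "(\<lambda>n. c (Suc n) * z ^ n) sums (a z / z)" by simp
    then show ?thesis using False by (simp add: sums_iff)
  qed
  moreover have "summable (\<lambda>n. c (Suc n) / of_nat (Suc n) * z ^ Suc n)"
    using sm[OF assms] by (subst (asm) summable_Suc_iff[symmetric]) (simp add: d_def)
  ultimately show ?thesis using that[OF D] unfolding diffs by blast
qed

lemma antideriv_0 [simp]: "antideriv 0 = 0"
  by (simp add: antideriv_def)

lemma antideriv_differentiable: "z \<in> ball 0 \<epsilon> \<Longrightarrow> antideriv field_differentiable (at z)"
  by (rule antideriv_derivative) (auto simp: field_differentiable_def)

lemma cis_in_ball: "cis t * z \<in> ball 0 \<epsilon> \<longleftrightarrow> z \<in> ball 0 \<epsilon>"
  by (simp add: norm_mult)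

text \<open>Since \<open>z * antideriv' z = a z\<close>, the function \<open>- \<i> * antideriv (z * exp (\<i> * \<tau>))\<close> of \<open>\<tau>\<close> is a primitive of the
  integrand.\<close>

lemma antideriv_integral:
  assumes "z \<in> ball 0 \<epsilon>"
  shows "(LBINT \<tau>=ereal 0..ereal t. a (z * exp (\<i> * of_real \<tau>))) = - \<i> * (antideriv (cis t * z) - antideriv z)"
proof -
  let ?F = "\<lambda>\<tau>. - \<i> * antideriv (z * exp (\<i> * of_real \<tau>))"
  have b: "z * exp (\<i> * of_real \<tau>) \<in> ball 0 \<epsilon>" for \<tau> using assms by (simp add: norm_mult)
  have deriv: "(?F has_vector_derivative a (z * exp (\<i> * of_real \<tau>))) (at \<tau>)" for \<tau> :: real
  proof -
    let ?w = "\<lambda>\<tau>. z * exp (\<i> * \<tau>)"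
    obtain D where D: "(antideriv has_field_derivative D) (at (?w (of_real \<tau>)))" "?w (of_real \<tau>) * D = a (?w (of_real \<tau>))"
      by (rule antideriv_derivative[OF b])
    have w: "(?w has_field_derivative (\<i> * ?w (of_real \<tau>))) (at (of_real \<tau>))"
      by (auto intro!: derivative_eq_intros)
    have "((\<lambda>\<tau>. - \<i> * antideriv (?w \<tau>)) has_field_derivative (- \<i> * (D * (\<i> * ?w (of_real \<tau>))))) (at (of_real \<tau>))"
      by (intro DERIV_cmult DERIV_chain2[OF D(1) w])
    moreover have "- \<i> * (D * (\<i> * ?w (of_real \<tau>))) = a (?w (of_real \<tau>))"
      unfolding D(2)[symmetric] by (simp add: algebra_simps)
    ultimately have "((\<lambda>\<tau>. - \<i> * antideriv (?w \<tau>)) has_field_derivative a (?w (of_real \<tau>))) (at (of_real \<tau>))" by simp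
    then show ?thesis by (rule has_vector_derivative_real_field)
  qed
  have cont: "continuous_on UNIV (\<lambda>\<tau>::real. a (z * exp (\<i> * of_real \<tau>)))"
  proof -
    have "a holomorphic_on ball 0 \<epsilon>"
    proof -
      have "(\<lambda>w. w * deriv antideriv w) holomorphic_on ball 0 \<epsilon>"
        by (intro holomorphic_intros holomorphic_deriv)
           (auto simp: holomorphic_on_def intro!: field_differentiable_at_within antideriv_differentiable)
      then show ?thesis
      proof (rule holomorphic_transform)
        show "w * deriv antideriv w = a w" if "w \<in> ball 0 \<epsilon>" for w
          by (rule antideriv_derivative[OF that]) (simp add: DERIV_imp_deriv)
      qed
    qed
    then have "continuous_on (ball 0 \<epsilon>) a" by (rule holomorphic_on_imp_continuous_on)
    then show ?thesis
      by (rule continuous_on_compose2) (use b in \<open>auto intro!: continuous_intros\<close>)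
  qed
  have "(LBINT \<tau>=ereal 0..ereal t. a (z * exp (\<i> * of_real \<tau>))) = ?F t - ?F 0"
  proof (rule interval_integral_FTC_finite)
    show "continuous_on {min 0 t..max 0 t} (\<lambda>\<tau>. a (z * exp (\<i> * of_real \<tau>)))"
      by (rule continuous_on_subset[OF cont]) simp
    show "(?F has_vector_derivative a (z * exp (\<i> * of_real \<tau>))) (at \<tau> within {min 0 t..max 0 t})" for \<tau>
      by (rule has_vector_derivative_at_within[OF deriv])
  qed
  then show ?thesis by (simp add: cis_conv_exp algebra_simps)
qed

definition Phi :: "complex \<times> complex \<Rightarrow> complex \<times> complex" where
  "Phi x = (rectify \<alpha> (fst x) * exp (\<i> * antideriv (snd x)), snd x)"

definition Psi :: "complex \<times> complex \<Rightarrow> complex \<times> complex" where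
  "Psi x = (unrectify \<alpha> (fst x * exp (- (\<i> * antideriv (snd x)))), snd x)"

text \<open>The rotation by \<open>t\<close>, transported back by \<open>Psi\<close>.\<close>

definition flow :: "real \<Rightarrow> complex \<times> complex \<Rightarrow> complex \<times> complex" where
  "flow t x = (unrectify \<alpha> (rectify \<alpha> (fst x) * exp (\<i> * antideriv (snd x) - \<i> * antideriv (cis t * snd x))), cis t * snd x)"

lemma phi_eq_flow:
  assumes "snd x \<in> ball 0 \<epsilon>"
  shows "phi a \<alpha> t x = flow t x"
proof -
  obtain z1 z2 where x: "x = (z1, z2)" by (cases x)
  have z2: "z2 \<in> ball 0 \<epsilon>" using assms x by simp
  have "exp (LBINT \<tau>=ereal 0..ereal t. a (z2 * exp (\<i> * of_real \<tau>))) = exp (\<i> * antideriv z2 - \<i> * antideriv (cis t * z2))"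
    unfolding antideriv_integral[OF z2] by (simp add: algebra_simps)
  then show ?thesis
    unfolding x phi_def flow_def Let_def
    by (cases "\<alpha> = 0") (simp_all add: unrectify_def rectify_def cis_conv_exp mult_ac)
qed

lemma holo2_at_snd_fun:
  assumes "k field_differentiable (at (snd x))"
  shows "holo2_at (\<lambda>y. k (snd y)) x"
  by (rule holo2_at_compose[OF holo2_at_snd assms])

lemma antideriv_holomorphic: "antideriv holomorphic_on ball 0 \<epsilon>"
  unfolding holomorphic_on_def using antideriv_differentiable field_differentiable_at_within by blast

lemma antideriv_rotated_holomorphic: "(\<lambda>z. antideriv (cis t * z)) holomorphic_on ball 0 \<epsilon>"
proof -
  have "antideriv \<circ> (\<lambda>z. cis t * z) holomorphic_on ball 0 \<epsilon>"
    by (rule holomorphic_on_compose_gen[OF _ antideriv_holomorphic])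
       (auto intro!: holomorphic_intros simp: norm_mult)
  then show ?thesis by (simp add: o_def)
qed

lemma exp_antideriv_differentiable:
  assumes "z \<in> ball 0 \<epsilon>"
  shows "(\<lambda>z. exp (\<i> * antideriv z)) field_differentiable (at z)"
    "(\<lambda>z. exp (- (\<i> * antideriv z))) field_differentiable (at z)"
    "(\<lambda>z. exp (\<i> * antideriv z - \<i> * antideriv (cis t * z))) field_differentiable (at z)"
  by (rule holomorphic_on_imp_differentiable_at[OF _ open_ball assms],
      intro holomorphic_intros antideriv_holomorphic antideriv_rotated_holomorphic)+

lemma holo2_at_Phi:
  assumes "snd x \<in> ball 0 \<epsilon>"
  shows "holo2_at (\<lambda>y. fst (Phi y)) x" "holo2_at (\<lambda>y. snd (Phi y)) x"
  unfolding Phi_def fst_conv snd_conv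
  by (intro holo2_at_mult holo2_at_compose[OF holo2_at_fst rectify_differentiable] holo2_at_snd_fun exp_antideriv_differentiable assms holo2_at_snd)+

lemma holo2_at_Psi:
  assumes "snd x \<in> ball 0 \<epsilon>" "cmod (of_real \<alpha> * (fst x * exp (- (\<i> * antideriv (snd x))))) < 1"
  shows "holo2_at (\<lambda>y. fst (Psi y)) x" "holo2_at (\<lambda>y. snd (Psi y)) x"
proof -
  have "holo2_at (\<lambda>y. fst y * exp (- (\<i> * antideriv (snd y)))) x"
    by (intro holo2_at_mult holo2_at_fst holo2_at_snd_fun exp_antideriv_differentiable assms)
  then show "holo2_at (\<lambda>y. fst (Psi y)) x"
    unfolding Psi_def fst_conv by (rule holo2_at_compose) (rule unrectify_differentiable[OF assms(2)])
  show "holo2_at (\<lambda>y. snd (Psi y)) x" unfolding Psi_def snd_conv by (rule holo2_at_snd)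
qed

lemma Psi_Phi: "\<bar>\<alpha> * Im (fst x)\<bar> < pi \<Longrightarrow> Psi (Phi x) = x"
  by (simp add: Phi_def Psi_def unrectify_rectify mult.assoc flip: exp_add)

lemma Phi_Psi: "cmod (of_real \<alpha> * (fst x * exp (- (\<i> * antideriv (snd x))))) < 1 \<Longrightarrow> Phi (Psi x) = x"
  by (simp add: Phi_def Psi_def rectify_unrectify mult.assoc flip: exp_add)

lemma Phi_0 [simp]: "Phi 0 = 0" and Psi_0 [simp]: "Psi 0 = 0"
  by (simp_all add: Phi_def Psi_def zero_prod_def)

lemma isCont_pair:
  assumes "holo2_at (\<lambda>y. fst (f y)) x" "holo2_at (\<lambda>y. snd (f y)) x"
  shows "filterlim f (nhds (f x)) (nhds x)"
proof -
  have "isCont (\<lambda>y. (fst (f y), snd (f y))) x"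
    by (intro continuous_Pair holo2_at_isCont assms)
  from isCont_nhds[OF this] show ?thesis by simp
qed

lemma Phi_lim: "filterlim Phi (nhds 0) (nhds 0)"
  using isCont_pair[of Phi 0] holo2_at_Phi[of 0] \<epsilon> by simp

lemma Psi_lim: "filterlim Psi (nhds 0) (nhds 0)"
  using isCont_pair[of Psi 0] holo2_at_Psi[of 0] \<epsilon> by simp

lemma eventually_domain:
  "\<forall>\<^sub>F x in nhds 0. snd x \<in> ball 0 \<epsilon> \<and> \<bar>\<alpha> * Im (fst x)\<bar> < pi \<and>
     cmod (of_real \<alpha> * (fst x * exp (- (\<i> * antideriv (snd x))))) < 1"
proof -
  have "holo2_at (\<lambda>y. fst y * exp (- (\<i> * antideriv (snd y)))) 0"
    by (intro holo2_at_mult holo2_at_fst holo2_at_snd_fun exp_antideriv_differentiable) (use \<epsilon> in simp)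
  then have "isCont (\<lambda>y. cmod (of_real \<alpha> * (fst y * exp (- (\<i> * antideriv (snd y)))))) 0"
    by (intro continuous_intros holo2_at_isCont)
  from isCont_nhds[OF this] have 1: "((\<lambda>y. cmod (of_real \<alpha> * (fst y * exp (- (\<i> * antideriv (snd y)))))) \<longlongrightarrow> 0) (nhds 0)"
    by simp
  have "((\<lambda>y::complex \<times> complex. \<bar>\<alpha> * Im (fst y)\<bar>) \<longlongrightarrow> \<bar>\<alpha> * Im (fst (0 :: complex \<times> complex))\<bar>) (nhds 0)"
    by (intro tendsto_coordinates)
  then have 2: "((\<lambda>y::complex \<times> complex. \<bar>\<alpha> * Im (fst y)\<bar>) \<longlongrightarrow> 0) (nhds 0)"
    by simp
  have "isCont (\<lambda>y::complex \<times> complex. cmod (snd y)) 0" by (intro continuous_intros)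
  from isCont_nhds[OF this] have 3: "((\<lambda>y::complex \<times> complex. cmod (snd y)) \<longlongrightarrow> 0) (nhds 0)"
    by simp
  show ?thesis
    using order_tendstoD(2)[OF 1 zero_less_one] order_tendstoD(2)[OF 2 pi_gt_zero] order_tendstoD(2)[OF 3 \<epsilon>]
    by eventually_elim simp
qed

section \<open>The hypersurface in straightened coordinates\<close>

lemma R_fun_eq: "R_fun c q z = q (cmod z) - Re (antideriv z)"
  by (simp add: R_fun_def antideriv_def)

lemma R_tendsto: "((\<lambda>x::complex \<times> complex. R_fun c q (snd x)) \<longlongrightarrow> 0) (nhds 0)"
proof -
  have q: "((\<lambda>x::complex \<times> complex. q (cmod (snd x))) \<longlongrightarrow> 0) (nhds 0)"
  proof (rule tendstoI)
    fix e :: real assume "e > 0"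
    then have "\<exists>d>0. \<forall>x\<in>{0..<\<epsilon>}. dist x 0 < d \<longrightarrow> dist (q x) (q 0) < e"
      by (rule q_cont[unfolded continuous_within_eps_delta, rule_format])
    then obtain d where d: "d > 0" "\<forall>x\<in>{0..<\<epsilon>}. dist x 0 < d \<longrightarrow> dist (q x) (q 0) < e"
      by (elim exE conjE)
    have "((\<lambda>x::complex \<times> complex. cmod (snd x)) \<longlongrightarrow> cmod (snd (0 :: complex \<times> complex))) (nhds 0)"
      by (intro tendsto_coordinates)
    then have "\<forall>\<^sub>F x::complex \<times> complex in nhds 0. cmod (snd x) < min d \<epsilon>"
      by (rule order_tendstoD) (use d(1) \<epsilon> in simp)
    then show "\<forall>\<^sub>F x::complex \<times> complex in nhds 0. dist (q (cmod (snd x))) 0 < e"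
    proof eventually_elim
      case (elim x)
      then show ?case using d(2)[rule_format, of "cmod (snd x)"] by (simp add: q_0 dist_real_def)
    qed
  qed
  have "holo2_at (\<lambda>x. antideriv (snd x)) 0" by (rule holo2_at_snd_fun[OF antideriv_differentiable]) (use \<epsilon> in simp)
  from isCont_nhds[OF holo2_at_isCont[OF this]] have "((\<lambda>x. antideriv (snd x)) \<longlongrightarrow> 0) (nhds (0 :: complex \<times> complex))" by simp
  from tendsto_diff[OF q tendsto_Re[OF this]] show ?thesis by (simp add: R_fun_eq)
qed

text \<open>The term with the logarithm in the definition of \<open>P1_fun\<close> is there to make this product simple.\<close>

lemma P1_cos:
  assumes "z \<in> ball 0 \<epsilon>" "0 < cos (R_fun c q z)"
  shows "P1_fun c p q z * cos (R_fun c q z) = flat_fun p z * exp (Im (antideriv z))"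
proof (cases "z = 0")
  case False
  have sm: "summable (\<lambda>n. c (Suc n) / of_nat (Suc n) * z ^ Suc n)"
    by (rule antideriv_derivative[OF assms(1)]) blast
  have "(\<Sum>n. c (Suc n) / (\<i> * of_nat (Suc n)) * z ^ Suc n) = (\<Sum>n. - \<i> * (c (Suc n) / of_nat (Suc n) * z ^ Suc n))"
    by (rule arg_cong[of _ _ suminf], rule ext) (simp add: field_simps del: of_nat_Suc)
  also have "\<dots> = - \<i> * antideriv z" unfolding antideriv_def by (rule suminf_mult[OF sm])
  finally have "Re (\<Sum>n. c (Suc n) / (\<i> * of_nat (Suc n)) * z ^ Suc n) = Im (antideriv z)" by simp
  then show ?thesis
    using False assms(2) by (simp add: P1_fun_def flat_fun_def exp_diff exp_add del: of_nat_Suc)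
qed (simp add: P1_fun_def flat_fun_def)

text \<open>For \<open>\<alpha> \<noteq> 0\<close>, after multiplication by \<open>\<alpha>\<close> and exponentiation the defining equation reads
  \<open>(1 + \<alpha> * P1) * cos R = exp (- \<alpha> * Re z1) * cos (R + \<alpha> * Im z1)\<close>, and its right-hand side is the real part
  of \<open>exp (- \<alpha> * z1) * cis (- R)\<close>.\<close>

lemma hypersurface_iff:
  assumes z2: "z2 \<in> ball 0 \<epsilon>" and y: "\<bar>Im z1\<bar> < \<delta>"
    and c0: "0 < cos (R_fun c q z2)" and c1: "0 < cos (R_fun c q z2 + \<alpha> * Im z1)"
  shows "(z1, z2) \<in> hypersurface \<epsilon> \<delta> c \<alpha> p q \<longleftrightarrow>
     Re (rectify \<alpha> z1 * cis (- R_fun c q z2)) = flat_fun p z2 * exp (Im (antideriv z2))"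
proof -
  define r where "r = R_fun c q z2"
  define P where "P = P1_fun c p q z2"
  have P: "P * cos r = flat_fun p z2 * exp (Im (antideriv z2))"
    unfolding P_def r_def by (rule P1_cos[OF z2 c0])
  have c0': "0 < cos r" and c1': "0 < cos (r + \<alpha> * Im z1)" using c0 c1 by (simp_all add: r_def)
  have mem: "(z1, z2) \<in> hypersurface \<epsilon> \<delta> c \<alpha> p q \<longleftrightarrow> Re z1 + P_fun c \<alpha> p q z2 + F_fun c \<alpha> q z2 (Im z1) = 0"
    using z2 y by (simp add: hypersurface_def)
  show ?thesis
  proof (cases "\<alpha> = 0")
    case True
    have "Re (rectify \<alpha> z1 * cis (- r)) = - (Re z1 * cos r + Im z1 * sin r)"
      using True by (simp add: rectify_def)
    moreover have "Re z1 + P + tan r * Im z1 = 0 \<longleftrightarrow> (Re z1 + P + tan r * Im z1) * cos r = 0"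
      using c0' by simp
    moreover have "(Re z1 + P + tan r * Im z1) * cos r = Re z1 * cos r + Im z1 * sin r + P * cos r"
      using c0' by (simp add: tan_def field_simps)
    moreover have "Re z1 + P_fun c \<alpha> p q z2 + F_fun c \<alpha> q z2 (Im z1) = Re z1 + P + tan r * Im z1"
      using True by (simp add: P_fun_def F_fun_def P_def r_def)
    ultimately show ?thesis unfolding mem P[symmetric] r_def[symmetric] by (simp only:) linarith
  next
    case False
    have pos: "0 < 1 + \<alpha> * P" unfolding P_def by (rule P1_pos[OF z2])
    define t where "t = cos (r + \<alpha> * Im z1)"
    have t: "0 < t" using c1' by (simp add: t_def)
    have "Re z1 + P_fun c \<alpha> p q z2 + F_fun c \<alpha> q z2 (Im z1)
        = (\<alpha> * Re z1 + ln (1 + \<alpha> * P) - ln (t / cos r)) / \<alpha>"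
      using False t c0' by (simp add: P_fun_def F_fun_def P_def r_def[symmetric] t_def[symmetric] field_simps)
    then have "(z1, z2) \<in> hypersurface \<epsilon> \<delta> c \<alpha> p q \<longleftrightarrow> \<alpha> * Re z1 + ln (1 + \<alpha> * P) = ln (t / cos r)"
      unfolding mem using False by simp
    also have "\<dots> \<longleftrightarrow> exp (\<alpha> * Re z1 + ln (1 + \<alpha> * P)) = exp (ln (t / cos r))" by simp
    also have "\<dots> \<longleftrightarrow> exp (\<alpha> * Re z1) * (1 + \<alpha> * P) = t / cos r"
      using pos t c0' by (simp add: exp_add)
    also have "\<dots> \<longleftrightarrow> (1 + \<alpha> * P) * cos r = exp (- (\<alpha> * Re z1)) * t"
      using c0' by (auto simp: exp_minus field_simps)
    also have "\<dots> \<longleftrightarrow> \<alpha> * (P * cos r) = exp (- (\<alpha> * Re z1)) * t - cos r"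
      by (auto simp: algebra_simps)
    also have "exp (- (\<alpha> * Re z1)) * t - cos r = \<alpha> * Re (rectify \<alpha> z1 * cis (- r))"
    proof -
      have e: "exp (- (of_real \<alpha> * z1)) = of_real (exp (- (\<alpha> * Re z1))) * cis (- (\<alpha> * Im z1))"
        by (subst exp_eq_polar) simp
      have "of_real \<alpha> * (rectify \<alpha> z1 * cis (- r)) = of_real (exp (- (\<alpha> * Re z1))) * (cis (- (\<alpha> * Im z1)) * cis (- r)) - cis (- r)"
      proof -
        have "of_real \<alpha> * (rectify \<alpha> z1 * cis (- r)) = (exp (- (of_real \<alpha> * z1)) - 1) * cis (- r)"
          using False by (simp add: rectify_def)
        then show ?thesis unfolding e by (simp only: left_diff_distrib mult_1 mult.assoc)
      qed
      also have "cis (- (\<alpha> * Im z1)) * cis (- r) = cis (- (r + \<alpha> * Im z1))"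
        by (simp add: cis_mult algebra_simps)
      finally have E: "of_real \<alpha> * (rectify \<alpha> z1 * cis (- r))
        = of_real (exp (- (\<alpha> * Re z1))) * cis (- (r + \<alpha> * Im z1)) - cis (- r)" .
      have "Re (of_real \<alpha> * (rectify \<alpha> z1 * cis (- r))) = exp (- (\<alpha> * Re z1)) * cos (- (r + \<alpha> * Im z1)) - cos (- r)"
        unfolding E by (simp only: minus_complex.sel Re_of_real_mult cis.sel)
      then have "Re (of_real \<alpha> * (rectify \<alpha> z1 * cis (- r))) = exp (- (\<alpha> * Re z1)) * t - cos r"
        unfolding cos_minus t_def .
      then show ?thesis by (simp only: Re_of_real_mult)
    qed
    also have "\<alpha> * (P * cos r) = \<alpha> * Re (rectify \<alpha> z1 * cis (- r)) \<longleftrightarrow> Re (rectify \<alpha> z1 * cis (- r)) = P * cos r"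
      using False by auto
    finally show ?thesis unfolding r_def[symmetric] P[symmetric] .
  qed
qed

text \<open>The factor \<open>exp (\<i> * antideriv z2)\<close> in \<open>Phi\<close> turns the phase \<open>- R\<close> into the radial phase \<open>- q |z2|\<close>.\<close>

lemma straightened:
  "Re (fst (Phi x) * cis (- q (cmod (snd x)))) = exp (- Im (antideriv (snd x))) * Re (rectify \<alpha> (fst x) * cis (- R_fun c q (snd x)))"
proof -
  define w where "w = antideriv (snd x)"
  have "exp (\<i> * w) = of_real (exp (- Im w)) * cis (Re w)"
    by (subst exp_eq_polar) simp
  then have "fst (Phi x) * cis (- q (cmod (snd x)))
      = of_real (exp (- Im w)) * (rectify \<alpha> (fst x) * (cis (Re w) * cis (- q (cmod (snd x)))))"
    unfolding Phi_def fst_conv w_def[symmetric] by (simp only: mult_ac)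
  also have "cis (Re w) * cis (- q (cmod (snd x))) = cis (- R_fun c q (snd x))"
    by (simp add: cis_mult R_fun_eq w_def)
  finally show ?thesis
    unfolding w_def by (simp only: Re_of_real_mult)
qed

lemma membership:
  "\<forall>\<^sub>F x in nhds 0. x \<in> hypersurface \<epsilon> \<delta> c \<alpha> p q \<longleftrightarrow>
     Re (fst (Phi x) * cis (- q (cmod (snd x)))) = flat_fun p (of_real (cmod (snd x)))"
proof -
  have im: "((\<lambda>y::complex \<times> complex. Im (fst y)) \<longlongrightarrow> Im (fst (0 :: complex \<times> complex))) (nhds 0)"
    by (intro tendsto_coordinates)
  then have im0: "((\<lambda>y::complex \<times> complex. \<bar>Im (fst y)\<bar>) \<longlongrightarrow> 0) (nhds 0)"
    using tendsto_rabs_zero by fastforce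
  have "((\<lambda>x. cos (R_fun c q (snd x))) \<longlongrightarrow> cos 0) (nhds (0::complex \<times> complex))"
    by (intro tendsto_cos R_tendsto)
  then have 1: "\<forall>\<^sub>F x::complex \<times> complex in nhds 0. 0 < cos (R_fun c q (snd x))"
    by (rule order_tendstoD) simp
  have "((\<lambda>x. cos (R_fun c q (snd x) + \<alpha> * Im (fst x))) \<longlongrightarrow> cos (0 + \<alpha> * Im (fst (0 :: complex \<times> complex)))) (nhds (0::complex \<times> complex))"
    by (intro tendsto_cos tendsto_add tendsto_mult tendsto_const R_tendsto im)
  then have 2: "\<forall>\<^sub>F x::complex \<times> complex in nhds 0. 0 < cos (R_fun c q (snd x) + \<alpha> * Im (fst x))"
    by (rule order_tendstoD) simp
  show ?thesis
    using eventually_domain order_tendstoD(2)[OF im0 \<delta>] 1 2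
  proof eventually_elim
    case (elim x)
    have "x \<in> hypersurface \<epsilon> \<delta> c \<alpha> p q \<longleftrightarrow>
       Re (rectify \<alpha> (fst x) * cis (- R_fun c q (snd x))) = flat_fun p (snd x) * exp (Im (antideriv (snd x)))"
      using hypersurface_iff[of "snd x" "fst x"] elim by simp
    also have "\<dots> \<longleftrightarrow> exp (- Im (antideriv (snd x))) * Re (rectify \<alpha> (fst x) * cis (- R_fun c q (snd x))) = flat_fun p (snd x)"
      by (auto simp: exp_minus field_simps)
    also have "flat_fun p (snd x) = flat_fun p (of_real (cmod (snd x)))" by (simp add: flat_fun_def)
    finally show ?case unfolding straightened .
  qed
qed

section \<open>The rotations\<close>

text \<open>The last two conditions keep both logarithms, the one in the flow and the one in its inverse, in
  the right half plane. They are exchanged by the flow, so the flow for \<open>t\<close> maps the domain for \<open>t\<close>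
  onto the domain for \<open>- t\<close>.\<close>

definition flow_domain :: "real \<Rightarrow> (complex \<times> complex) set" where
  "flow_domain t = {x. snd x \<in> ball 0 \<epsilon> \<and> \<bar>\<alpha> * Im (fst x)\<bar> < pi \<and>
     cmod (of_real \<alpha> * rectify \<alpha> (fst x)) < 1 \<and>
     cmod (of_real \<alpha> * (rectify \<alpha> (fst x) * exp (\<i> * antideriv (snd x) - \<i> * antideriv (cis t * snd x)))) < 1}"

lemma holo2_at_flow_factor:
  assumes "snd x \<in> ball 0 \<epsilon>"
  shows "holo2_at (\<lambda>y. rectify \<alpha> (fst y) * exp (\<i> * antideriv (snd y) - \<i> * antideriv (cis t * snd y))) x"
  by (intro holo2_at_mult holo2_at_compose[OF holo2_at_fst rectify_differentiable] holo2_at_snd_fun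
        exp_antideriv_differentiable(3) assms)

lemma open_flow_domain: "open (flow_domain t)"
proof -
  have "\<forall>\<^sub>F y in nhds x. y \<in> flow_domain t" if x: "x \<in> flow_domain t" for x
  proof -
    have 1: "((\<lambda>y. cmod (snd y)) \<longlongrightarrow> cmod (snd x)) (nhds x)"
      by (intro tendsto_coordinates)
    have 2: "((\<lambda>y. \<bar>\<alpha> * Im (fst y)\<bar>) \<longlongrightarrow> \<bar>\<alpha> * Im (fst x)\<bar>) (nhds x)"
      by (intro tendsto_coordinates)
    have "holo2_at (\<lambda>y. rectify \<alpha> (fst y)) x" by (rule holo2_at_compose[OF holo2_at_fst rectify_differentiable])
    from isCont_nhds[OF holo2_at_isCont[OF this]]
    have 3: "((\<lambda>y. cmod (of_real \<alpha> * rectify \<alpha> (fst y))) \<longlongrightarrow> cmod (of_real \<alpha> * rectify \<alpha> (fst x))) (nhds x)"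
      by (intro tendsto_intros)
    have "snd x \<in> ball 0 \<epsilon>" using x by (simp add: flow_domain_def)
    note lim = isCont_nhds[OF holo2_at_isCont[OF holo2_at_flow_factor[OF this, of t]]]
    have 4: "((\<lambda>y. cmod (of_real \<alpha> * (rectify \<alpha> (fst y) * exp (\<i> * antideriv (snd y) - \<i> * antideriv (cis t * snd y))))) \<longlongrightarrow>
      cmod (of_real \<alpha> * (rectify \<alpha> (fst x) * exp (\<i> * antideriv (snd x) - \<i> * antideriv (cis t * snd x))))) (nhds x)"
      by (rule tendsto_norm[OF tendsto_mult[OF tendsto_const lim]])
    have "\<forall>\<^sub>F y in nhds x. cmod (snd y) < \<epsilon>" "\<forall>\<^sub>F y in nhds x. \<bar>\<alpha> * Im (fst y)\<bar> < pi"
      "\<forall>\<^sub>F y in nhds x. cmod (of_real \<alpha> * rectify \<alpha> (fst y)) < 1"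
      "\<forall>\<^sub>F y in nhds x. cmod (of_real \<alpha> * (rectify \<alpha> (fst y) * exp (\<i> * antideriv (snd y) - \<i> * antideriv (cis t * snd y)))) < 1"
      using order_tendstoD(2)[OF 1, of \<epsilon>] order_tendstoD(2)[OF 2, of pi] order_tendstoD(2)[OF 3, of 1]
        order_tendstoD(2)[OF 4, of 1] x by (simp_all add: flow_domain_def)
    then show "\<forall>\<^sub>F y in nhds x. y \<in> flow_domain t"
      by eventually_elim (simp add: flow_domain_def)
  qed
  note ev = this
  show ?thesis
  proof (subst open_subopen, rule ballI)
    fix x assume "x \<in> flow_domain t"
    from ev[OF this] obtain T where "open T" "x \<in> T" "\<forall>y\<in>T. y \<in> flow_domain t"
      unfolding eventually_nhds by (elim exE conjE)
    then show "\<exists>T. open T \<and> x \<in> T \<and> T \<subseteq> flow_domain t" by (intro exI[of _ T]) auto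
  qed
qed

lemma flow_inverse:
  assumes "x \<in> flow_domain t"
  shows "flow t x \<in> flow_domain (- t)" "flow (- t) (flow t x) = x"
proof -
  let ?e = "exp (\<i> * antideriv (snd x) - \<i> * antideriv (cis t * snd x))"
  have x: "snd x \<in> ball 0 \<epsilon>" "\<bar>\<alpha> * Im (fst x)\<bar> < pi" "cmod (of_real \<alpha> * rectify \<alpha> (fst x)) < 1"
    "cmod (of_real \<alpha> * (rectify \<alpha> (fst x) * ?e)) < 1"
    using assms by (auto simp: flow_domain_def)
  have s: "snd (flow t x) = cis t * snd x" by (simp add: flow_def)
  have s': "cis (- t) * (cis t * snd x) = snd x" by (simp add: cis_mult flip: mult.assoc)
  have e: "rectify \<alpha> (fst (flow t x)) = rectify \<alpha> (fst x) * ?e"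
    unfolding flow_def fst_conv by (rule rectify_unrectify[OF x(4)])
  have ee: "rectify \<alpha> (fst (flow t x)) * exp (\<i> * antideriv (cis t * snd x) - \<i> * antideriv (snd x)) = rectify \<alpha> (fst x)"
    unfolding e by (simp add: mult.assoc flip: exp_add)
  have im: "\<bar>\<alpha> * Im (fst (flow t x))\<bar> < pi"
    unfolding flow_def fst_conv by (rule Im_unrectify[OF x(4)])
  show "flow t x \<in> flow_domain (- t)"
    unfolding flow_domain_def mem_Collect_eq s s' ee
    using x im by (simp only: e cis_in_ball simp_thms)
  show "flow (- t) (flow t x) = x"
    unfolding flow_def[of "- t"] s s' ee unrectify_rectify[OF x(2)] by simp
qed

lemma flow_holomorphic: "holomorphic2_on (flow t) (flow_domain t)"
  unfolding holomorphic2_on_iff_holo2_at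
proof (intro ballI conjI)
  fix x assume "x \<in> flow_domain t"
  then have x: "snd x \<in> ball 0 \<epsilon>"
    "cmod (of_real \<alpha> * (rectify \<alpha> (fst x) * exp (\<i> * antideriv (snd x) - \<i> * antideriv (cis t * snd x)))) < 1"
    by (auto simp: flow_domain_def)
  show "holo2_at (\<lambda>y. fst (flow t y)) x"
    unfolding flow_def fst_conv
    by (rule holo2_at_compose[OF holo2_at_flow_factor[OF x(1)] unrectify_differentiable[OF x(2)]])
  show "holo2_at (\<lambda>y. snd (flow t y)) x"
    unfolding flow_def snd_conv by (intro holo2_at_mult holo2_at_const holo2_at_snd)
qed

lemma flow_0 [simp]: "flow t 0 = 0"
  by (simp add: flow_def zero_prod_def)

lemma flow_domain_0: "0 \<in> flow_domain t"
  using \<epsilon> by (simp add: flow_domain_def)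

lemma flow_biholomorphic: "biholomorphic2 (flow t) (flow_domain t) (flow_domain (- t))"
proof -
  have inv: "flow (- t) x \<in> flow_domain t \<and> flow t (flow (- t) x) = x" if "x \<in> flow_domain (- t)" for x
    using flow_inverse[OF that] by simp
  have bij: "bij_betw (flow t) (flow_domain t) (flow_domain (- t))"
    by (rule bij_betw_byWitness[where f' = "flow (- t)"]) (use flow_inverse inv in auto)
  have "holomorphic2_on (inv_into (flow_domain t) (flow t)) (flow_domain (- t))"
    unfolding holomorphic2_on_iff_holo2_at
  proof (intro ballI conjI)
    fix x assume x: "x \<in> flow_domain (- t)"
    have "inv_into (flow_domain t) (flow t) y = flow (- t) y" if "y \<in> flow_domain (- t)" for y
      using inv_into_f_eq[OF bij_betw_imp_inj_on[OF bij], of "flow (- t) y" y] inv[OF that] by blast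
    then have ev: "\<forall>\<^sub>F y in nhds x. inv_into (flow_domain t) (flow t) y = flow (- t) y"
      using eventually_nhds_in_open[OF open_flow_domain x] by (auto elim: eventually_mono)
    have "holo2_at (\<lambda>y. fst (flow (- t) y)) x \<and> holo2_at (\<lambda>y. snd (flow (- t) y)) x"
      using flow_holomorphic[of "- t"] x unfolding holomorphic2_on_iff_holo2_at by blast
    note d = this
    show "holo2_at (\<lambda>y. fst (inv_into (flow_domain t) (flow t) y)) x"
      by (rule holo2_at_cong[OF conjunct1[OF d]]) (use ev in eventually_elim, simp)
    show "holo2_at (\<lambda>y. snd (inv_into (flow_domain t) (flow t) y)) x"
      by (rule holo2_at_cong[OF conjunct2[OF d]]) (use ev in eventually_elim, simp)
  qed
  then show ?thesis
    unfolding biholomorphic2_def using open_flow_domain bij flow_holomorphic by blast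
qed

lemma flow_lim: "filterlim (flow t) (nhds 0) (nhds 0)"
  using isCont_pair[of "flow t" 0] flow_holomorphic[of t] flow_domain_0[of t]
  unfolding holomorphic2_on_iff_holo2_at by simp

lemma flow_preserves:
  "\<forall>\<^sub>F x in nhds 0. x \<in> hypersurface \<epsilon> \<delta> c \<alpha> p q \<longrightarrow> flow t x \<in> hypersurface \<epsilon> \<delta> c \<alpha> p q"
proof -
  have "\<forall>\<^sub>F x in nhds 0. x \<in> flow_domain t"
    by (rule eventually_nhds_in_open[OF open_flow_domain flow_domain_0])
  then show ?thesis
    using membership eventually_compose_filterlim[OF membership flow_lim[of t]]
  proof eventually_elim
    case (elim x)
    have "cmod (of_real \<alpha> * (rectify \<alpha> (fst x) * exp (\<i> * antideriv (snd x) - \<i> * antideriv (cis t * snd x)))) < 1"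
      using elim(1) by (simp add: flow_domain_def)
    from rectify_unrectify[OF this] have "fst (Phi (flow t x)) = fst (Phi x)"
      by (simp add: Phi_def flow_def mult.assoc flip: exp_add)
    moreover have "cmod (snd (flow t x)) = cmod (snd x)" by (simp add: flow_def norm_mult)
    ultimately show ?case using elim(2,3) by simp
  qed
qed

lemma germ_eqI: "\<forall>\<^sub>F x in nhds 0. f x = h x \<Longrightarrow> germ f = germ h"
  unfolding germ_def by (auto elim: eventually_elim2)

lemma germ_phi: "germ (phi a \<alpha> t) = germ (flow t)"
proof (rule germ_eqI, use eventually_domain in eventually_elim)
  case (elim x)
  then show ?case using phi_eq_flow by blast
qed

lemma phi_in_stability_group: "germ (phi a \<alpha> t) \<in> stability_group (hypersurface \<epsilon> \<delta> c \<alpha> p q)"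
  unfolding germ_phi stability_group_def
  using flow_biholomorphic[of t] flow_domain_0[of t] flow_0[of t] flow_preserves[of t] by blast

end

section \<open>Every automorphism is a rotation\<close>

text \<open>The derivative of \<open>H\<close> is injective because \<open>K\<close> inverts \<open>H\<close> on the left. If the determinant vanished, the
  vectors \<open>(V_z, - V_Z)\<close> and \<open>(U_z, - U_Z)\<close> would lie in its kernel, where \<open>U\<close> and \<open>V\<close> are the components of \<open>H\<close> and subscripts denote derivatives.\<close>

lemma jacobian_nonzero:
  fixes H K :: "complex \<times> complex \<Rightarrow> complex \<times> complex"
  assumes H: "((\<lambda>x. fst (H x)) has_derivative LU) (at 0)" "\<forall>c v w. LU (c * v, c * w) = c * LU (v, w)"
    "((\<lambda>x. snd (H x)) has_derivative LV) (at 0)" "\<forall>c v w. LV (c * v, c * w) = c * LV (v, w)"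
    and K: "(K has_derivative M) (at (H 0))" and KH: "\<forall>\<^sub>F x in nhds 0. K (H x) = x"
  shows "LU (1, 0) * LV (0, 1) \<noteq> LU (0, 1) * LV (1, 0)"
proof
  assume det: "LU (1, 0) * LV (0, 1) = LU (0, 1) * LV (1, 0)"
  have "(H has_derivative (\<lambda>v. (LU v, LV v))) (at 0)"
    using has_derivative_Pair[OF H(1,3)] by simp
  from diff_chain_at[OF this K] have 1: "((\<lambda>x. K (H x)) has_derivative (\<lambda>v. M (LU v, LV v))) (at 0)"
    by (simp add: o_def)
  have "((\<lambda>x. x) has_derivative (\<lambda>v. M (LU v, LV v))) (at (0 :: complex \<times> complex))"
  proof (rule has_derivative_transform_eventually[OF 1])
    show "\<forall>\<^sub>F x in at 0. K (H x) = x"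
      unfolding eventually_at_filter using KH by eventually_elim simp
    show "K (H 0) = 0" by (rule eventually_nhds_x_imp_x[OF KH])
  qed simp
  then have id: "(\<lambda>v. M (LU v, LV v)) = (\<lambda>v. v)"
    by (rule has_derivative_unique[OF _ has_derivative_ident])
  have M0: "M (0, 0) = 0" using linear_0[OF has_derivative_linear[OF K]] by (simp add: zero_prod_def)
  have inj: "v = 0" if "LU v = 0" "LV v = 0" for v
    using fun_cong[OF id, of v] that M0 by simp
  have split: "L (v, w) = v * L (1, 0) + w * L (0, 1)"
    if "linear L" "\<forall>c v w. L (c * v, c * w) = c * L (v, w)" for L :: "complex \<times> complex \<Rightarrow> complex" and v w
  proof -
    have "L (v, w) = L (v, 0) + L (0, w)" using linear_add[OF that(1), of "(v, 0)" "(0, w)"] by simp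
    also have "L (v, 0) = v * L (1, 0)" using that(2)[rule_format, of v 1 0] by (simp only: mult_1_right mult_zero_right)
    also have "L (0, w) = w * L (0, 1)" using that(2)[rule_format, of w 0 1] by (simp only: mult_1_right mult_zero_right)
    finally show ?thesis .
  qed
  note s1 = split[OF has_derivative_linear[OF H(1)] H(2)] and s2 = split[OF has_derivative_linear[OF H(3)] H(4)]
  have "(LV (0, 1), - LV (1, 0)) = 0"
  proof (rule inj)
    show "LU (LV (0, 1), - LV (1, 0)) = 0" by (subst s1) (use det in \<open>simp add: mult.commute\<close>)
    show "LV (LV (0, 1), - LV (1, 0)) = 0" by (subst s2) (simp add: mult.commute)
  qed
  then have LV: "LV (0, 1) = 0" "LV (1, 0) = 0" by (simp_all add: zero_prod_def)
  have "(LU (0, 1), - LU (1, 0)) = 0"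
  proof (rule inj)
    show "LU (LU (0, 1), - LU (1, 0)) = 0" by (subst s1) (simp add: mult.commute)
    show "LV (LU (0, 1), - LU (1, 0)) = 0" by (subst s2) (simp add: LV)
  qed
  then have "LU (1, 0) = 0" by (simp add: zero_prod_def)
  then have "(1, 0) = (0 :: complex \<times> complex)" using LV by (intro inj)
  then show False by (simp add: zero_prod_def)
qed

context model begin

text \<open>Conjugation with \<open>Phi\<close> gives a local biholomorphism that preserves the model. By \<open>rotation\<close> it is
  \<open>(Z, z) \<mapsto> (Z, b * z)\<close> with \<open>b\<close> unimodular, and \<open>t\<close> is the argument of \<open>b\<close>.\<close>

lemma automorphism_is_rotation:
  assumes prof: "flat_profile (\<lambda>x. flat_fun p (of_real x)) G' G'' q q' q'' \<epsilon>"
    and f: "biholomorphic2 f S T" "0 \<in> S" "f 0 = 0"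
    and pres: "\<forall>\<^sub>F x in nhds 0. x \<in> hypersurface \<epsilon> \<delta> c \<alpha> p q \<longrightarrow> f x \<in> hypersurface \<epsilon> \<delta> c \<alpha> p q"
  shows "\<exists>t. \<forall>\<^sub>F x in nhds 0. f x = phi a \<alpha> t x"
proof -
  define h where "h = inv_into S f"
  have open_S: "open S" and open_T: "open T" and bij: "bij_betw f S T"
    and fholo: "holomorphic2_on f S" and hholo: "holomorphic2_on h T"
    using f(1) unfolding biholomorphic2_def h_def by auto
  have T0: "0 \<in> T" using bij_betwE[OF bij] f(2,3) by force
  have hf: "h (f x) = x" if "x \<in> S" for x
    unfolding h_def by (rule inv_into_f_f[OF bij_betw_imp_inj_on[OF bij] that])
  have h0: "h 0 = 0" using hf[OF f(2)] f(3) by simp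
  have fc: "holo2_at (\<lambda>y. fst (f y)) x" "holo2_at (\<lambda>y. snd (f y)) x" if "x \<in> S" for x
    using fholo that unfolding holomorphic2_on_iff_holo2_at by auto
  have hc: "holo2_at (\<lambda>y. fst (h y)) x" "holo2_at (\<lambda>y. snd (h y)) x" if "x \<in> T" for x
    using hholo that unfolding holomorphic2_on_iff_holo2_at by auto
  have f_lim: "filterlim f (nhds 0) (nhds 0)" using isCont_pair[OF fc[OF f(2)]] f(3) by simp
  have h_lim: "filterlim h (nhds 0) (nhds 0)" using isCont_pair[OF hc[OF T0]] h0 by simp
  note fP_lim = filterlim_compose[OF f_lim Psi_lim]
  define H where "H x = Phi (f (Psi x))" for x
  define K where "K x = Phi (h (Psi x))" for x
  have H_lim: "filterlim H (nhds 0) (nhds 0)"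
    unfolding H_def by (rule filterlim_compose[OF Phi_lim fP_lim])
  have HH: "holo2_at (\<lambda>y. fst (H y)) x \<and> holo2_at (\<lambda>y. snd (H y)) x"
    if "snd x \<in> ball 0 \<epsilon>" "cmod (of_real \<alpha> * (fst x * exp (- (\<i> * antideriv (snd x))))) < 1"
      "Psi x \<in> S" "snd (f (Psi x)) \<in> ball 0 \<epsilon>" for x
  proof -
    have fst: "holo2_at (\<lambda>y. fst (f (Psi y))) x"
      by (rule holo2_at_comp[where f = Psi and h = "\<lambda>y. fst (f y)", OF holo2_at_Psi[OF that(1,2)] fc(1)[OF that(3)]])
    have snd: "holo2_at (\<lambda>y. snd (f (Psi y))) x"
      by (rule holo2_at_comp[where f = Psi and h = "\<lambda>y. snd (f y)", OF holo2_at_Psi[OF that(1,2)] fc(2)[OF that(3)]])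
    show ?thesis
      unfolding H_def
      using holo2_at_comp[where f = "\<lambda>y. f (Psi y)" and h = "\<lambda>y. fst (Phi y)", OF fst snd holo2_at_Phi(1)[OF that(4)]]
        holo2_at_comp[where f = "\<lambda>y. f (Psi y)" and h = "\<lambda>y. snd (Phi y)", OF fst snd holo2_at_Phi(2)[OF that(4)]]
      by (rule conjI)
  qed
  have KK: "holo2_at (\<lambda>y. fst (K y)) 0 \<and> holo2_at (\<lambda>y. snd (K y)) 0"
  proof -
    have P: "holo2_at (\<lambda>y. fst (Psi y)) 0" "holo2_at (\<lambda>y. snd (Psi y)) 0"
      by (rule holo2_at_Psi; use \<epsilon> in simp)+
    have T0': "Psi 0 \<in> T" and "snd (h (Psi 0)) \<in> ball 0 \<epsilon>" using T0 h0 \<epsilon> by simp_all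
    note Phi0 = holo2_at_Phi[OF this(2)]
    have fst: "holo2_at (\<lambda>y. fst (h (Psi y))) 0"
      by (rule holo2_at_comp[where f = Psi and h = "\<lambda>y. fst (h y)", OF P hc(1)[OF T0']])
    have snd: "holo2_at (\<lambda>y. snd (h (Psi y))) 0"
      by (rule holo2_at_comp[where f = Psi and h = "\<lambda>y. snd (h y)", OF P hc(2)[OF T0']])
    show ?thesis
      unfolding K_def
      using holo2_at_comp[where f = "\<lambda>y. h (Psi y)" and h = "\<lambda>y. fst (Phi y)", OF fst snd Phi0(1)]
        holo2_at_comp[where f = "\<lambda>y. h (Psi y)" and h = "\<lambda>y. snd (Phi y)", OF fst snd Phi0(2)]
      by (rule conjI)
  qed
  have in_S: "\<forall>\<^sub>F x in nhds 0. x \<in> S" by (rule eventually_nhds_in_open[OF open_S f(2)])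
  have in_S': "\<forall>\<^sub>F x in nhds 0. Psi x \<in> S"
    by (rule eventually_compose_filterlim[OF in_S Psi_lim])
  have dom': "\<forall>\<^sub>F x in nhds 0. snd (f (Psi x)) \<in> ball 0 \<epsilon> \<and> \<bar>\<alpha> * Im (fst (f (Psi x)))\<bar> < pi"
    using eventually_compose_filterlim[OF eventually_domain fP_lim] by eventually_elim simp
  have ev_c: "\<forall>\<^sub>F x in nhds 0. holo2_at (\<lambda>y. fst (H y)) x \<and> holo2_at (\<lambda>y. snd (H y)) x"
    using eventually_domain in_S' dom' by eventually_elim (rule HH, auto)
  have ev_b: "\<forall>\<^sub>F x in nhds 0. norm (H x) < 1"
    using order_tendstoD(2)[OF tendsto_norm[OF H_lim], of 1] by simp
  let ?I = "\<lambda>x. Re (fst x * cis (- q (cmod (snd x)))) = flat_fun p (of_real (cmod (snd x)))"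
  have ev_i: "\<forall>\<^sub>F x in nhds 0. ?I x \<longrightarrow> ?I (H x)"
    using eventually_compose_filterlim[OF membership Psi_lim]
      eventually_compose_filterlim[OF pres Psi_lim]
      eventually_compose_filterlim[OF membership fP_lim] eventually_domain
  proof eventually_elim
    case (elim x)
    have s: "snd (Phi y) = snd y" "snd (Psi y) = snd y" for y by (simp_all add: Phi_def Psi_def)
    have "Phi (Psi x) = x" using elim(4) by (intro Phi_Psi) simp
    then show ?case using elim(1-3) unfolding H_def s by auto
  qed
  have ev_KH: "\<forall>\<^sub>F x in nhds 0. K (H x) = x"
    using eventually_domain in_S' dom'
  proof eventually_elim
    case (elim x)
    have "Psi (Phi (f (Psi x))) = f (Psi x)" using elim by (intro Psi_Phi) simp
    then show ?case using elim unfolding K_def H_def by (simp add: hf Phi_Psi)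
  qed
  obtain r where r: "r > 0" "\<forall>Z\<in>ball 0 r. \<forall>z\<in>ball 0 r. (holo2_at (\<lambda>y. fst (H y)) (Z, z) \<and> holo2_at (\<lambda>y. snd (H y)) (Z, z))
      \<and> norm (H (Z, z)) < 1 \<and> (?I (Z, z) \<longrightarrow> ?I (H (Z, z)))"
    using eventually_conj[OF ev_c eventually_conj[OF ev_b ev_i]] by (rule eventually_polydisc)
  define U where "U Z z = fst (H (Z, z))" for Z z
  define V where "V Z z = snd (H (Z, z))" for Z z
  have H0: "H 0 = 0" by (simp add: H_def f(3))
  then have UV0: "U 0 0 = 0" "V 0 0 = 0" by (simp_all add: U_def V_def flip: zero_prod_def)
  have U_holo: "z \<in> ball 0 r \<Longrightarrow> (\<lambda>Z. U Z z) holomorphic_on ball 0 r"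
    "Z \<in> ball 0 r \<Longrightarrow> U Z holomorphic_on ball 0 r" for Z z
    unfolding U_def by (rule holo2_at_holomorphic_slices[of "ball 0 r" "ball 0 r"]; use r(2) in blast)+
  have V_holo: "z \<in> ball 0 r \<Longrightarrow> (\<lambda>Z. V Z z) holomorphic_on ball 0 r"
    "Z \<in> ball 0 r \<Longrightarrow> V Z holomorphic_on ball 0 r" for Z z
    unfolding V_def by (rule holo2_at_holomorphic_slices[of "ball 0 r" "ball 0 r"]; use r(2) in blast)+
  have bnd: "cmod (U Z z) \<le> 1 \<and> cmod (V Z z) \<le> 1" if "Z \<in> ball 0 r" "z \<in> ball 0 r" for Z z
  proof -
    have "norm (H (Z, z)) < 1" using r(2) that by blast
    then show ?thesis unfolding U_def V_def
      using norm_fst_le[of "fst (H (Z, z))" "snd (H (Z, z))"] norm_snd_le[of "snd (H (Z, z))" "fst (H (Z, z))"] by simp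
  qed
  have jac: "coeff1 U 1 0 * deriv (V 0) 0 \<noteq> deriv (U 0) 0 * coeff1 V 1 0"
  proof -
    have "holo2_at (\<lambda>y. fst (H y)) 0 \<and> holo2_at (\<lambda>y. snd (H y)) 0"
      using eventually_nhds_x_imp_x[OF ev_c] .
    then obtain LU LV where L: "((\<lambda>y. fst (H y)) has_derivative LU) (at 0)" "\<forall>c v w. LU (c * v, c * w) = c * LU (v, w)"
      "((\<lambda>y. snd (H y)) has_derivative LV) (at 0)" "\<forall>c v w. LV (c * v, c * w) = c * LV (v, w)"
      unfolding holo2_at_def by blast
    obtain M1 M2 where M: "((\<lambda>y. fst (K y)) has_derivative M1) (at 0)" "((\<lambda>y. snd (K y)) has_derivative M2) (at 0)"
      using KK unfolding holo2_at_def by blast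
    have KD: "(K has_derivative (\<lambda>v. (M1 v, M2 v))) (at (H 0))"
      using has_derivative_Pair[OF M] by (simp add: H0)
    have "LU (1, 0) * LV (0, 1) \<noteq> LU (0, 1) * LV (1, 0)"
      by (rule jacobian_nonzero[OF L KD ev_KH])
    moreover have "coeff1 U 1 0 = LU (1, 0)" "deriv (U 0) 0 = LU (0, 1)"
      using holo2_at_slices[OF L(1)[unfolded zero_prod_def] L(2)]
      by (simp_all add: coeff1_def U_def[abs_def] DERIV_imp_deriv)
    moreover have "coeff1 V 1 0 = LV (1, 0)" "deriv (V 0) 0 = LV (0, 1)"
      using holo2_at_slices[OF L(3)[unfolded zero_prod_def] L(4)]
      by (simp_all add: coeff1_def V_def[abs_def] DERIV_imp_deriv)
    ultimately show ?thesis by simp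
  qed
  interpret prof: flat_profile "\<lambda>x. flat_fun p (of_real x)" G' G'' q q' q'' \<epsilon> by (rule prof)
  interpret map: profile_map "\<lambda>x. flat_fun p (of_real x)" G' G'' q q' q'' \<epsilon> U V r 1
  proof unfold_locales
    show "Re (U Z z * cis (- q (cmod (V Z z)))) = flat_fun p (of_real (cmod (V Z z)))"
      if "Z \<in> ball 0 r" "z \<in> ball 0 r" "Re (Z * cis (- q (cmod z))) = flat_fun p (of_real (cmod z))" for Z z
      using r(2)[rule_format, OF that(1,2)] that(3) unfolding U_def V_def by simp
  qed (fact r(1) U_holo V_holo UV0 jac conjunct1[OF bnd] conjunct2[OF bnd])+
  define b where "b = map.b"
  have b: "cmod b = 1" unfolding b_def by (rule map.rotation(1))
  have rot: "H (Z, z) = (Z, b * z)" if "Z \<in> ball 0 r" "z \<in> ball 0 r" for Z z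
    using map.rotation(2)[OF that] unfolding U_def V_def b_def by (simp add: prod_eq_iff)
  have bt: "b = cis (Arg b)" using rcis_cmod_Arg[of b] b by (simp add: rcis_def)
  have small: "\<forall>\<^sub>F x in nhds 0. cmod (fst (Phi x)) < r \<and> cmod (snd (Phi x)) < r"
  proof -
    have "((\<lambda>x. norm (Phi x)) \<longlongrightarrow> norm (0 :: complex \<times> complex)) (nhds 0)" by (rule tendsto_norm[OF Phi_lim])
    then have "\<forall>\<^sub>F x in nhds 0. norm (Phi x) < r" by (rule order_tendstoD) (use r(1) in simp)
    then show ?thesis
    proof eventually_elim
      case (elim x)
      then show ?case
        using norm_fst_le[of "fst (Phi x)" "snd (Phi x)"] norm_snd_le[of "snd (Phi x)" "fst (Phi x)"] by simp
    qed
  qed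
  have "\<forall>\<^sub>F x in nhds 0. f x = phi a \<alpha> (Arg b) x"
    using small eventually_domain eventually_compose_filterlim[OF eventually_domain f_lim]
  proof eventually_elim
    case (elim x)
    have "Psi (Phi x) = x" using elim by (intro Psi_Phi) simp
    moreover have "H (Phi x) = (fst (Phi x), b * snd (Phi x))"
      using rot[of "fst (Phi x)" "snd (Phi x)"] elim by simp
    moreover have "snd (Phi x) = snd x" by (simp add: Phi_def)
    ultimately have "Phi (f x) = (fst (Phi x), b * snd x)" unfolding H_def by (simp only:)
    moreover have "Psi (Phi (f x)) = f x" using elim by (intro Psi_Phi) simp
    ultimately have "f x = Psi (fst (Phi x), b * snd x)" by (simp only:)
    also have "\<dots> = flow (Arg b) x"
      unfolding flow_def bt[symmetric] by (simp add: Psi_def Phi_def mult.assoc exp_diff exp_minus divide_inverse)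
    also have "\<dots> = phi a \<alpha> (Arg b) x" using elim by (intro phi_eq_flow[symmetric]) simp
    finally show ?case .
  qed
  then show ?thesis by blast
qed

end

theorem theoremA:
  fixes \<epsilon>\<^sub>0 \<delta>\<^sub>0 \<alpha> :: real
    and a :: "complex \<Rightarrow> complex"
    and c :: "nat \<Rightarrow> complex"
    and p q :: "real \<Rightarrow> real"
  assumes "\<epsilon>\<^sub>0 > 0" and "\<delta>\<^sub>0 > 0"
    and "a holomorphic_on ball 0 \<epsilon>\<^sub>0"
    and "\<exists>z\<in>ball 0 \<epsilon>\<^sub>0. a z \<noteq> 0"
    and "\<And>z. z \<in> ball 0 \<epsilon>\<^sub>0 \<Longrightarrow> (\<lambda>n. c (Suc n) * z ^ Suc n) sums a z"
    and "smooth_on {0<..<\<epsilon>\<^sub>0} p"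
    and "smooth_on {0..<\<epsilon>\<^sub>0} q" and "q 0 = 0"
    and "smooth_on (ball 0 \<epsilon>\<^sub>0) (flat_fun p)"
    and "vanishes_to_infinite_order (flat_fun p) 0"
    and "\<And>z t. z \<in> ball 0 \<epsilon>\<^sub>0 \<Longrightarrow> \<bar>t\<bar> < \<delta>\<^sub>0 \<Longrightarrow> cos (R_fun c q z + \<alpha> * t) \<noteq> 0"
    and "\<And>z. z \<in> ball 0 \<epsilon>\<^sub>0 \<Longrightarrow> 1 + \<alpha> * P1_fun c p q z > 0"
    and "\<exists>r>0. smooth_on (ball 0 r) (P_fun c \<alpha> p q)"
    and "\<exists>r>0. smooth_on (ball 0 r \<times> {-r<..<r}) (\<lambda>(z, t). F_fun c \<alpha> q z t)"
  shows "stability_group (hypersurface \<epsilon>\<^sub>0 \<delta>\<^sub>0 c \<alpha> p q) = {germ (phi a \<alpha> t) | t :: real. True}"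
proof -
  obtain G' G'' q' q'' where prof: "flat_profile (\<lambda>x. flat_fun p (of_real x)) G' G'' q q' q'' \<epsilon>\<^sub>0"
    using flat_profile_of_smooth[OF assms(1,7,8,9,10)] .
  interpret model \<epsilon>\<^sub>0 \<delta>\<^sub>0 \<alpha> a c p q
  proof
    show "continuous (at 0 within {0..<\<epsilon>\<^sub>0}) q"
      by (rule DERIV_continuous[OF flat_profile.q_deriv[OF prof]]) (use assms(1) in simp)
  qed (fact assms)+
  show ?thesis
  proof (intro equalityI subsetI)
    fix F assume "F \<in> stability_group (hypersurface \<epsilon>\<^sub>0 \<delta>\<^sub>0 c \<alpha> p q)"
    then obtain f S T where F: "F = germ f" and f: "biholomorphic2 f S T" "0 \<in> S" "f 0 = 0"
      "\<forall>\<^sub>F x in nhds 0. x \<in> hypersurface \<epsilon>\<^sub>0 \<delta>\<^sub>0 c \<alpha> p q \<longrightarrow> f x \<in> hypersurface \<epsilon>\<^sub>0 \<delta>\<^sub>0 c \<alpha> p q"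
      unfolding stability_group_def by blast
    obtain t where "\<forall>\<^sub>F x in nhds 0. f x = phi a \<alpha> t x"
      using automorphism_is_rotation[OF prof f] by blast
    then show "F \<in> {germ (phi a \<alpha> t) | t :: real. True}"
      unfolding F using germ_eqI by blast
  qed (use phi_in_stability_group in blast)
qed

end
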